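(* Let $s\in(0,1)$, let $n$ be a positive integer with $s<n/2$, and let $\Omega\subset\mathbb{R}^n$ be a bounded domain with smooth boundary. Let $M:[0,+\infty)\to[0,+\infty)$ be a continuous map such that: (i) there exists a constant $m_0$ with $0<m_0\le M(t)$ for all $t\in[0,+\infty)$; (ii) there exists $t_0\ge 0$ such that $\widehat{M}(t)\ge t\,M(t)$ for every $t\in[t_0,+\infty)$, where $\widehat{M}(t):=\int_0^t M(\sigma)\,d\sigma$. Let $f:\overline{\Omega}\times\mathbb{R}\to\mathbb{R}$ be a continuous function such that, with $F(x,\xi):=\int_0^\xi f(x,t)\,dt$: (iii) there exist $c>0$ and $q$ with $2<q<2^*$ such that $|f(x,t)|\le c(1+|t|^{q-1})$ for all $x\in\overline{\Omega}$ and $t\in\mathbb{R}$; (iv) there exist $t_\star>0$ and $\theta>2$ such that $0<\theta F(x,\xi)\le f(x,\xi)\,\xi$ for all $x\in\overline{\Omega}$ and all $|\xi|\ge t_\star$; (v) $\displaystyle\limsup_{t\to 0}\frac{f(x,t)}{t}\le\lambda$ uniformly for $x\in\overline{\Omega}$, for some real number $\lambda<m_0\lambda_{1,s}$. Then the nonlocal problem $$ \begin{cases} M\left(\displaystyle\int_{Q}\frac{|u(x)-u(y)|^2}{|x-y|^{n+2s}}\,dx\,dy\right)(-\Delta)^s u=f(x,u) & \text{in }\Omega,\\ u=0 & \text{in }\mathbb{R}^n\setminus\Omega \end{cases} $$ has at least one nontrivial (i.e. not identically zero) weak solution $u\in X_0$.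
   Context: Notation: $2^*:=2n/(n-2s)$; $\mathcal{C}\Omega:=\mathbb{R}^n\setminus\Omega$; $Q:=(\mathbb{R}^n\times\mathbb{R}^n)\setminus(\mathcal{C}\Omega\times\mathcal{C}\Omega)$. $H^s(\mathbb{R}^n)$ is the space of functions $g\in L^2(\mathbb{R}^n)$ such that $(x,y)\mapsto\frac{g(x)-g(y)}{|x-y|^{n/2+s}}$ belongs to $L^2(\mathbb{R}^n\times\mathbb{R}^n)$, and $$X_0:=\{g\in H^s(\mathbb{R}^n): g=0\text{ a.e. in }\mathbb{R}^n\setminus\Omega\}.$$ The operator $(-\Delta)^s$ is the fractional Laplacian, defined (up to normalization) by $(-\Delta)^s u(x):=-\int_{\mathbb{R}^n}\frac{u(x+y)+u(x-y)-2u(x)}{|y|^{n+2s}}\,dy$. A weak solution of the problem is a function $u\in X_0$ such that for all $\varphi\in X_0$ $$ M\left(\int_{Q}\frac{|u(x)-u(y)|^2}{|x-y|^{n+2s}}\,dx\,dy\right)\int_{Q}\frac{(u(x)-u(y))(\varphi(x)-\varphi(y))}{|x-y|^{n+2s}}\,dx\,dy=\int_\Omega f(x,u(x))\varphi(x)\,dx . $$ $\lambda_{1,s}>0$ is the first eigenvalue of $(-\Delta)^s$ with homogeneous Dirichlet data in $\mathbb{R}^n\setminus\Omega$, characterized by $$ \lambda_{1,s}=\min\left\{\frac{\int_{Q}\frac{|u(x)-u(y)|^2}{|x-y|^{n+2s}}\,dx\,dy}{\int_\Omega|u(x)|^2\,dx}: u\in X_0\setminus\{0\}\right\}. $$ The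 condition $\limsup_{t\to0}f(x,t)/t\le\lambda$ uniformly for $x\in\overline{\Omega}$ means: for every $\varepsilon>0$ there is $\delta_\varepsilon>0$ such that $f(x,t)/t\le\lambda+\varepsilon$ for all $x\in\overline{\Omega}$ and $0<|t|\le\delta_\varepsilon$. *)

theory Defs
  imports "HOL-Analysis.Analysis"
begin

subsection \<open>Bounded domains with smooth boundary\<close>

primrec C_k :: "nat \<Rightarrow> ('a::euclidean_space \<Rightarrow> real) \<Rightarrow> bool" where
  "C_k 0 g \<longleftrightarrow> continuous_on UNIV g"
| "C_k (Suc k) g \<longleftrightarrow> g differentiable_on UNIV \<and>
     (\<forall>b\<in>Basis. C_k k (\<lambda>x. frechet_derivative g (at x) b))"

definition smooth :: "('a::euclidean_space \<Rightarrow> real) \<Rightarrow> bool" where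
  "smooth g \<longleftrightarrow> (\<forall>k. C_k k g)"

text \<open>
  Near each boundary point, the set is the part of a ball lying strictly above the graph of
  a smooth function over a hyperplane. The unit vector \<open>e\<close> is the normal of that hyperplane
  (the last axis, after reorienting the coordinates), and
  \<open>x - (x \<bullet> e) *\<^sub>R e\<close> is the orthogonal projection of \<open>x\<close> to it; only the values of \<open>\<gamma>\<close> on the
  hyperplane matter.
\<close>

definition smooth_boundary :: "'a::euclidean_space set \<Rightarrow> bool" where
  "smooth_boundary \<Omega> \<longleftrightarrow> (\<forall>p\<in>frontier \<Omega>. \<exists>r>0. \<exists>e \<gamma>. norm e = 1 \<and> smooth \<gamma> \<and>
     \<Omega> \<inter> ball p r = {x \<in> ball p r. \<gamma> (x - (x \<bullet> e) *\<^sub>R e) < x \<bullet> e})"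

definition bounded_smooth_domain :: "'a::euclidean_space set \<Rightarrow> bool" where
  "bounded_smooth_domain \<Omega> \<longleftrightarrow>
     \<Omega> \<noteq> {} \<and> open \<Omega> \<and> connected \<Omega> \<and> bounded \<Omega> \<and> smooth_boundary \<Omega>"


subsection \<open>Fractional Sobolev spaces\<close>

text \<open>
  Elements of these spaces are represented by Lebesgue measurable functions; functions that
  agree almost everywhere are the same element, so \<open>u \<noteq> 0\<close> in such a space means that \<open>u\<close> is
  not almost everywhere zero.
\<close>

definition L2 :: "('a::euclidean_space \<Rightarrow> real) set" where
  "L2 = {g. g \<in> borel_measurable lebesgue \<and> integrable lebesgue (\<lambda>x. (g x)\<^sup>2)}"

definition Hs :: "real \<Rightarrow> ((real ^ 'n) \<Rightarrow> real) set" where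
  "Hs s = {g. g \<in> L2 \<and>
     (\<lambda>(x, y). (g x - g y) / norm (x - y) powr (real CARD('n) / 2 + s)) \<in> L2}"

definition X0 :: "real \<Rightarrow> (real ^ 'n) set \<Rightarrow> ((real ^ 'n) \<Rightarrow> real) set" where
  "X0 s \<Omega> = {g. g \<in> Hs s \<and> (AE x in lebesgue. x \<notin> \<Omega> \<longrightarrow> g x = 0)}"

definition Q_region :: "(real ^ 'n) set \<Rightarrow> ((real ^ 'n) \<times> (real ^ 'n)) set" where
  "Q_region \<Omega> = UNIV - (UNIV - \<Omega>) \<times> (UNIV - \<Omega>)"

definition gagliardo ::
  "real \<Rightarrow> (real ^ 'n) set \<Rightarrow> ((real ^ 'n) \<Rightarrow> real) \<Rightarrow> ((real ^ 'n) \<Rightarrow> real) \<Rightarrow> real" where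
  "gagliardo s \<Omega> u \<phi> = (LINT (x, y):Q_region \<Omega>|lebesgue.
     (u x - u y) * (\<phi> x - \<phi> y) / norm (x - y) powr (real CARD('n) + 2 * s))"

definition gagliardo_energy ::
  "real \<Rightarrow> (real ^ 'n) set \<Rightarrow> ((real ^ 'n) \<Rightarrow> real) \<Rightarrow> real" where
  "gagliardo_energy s \<Omega> u = (LINT (x, y):Q_region \<Omega>|lebesgue.
     \<bar>u x - u y\<bar>\<^sup>2 / norm (x - y) powr (real CARD('n) + 2 * s))"

text \<open>On the reals, \<open>LEAST\<close> is the minimum: it is meaningful only if the minimum is attained.\<close>

definition lambda1 :: "real \<Rightarrow> (real ^ 'n) set \<Rightarrow> real" where
  "lambda1 s \<Omega> = (LEAST r. r \<in>
     {gagliardo_energy s \<Omega> u / (LINT x:\<Omega>|lebesgue. \<bar>u x\<bar>\<^sup>2) | u.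
        u \<in> X0 s \<Omega> \<and> \<not> (AE x in lebesgue. u x = 0)})"


subsection \<open>The Kirchhoff problem\<close>

text \<open>
  The integrals over \<open>Q_region \<Omega>\<close> converge for all elements of \<open>X0 s \<Omega>\<close>. For general \<open>f\<close> the one on the
  right-hand side need not, and the integral would then default to 0; hence the explicit
  integrability requirement.
\<close>

definition weak_solution ::
  "real \<Rightarrow> (real ^ 'n) set \<Rightarrow> (real \<Rightarrow> real) \<Rightarrow> ((real ^ 'n) \<Rightarrow> real \<Rightarrow> real)
    \<Rightarrow> ((real ^ 'n) \<Rightarrow> real) \<Rightarrow> bool" where
  "weak_solution s \<Omega> M f u \<longleftrightarrow> u \<in> X0 s \<Omega> \<and> (\<forall>\<phi>\<in>X0 s \<Omega>.
     set_integrable lebesgue \<Omega> (\<lambda>x. f x (u x) * \<phi> x) \<and>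
     M (gagliardo_energy s \<Omega> u) * gagliardo s \<Omega> u \<phi> = (LINT x:\<Omega>|lebesgue. f x (u x) * \<phi> x))"

text \<open>The interval integral is oriented, so negative upper limits \<open>\<xi>\<close> are covered.\<close>

definition primitive :: "(real \<Rightarrow> real) \<Rightarrow> real \<Rightarrow> real" where
  "primitive g \<xi> = (LBINT t=0..ereal \<xi>. g t)"

end

theory Submission
  imports Defs "HOL-Library.Function_Algebras" "HOL-Complex_Analysis.Great_Picard"
begin

text \<open>
  Weak solutions are the critical points of
  \<open>J u = primitive M (\<parallel>u\<parallel>\<^sup>2) / 2 - (\<integral>x\<in>\<Omega>. primitive (f x) (u x))\<close>, and the
  argument is a mountain pass. The gradient of \<open>J\<close> is uniformly continuous on balls, because the
  nonlinear part is uniformly continuous even for the \<open>L\<^sup>2\<close> norm, so a single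
  explicit gradient step \<open>u - \<tau> \<nabla>J u\<close> replaces the usual deformation flow, and
  finite chains of points replace paths. By the Ambrosetti--Rabinowitz condition \<open>J\<close> decreases
  radially wherever it is small and the norm is large; hence the deformation can be
  confined to a ball, where Palais--Smale sequences are bounded for free.

  The embeddings come from averaging over dyadic cubes: the distance in \<open>L\<^sup>2\<close> of \<open>u\<close> from its
  average at scale \<open>2^-k\<close> is at most a multiple of \<open>2^(-ks) \<parallel>u\<parallel>\<close>, while the averages grow at
  most like \<open>2^(k(n/2-s)) \<parallel>u\<parallel>\<close> in the supremum norm. Comparing \<open>u\<close> with the average whose bound
  is about half of \<open>|u(x)|\<close> gives the Sobolev inequality pointwise, before any integration;
  convergence of all averages gives compactness.
\<close>

section \<open>A mountain pass theorem for discrete paths\<close>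

text \<open>Vectors are functions, not classes modulo null sets, so the form is only semidefinite
  and vectors of norm zero need not vanish. Weak convergence enters through just two properties of
  the L2 seminorm \<open>L\<close>: bounded sequences have \<open>L\<close>-convergent subsequences,
  and norm bounds survive \<open>L\<close>-limits. Weak nullity, completeness and the Riesz
  representation are deduced from these two.

  This is why the nonlinear part is always estimated in the form
  \<open>(\<eta> + C * L (u - v)) * N a\<close>. The superlinear growth of f is paid for by an
  arbitrarily small multiple of a bounded Sobolev norm, because an auxiliary exponent p fits
  strictly between q and the critical one; what remains is Lipschitz for L2.

  No end point is prescribed for the chains. Any point of norm at least R ends a chain, and J is
  only asked to be bounded above along one ray. For the Kirchhoff functional this holds because (ii)
  lets the primitive of M grow at most linearly, so that the energy part is at most quadratic on the
  ray, whereas (iv) gives the nonlinear part the power \<theta> > 2.\<close>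

locale semi_inner =
  fixes X :: "'v::real_vector set" and B :: "'v \<Rightarrow> 'v \<Rightarrow> real"
  assumes subspace: "subspace X"
    and B_sym: "\<And>u v. u \<in> X \<Longrightarrow> v \<in> X \<Longrightarrow> B u v = B v u"
    and B_add_left: "\<And>u v w. u \<in> X \<Longrightarrow> v \<in> X \<Longrightarrow> w \<in> X \<Longrightarrow> B (u + v) w = B u w + B v w"
    and B_scale_left: "\<And>r u w. u \<in> X \<Longrightarrow> w \<in> X \<Longrightarrow> B (r *\<^sub>R u) w = r * B u w"
    and B_nonneg: "\<And>u. u \<in> X \<Longrightarrow> 0 \<le> B u u"
begin

section \<open>Calculus of the seminorm\<close>

definition N :: "'v \<Rightarrow> real" where "N u = sqrt (B u u)"

lemma X_closed [simp]:
  "0 \<in> X"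
  "\<And>u v. u \<in> X \<Longrightarrow> v \<in> X \<Longrightarrow> u + v \<in> X"
  "\<And>u v. u \<in> X \<Longrightarrow> v \<in> X \<Longrightarrow> u - v \<in> X"
  "\<And>u r. u \<in> X \<Longrightarrow> r *\<^sub>R u \<in> X"
  "\<And>u. u \<in> X \<Longrightarrow> - u \<in> X"
  using subspace by (auto simp: subspace_0 subspace_add subspace_diff subspace_scale subspace_neg)

lemma B_add_right: "u \<in> X \<Longrightarrow> v \<in> X \<Longrightarrow> w \<in> X \<Longrightarrow> B w (u + v) = B w u + B w v"
  by (metis B_add_left B_sym X_closed(2))

lemma B_scale_right: "u \<in> X \<Longrightarrow> w \<in> X \<Longrightarrow> B w (r *\<^sub>R u) = r * B w u"
  by (metis B_scale_left B_sym X_closed(4))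

lemma B_minus_left: "u \<in> X \<Longrightarrow> w \<in> X \<Longrightarrow> B (- u) w = - B u w"
  using B_scale_left[of u w "-1"] by simp

lemma B_minus_right: "u \<in> X \<Longrightarrow> w \<in> X \<Longrightarrow> B w (- u) = - B w u"
  using B_scale_right[of u w "-1"] by simp

lemma B_diff_left: "u \<in> X \<Longrightarrow> v \<in> X \<Longrightarrow> w \<in> X \<Longrightarrow> B (u - v) w = B u w - B v w"
  using B_add_left[of u "- v" w] B_minus_left[of v w] by simp

lemma B_diff_right: "u \<in> X \<Longrightarrow> v \<in> X \<Longrightarrow> w \<in> X \<Longrightarrow> B w (u - v) = B w u - B w v"
  using B_add_right[of u "- v" w] B_minus_right[of v w] by simp

lemmas B_simps = B_add_left B_add_right B_scale_left B_scale_right B_minus_left B_minus_right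
  B_diff_left B_diff_right

lemma B_zero [simp]: "u \<in> X \<Longrightarrow> B u 0 = 0" "u \<in> X \<Longrightarrow> B 0 u = 0"
  using B_scale_left[of 0 u 0] B_scale_right[of 0 u 0] by simp_all

lemma N_nonneg [simp]: "u \<in> X \<Longrightarrow> 0 \<le> N u"
  by (simp add: N_def B_nonneg)

lemma N_sq: "u \<in> X \<Longrightarrow> (N u)\<^sup>2 = B u u"
  by (simp add: N_def B_nonneg)

lemma N_zero [simp]: "N 0 = 0"
  by (simp add: N_def)

lemma N_scale: "u \<in> X \<Longrightarrow> N (r *\<^sub>R u) = \<bar>r\<bar> * N u"
  by (simp add: N_def B_simps mult.assoc[symmetric] real_sqrt_mult flip: power2_eq_square)

lemma N_minus: "u \<in> X \<Longrightarrow> N (- u) = N u"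
  using N_scale[of u "-1"] by simp

lemma N_diff_commute: "u \<in> X \<Longrightarrow> v \<in> X \<Longrightarrow> N (u - v) = N (v - u)"
  using N_minus[of "u - v"] by simp

lemma N_add_sq: "u \<in> X \<Longrightarrow> v \<in> X \<Longrightarrow> (N (u + v))\<^sup>2 = (N u)\<^sup>2 + 2 * B u v + (N v)\<^sup>2"
  by (simp add: N_sq B_simps B_sym)

lemma N_diff_sq: "u \<in> X \<Longrightarrow> v \<in> X \<Longrightarrow> (N (u - v))\<^sup>2 = (N u)\<^sup>2 - 2 * B u v + (N v)\<^sup>2"
  by (simp add: N_sq B_simps B_sym)

text \<open>The square of \<open>N (u + t *\<^sub>R v)\<close> is nonnegative for every t. If
  \<open>N v = 0\<close> it is affine in t, and a nonzero slope is refuted by the t at which it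
  would equal -1; otherwise the minimising t is inserted.\<close>

lemma Cauchy_Schwarz:
  assumes [simp]: "u \<in> X" "v \<in> X"
  shows "\<bar>B u v\<bar> \<le> N u * N v"
proof -
  have q: "0 \<le> (N u)\<^sup>2 + 2 * t * B u v + t\<^sup>2 * (N v)\<^sup>2" for t
    using N_add_sq[of u "t *\<^sub>R v"] zero_le_power2[of "N (u + t *\<^sub>R v)"]
    by (simp add: B_simps N_scale power_mult_distrib)
  show ?thesis
  proof (cases "N v = 0")
    case True
    have "B u v = 0"
    proof (rule ccontr)
      assume "B u v \<noteq> 0"
      then show False
        using q[of "- ((N u)\<^sup>2 + 1) / (2 * B u v)"] True zero_le_power2[of "N u"]
          by (simp add: field_simps del: zero_le_power2)
    qed
    then show ?thesis using True by simp
  next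
    case False
    have "(B u v)\<^sup>2 \<le> (N u)\<^sup>2 * (N v)\<^sup>2"
      using q[of "- B u v / (N v)\<^sup>2"] False
      by (simp add: field_simps power2_eq_square zero_le_divide_iff)
         (smt (verit) mult_pos_pos zero_less_mult_iff not_real_square_gt_zero)
    then show ?thesis
      by (metis N_nonneg abs_le_square_iff abs_mult abs_of_nonneg assms power_mult_distrib)
  qed
qed

lemma B_le: "u \<in> X \<Longrightarrow> v \<in> X \<Longrightarrow> B u v \<le> N u * N v"
  using Cauchy_Schwarz by fastforce

lemma N_triangle:
  assumes [simp]: "u \<in> X" "v \<in> X"
  shows "N (u + v) \<le> N u + N v"
proof (rule power2_le_imp_le)
  show "(N (u + v))\<^sup>2 \<le> (N u + N v)\<^sup>2"
    using B_le[of u v] by (simp add: N_add_sq power2_sum)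
qed simp

lemma N_triangle_diff:
  assumes "u \<in> X" "v \<in> X"
  shows "N (u - v) \<le> N u + N v"
  using N_triangle[of u "- v"] assms by (simp add: N_minus)

lemma N_diff_bound:
  assumes "u \<in> X" "v \<in> X"
  shows "\<bar>N u - N v\<bar> \<le> N (u - v)"
  using N_triangle[of "u - v" v] N_triangle[of "v - u" u] N_diff_commute[of u v] assms by auto

text \<open>Discrete paths from the origin: a point of norm at least \<open>R\<close> has no successor.\<close>

inductive_set reach :: "('v \<Rightarrow> real) \<Rightarrow> real \<Rightarrow> real \<Rightarrow> real \<Rightarrow> 'v set"
  for J R a d where
  reach_0: "0 \<in> reach J R a d"
| reach_step: "u \<in> reach J R a d \<Longrightarrow> N u < R \<Longrightarrow> v \<in> X \<Longrightarrow> J v \<le> a \<Longrightarrow> N (v - u) \<le> d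
    \<Longrightarrow> v \<in> reach J R a d"

text \<open>Discrete counterpart of a path from the origin to norm R inside the sublevel set of a.
  The step length must be arbitrarily small, since only then is a chain unable to jump over a
  barrier.\<close>

definition linked :: "('v \<Rightarrow> real) \<Rightarrow> real \<Rightarrow> real \<Rightarrow> bool" where
  "linked J R a \<longleftrightarrow> (\<forall>d>0. \<exists>u\<in>reach J R a d. R \<le> N u)"

lemma reach_in: "u \<in> reach J R a d \<Longrightarrow> u \<in> X"
  by (induction rule: reach.induct) auto

lemma reach_le: "u \<in> reach J R a d \<Longrightarrow> J 0 \<le> a \<Longrightarrow> J u \<le> a"
  by (induction rule: reach.induct) auto

lemma reach_norm:
  assumes "u \<in> reach J R a d" "0 \<le> d" "0 < R"
  shows "N u \<le> R + d"
  using assms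
proof (induction rule: reach.induct)
  case (reach_step u v)
  then show ?case
    using N_diff_bound[of v u] reach_in[OF reach_step.hyps(1)] by force
qed auto

lemma reach_mono:
  assumes "u \<in> reach J R a d" "a \<le> a'" "d \<le> d'"
  shows "u \<in> reach J R a' d'"
  using assms(1)
proof (induction rule: reach.induct)
  case reach_0
  show ?case by (rule reach.reach_0)
next
  case (reach_step u v)
  show ?case by (rule reach.reach_step[OF reach_step.IH]) (use reach_step assms in auto)
qed

lemma linked_mono: "linked J R a \<Longrightarrow> a \<le> a' \<Longrightarrow> linked J R a'"
  unfolding linked_def using reach_mono[of _ J R a _ a'] by blast

lemma linked_ray:
  assumes e: "e \<in> X" "N e > 0" and "0 < R" and J: "\<And>t. 0 \<le> t \<Longrightarrow> J (t *\<^sub>R e) \<le> a"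
  shows "linked J R a"
  unfolding linked_def
proof (intro allI impI)
  fix d :: real assume d: "d > 0"
  \<comment> \<open>Neighbouring multiples of h along the ray are then exactly d apart.\<close>
  define h where "h = d / N e"
  have h: "h > 0" "h * N e = d" using d e by (auto simp: h_def)
  \<comment> \<open>The alternative is forced by the definition of \<open>reach\<close>: once a
    point has norm at least R, the chain cannot be continued.\<close>
  have step: "(\<exists>u\<in>reach J R a d. R \<le> N u) \<or> (of_nat k * h) *\<^sub>R e \<in> reach J R a d" for k :: nat
  proof (induction k)
    case 0
    then show ?case using reach_0 by simp
  next
    case (Suc k)
    show ?case
    proof (cases "\<exists>u\<in>reach J R a d. R \<le> N u")
      case False
      with Suc have r: "(of_nat k * h) *\<^sub>R e \<in> reach J R a d" by blast
      have diff: "(of_nat (Suc k) * h) *\<^sub>R e - (of_nat k * h) *\<^sub>R e = h *\<^sub>R e"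
        by (simp add: algebra_simps)
      have "(of_nat (Suc k) * h) *\<^sub>R e \<in> reach J R a d"
      proof (rule reach_step[OF r])
        show "N ((of_nat k * h) *\<^sub>R e) < R" using False r by force
        show "J ((of_nat (Suc k) * h) *\<^sub>R e) \<le> a" using J h by simp
        show "N ((of_nat (Suc k) * h) *\<^sub>R e - (of_nat k * h) *\<^sub>R e) \<le> d"
          unfolding diff using h e by (simp add: N_scale)
      qed (use e in simp)
      then show ?thesis by blast
    qed auto
  qed
  obtain k :: nat where k: "R / d < of_nat k" using reals_Archimedean2 by blast
  have "N ((of_nat k * h) *\<^sub>R e) = of_nat k * d"
    using h e by (simp add: N_scale abs_mult mult.assoc)
  moreover have "R < of_nat k * d" using k d by (simp add: field_simps)
  ultimately show "\<exists>u\<in>reach J R a d. R \<le> N u" using step[of k] by force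
qed

text \<open>A chain whose steps are at most the width of the ring cannot cross it without visiting
  it. Below the level \<alpha> it may not visit it, so it stays inside the inner radius.\<close>

lemma linked_ge:
  assumes "linked J R a" "0 < \<rho>1" "\<rho>1 < \<rho>2" "\<rho>2 \<le> R" "J 0 \<le> a"
    and ring: "\<And>u. u \<in> X \<Longrightarrow> \<rho>1 \<le> N u \<Longrightarrow> N u \<le> \<rho>2 \<Longrightarrow> \<alpha> \<le> J u"
  shows "\<alpha> \<le> a"
proof (rule ccontr)
  assume *: "\<not> \<alpha> \<le> a"
  have "N u < \<rho>1" if "u \<in> reach J R a (\<rho>2 - \<rho>1)" for u
    using that
  proof (induction rule: reach.induct)
    case (reach_step u v)
    have "N v \<le> \<rho>2"
      using N_diff_bound[of v u] reach_in[OF reach_step.hyps(1)] reach_step by force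
    then show ?case using ring[of v] reach_step * by force
  qed (use assms in auto)
  then show False
    using assms unfolding linked_def by (metis diff_gt_0_iff_gt dual_order.trans not_le order_less_imp_le)
qed

text \<open>c is the infimum of the levels at which the origin is linked to norm R. Without almost
  critical points near c, a single truncated gradient step maps every fine chain at a level slightly
  above c to a chain at a level slightly below c.\<close>

theorem mountain_pass:
  assumes V: "\<And>u. u \<in> X \<Longrightarrow> V u \<in> X"
    and V_unif: "\<And>\<epsilon>. \<epsilon> > 0 \<Longrightarrow> \<exists>\<delta>>0. \<forall>u\<in>X. \<forall>v\<in>X. N u \<le> R + 1 \<longrightarrow> N v \<le> R + 1 \<longrightarrow> N (u - v) \<le> \<delta>
      \<longrightarrow> N (V u - V v) \<le> \<epsilon>"
    and V_bound: "\<And>u. u \<in> X \<Longrightarrow> N u \<le> R + 1 \<Longrightarrow> N (V u) \<le> K"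
    and J_deriv: "\<And>\<epsilon>. \<epsilon> > 0 \<Longrightarrow> \<exists>\<delta>>0. \<forall>u\<in>X. \<forall>h\<in>X. N u \<le> R + 1 \<longrightarrow> N h \<le> \<delta>
      \<longrightarrow> \<bar>J (u + h) - J u - B (V u) h\<bar> \<le> \<epsilon> * N h"
    and J_0: "J 0 = 0"
    and ring: "0 < \<rho>1" "\<rho>1 < \<rho>2" "\<rho>2 \<le> R" "0 < \<alpha>"
      "\<And>u. u \<in> X \<Longrightarrow> \<rho>1 \<le> N u \<Longrightarrow> N u \<le> \<rho>2 \<Longrightarrow> \<alpha> \<le> J u"
    and ray: "e \<in> X" "N e > 0" "\<And>t. 0 \<le> t \<Longrightarrow> J (t *\<^sub>R e) \<le> C0"
    and out: "\<And>u. u \<in> X \<Longrightarrow> R \<le> N u \<Longrightarrow> N u \<le> R + 1 \<Longrightarrow> J u \<le> C0 + 1 \<Longrightarrow> B (V u) u \<le> 0"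
  shows "\<exists>c\<ge>\<alpha>. \<forall>\<epsilon>>0. \<exists>u\<in>X. N u \<le> R + 1 \<and> \<bar>J u - c\<bar> \<le> \<epsilon> \<and> N (V u) \<le> \<epsilon>"
proof -
  have R: "0 < R" using ring by linarith
  \<comment> \<open>The condition \<open>0 \<le> a\<close> puts the origin into the sublevel set, as
    \<open>linked_ge\<close> requires.\<close>
  define A where "A = {a. 0 \<le> a \<and> linked J R a}"
  define c where "c = Inf A"
  have C0: "C0 \<in> A"
    using linked_ray[OF ray(1,2) R, of J C0] ray(3)[of 0] ray(3) J_0 by (auto simp: A_def)
  have A_ge: "\<alpha> \<le> a" if "a \<in> A" for a
    using that linked_ge[of J R a \<rho>1 \<rho>2 \<alpha>] ring J_0 by (auto simp: A_def)
  have bdd: "bdd_below A" using A_ge by (rule bdd_belowI)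
  have c_ge: "\<alpha> \<le> c" unfolding c_def using C0 A_ge by (intro cInf_greatest) auto
  have c_le: "c \<le> C0" unfolding c_def using C0 bdd by (rule cInf_lower)
  have "\<exists>u\<in>X. N u \<le> R + 1 \<and> \<bar>J u - c\<bar> \<le> \<epsilon> \<and> N (V u) \<le> \<epsilon>" if "\<epsilon> > 0" for \<epsilon>
  proof (rule ccontr)
    assume neg: "\<not> ?thesis"
    \<comment> \<open>The bound \<open>c / 2\<close> keeps the origin, where J is 0, below the
      cutoff and the lowered level nonnegative; the bound 1 keeps all levels below
      \<open>C0 + 1\<close>, where \<open>out\<close> applies.\<close>
    define e0 where "e0 = min \<epsilon> (min (c / 2) 1)"
    have e0: "e0 > 0" "e0 \<le> \<epsilon>" "e0 \<le> c / 2" "e0 \<le> 1" using that c_ge ring by (auto simp: e0_def)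
    have V_big: "e0 \<le> N (V u)" if "u \<in> X" "N u \<le> R + 1" "\<bar>J u - c\<bar> \<le> e0" for u
      using neg that e0 by force
    have K: "0 \<le> K" using order_trans[OF N_nonneg[OF V[of 0]] V_bound[of 0]] R by simp
    obtain d1 where d1: "d1 > 0" "\<And>u h. u \<in> X \<Longrightarrow> h \<in> X \<Longrightarrow> N u \<le> R + 1 \<Longrightarrow> N h \<le> d1
      \<Longrightarrow> \<bar>J (u + h) - J u - B (V u) h\<bar> \<le> (e0 / 2) * N h"
      using J_deriv[of "e0 / 2"] e0 by auto
    \<comment> \<open>A gradient step of this size has length at most d1, within which the first
      order expansion of J holds.\<close>
    define \<tau> where "\<tau> = d1 / (K + 1)"
    have \<tau>: "\<tau> > 0" using d1 K by (simp add: \<tau>_def)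
    have \<tau>K: "\<tau> * K \<le> d1" using d1 K by (simp add: \<tau>_def field_simps)
    \<comment> \<open>A piecewise linear cutoff, 0 below \<open>c - e0\<close> and 1 above
      \<open>c - e0 / 2\<close>. It fixes the origin and varies with J in a Lipschitz way, so that
      neighbouring points are moved by similar amounts.\<close>
    define cut where "cut x = min 1 (max 0 ((x - (c - e0)) * (2 / e0)))" for x
    have cut01: "0 \<le> cut x" "cut x \<le> 1" for x by (auto simp: cut_def)
    have lin: "(x - (c - e0)) * k - (y - (c - e0)) * k = k * (x - y)" for x y k :: real
      by (simp add: algebra_simps)
    have cut_lip: "\<bar>cut x - cut y\<bar> \<le> (2 / e0) * \<bar>x - y\<bar>" for x y
    proof -
      have "\<bar>cut x - cut y\<bar> \<le> \<bar>(x - (c - e0)) * (2 / e0) - (y - (c - e0)) * (2 / e0)\<bar>"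
        unfolding cut_def by linarith
      also have "\<dots> = \<bar>(2 / e0) * (x - y)\<bar>" by (simp only: lin)
      also have "\<dots> = (2 / e0) * \<bar>x - y\<bar>" using e0 by (subst abs_mult) simp
      finally show ?thesis .
    qed
    have cut_0: "cut x = 0" if "x \<le> c - e0" for x
    proof -
      have "(x - (c - e0)) * (2 / e0) \<le> 0" using that e0 by (intro mult_nonpos_nonneg) auto
      then show ?thesis by (simp only: cut_def)
    qed
    have cut_1: "cut x = 1" if "c - e0 / 2 \<le> x" for x
    proof -
      have "(x - (c - e0)) * (2 / e0) \<ge> e0 / 2 * (2 / e0)"
        using that e0 by (intro mult_right_mono) auto
      then show ?thesis using e0 by (simp add: cut_def)
    qed
    define \<eta> where "\<eta> u = u - (\<tau> * cut (J u)) *\<^sub>R V u" for u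
    have \<eta>X: "\<eta> u \<in> X" if "u \<in> X" for u using that V by (simp add: \<eta>_def)
    have \<eta>0: "\<eta> 0 = 0"
      using cut_0[of 0] e0 J_0 c_ge ring by (simp add: \<eta>_def)
    \<comment> \<open>With t the truncated step size, the linear term lowers J by t times the square
      of \<open>N (V u)\<close>. The expansion error is at most \<open>e0 / 2\<close> times the step
      length, and \<open>N (V u) \<ge> e0\<close> makes the gain win.\<close>
    have dec: "J (\<eta> u) \<le> J u - \<tau> * cut (J u) * e0\<^sup>2 / 2"
      if u: "u \<in> X" "N u \<le> R + 1" and Ju: "J u \<le> c + e0" for u
    proof (cases "cut (J u) = 0")
      case True
      then show ?thesis by (simp add: \<eta>_def)
    next
      case False
      then have "\<bar>J u - c\<bar> \<le> e0" using cut_0[of "J u"] Ju by linarith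
      then have big: "e0 \<le> N (V u)" using V_big u by blast
      define t where "t = \<tau> * cut (J u)"
      have t: "0 \<le> t" "t \<le> \<tau>" using \<tau> cut01[of "J u"] by (auto simp: t_def mult_left_le)
      have Nh: "N (- (t *\<^sub>R V u)) = t * N (V u)"
        using V u t by (simp add: N_minus N_scale)
      have "t * N (V u) \<le> \<tau> * K"
        using t \<tau> V_bound[OF u] V u by (intro mult_mono) auto
      then have "\<bar>J (u + - (t *\<^sub>R V u)) - J u - B (V u) (- (t *\<^sub>R V u))\<bar> \<le> e0 / 2 * (t * N (V u))"
        using d1(2)[of u "- (t *\<^sub>R V u)"] u V \<tau>K by (simp add: Nh)
      moreover have "B (V u) (- (t *\<^sub>R V u)) = - t * (N (V u))\<^sup>2"
        using u V by (simp add: B_simps N_sq)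
      ultimately have "J (\<eta> u) \<le> J u - t * (N (V u))\<^sup>2 + e0 / 2 * (t * N (V u))"
        unfolding \<eta>_def t_def[symmetric] by (simp only: diff_conv_add_uminus)
      also have "\<dots> = J u - t * (N (V u) * (N (V u) - e0 / 2))"
        by (simp add: power2_eq_square algebra_simps)
      also have "\<dots> \<le> J u - t * (e0 * (e0 / 2))"
        using big e0 t by (intro diff_mono order_refl mult_left_mono mult_mono) auto
      finally show ?thesis by (simp add: t_def power2_eq_square)
    qed
    obtain d2 where d2: "d2 > 0" "\<And>u h. u \<in> X \<Longrightarrow> h \<in> X \<Longrightarrow> N u \<le> R + 1 \<Longrightarrow> N h \<le> d2
      \<Longrightarrow> \<bar>J (u + h) - J u - B (V u) h\<bar> \<le> 1 * N h"
      using J_deriv[of 1] by auto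
    have J_lip: "\<bar>J v - J u\<bar> \<le> (K + 1) * N (v - u)"
      if "u \<in> X" "v \<in> X" "N u \<le> R + 1" "N (v - u) \<le> d2" for u v
    proof -
      have "\<bar>J (u + (v - u)) - J u - B (V u) (v - u)\<bar> \<le> 1 * N (v - u)"
        using d2(2)[of u "v - u"] that by simp
      moreover have "\<bar>B (V u) (v - u)\<bar> \<le> K * N (v - u)"
        using Cauchy_Schwarz[of "V u" "v - u"] V_bound[of u] V[of u] that
        by (meson X_closed(3) N_nonneg mult_right_mono order_trans)
      ultimately show ?thesis by (simp add: algebra_simps)
    qed
    \<comment> \<open>Factor for the part of the change of \<eta> that is linear in the distance: 1
      from the identity, the rest from the cutoff through the Lipschitz bound of J. The variation of
      V is merely small and gets the other half of d.\<close>
    define Lc where "Lc = 1 + \<tau> * ((2 / e0) * (K + 1)) * K"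
    have Lc: "Lc \<ge> 1" using \<tau> e0 K by (simp add: Lc_def)
    \<comment> \<open>Where the cutoff is 1 the gain is at least \<open>2 * \<epsilon>2\<close>;
      elsewhere J is already below \<open>c - e0 / 2\<close>, hence below
      \<open>c - \<epsilon>2\<close>.\<close>
    define \<epsilon>2 where "\<epsilon>2 = min e0 (min (e0 / 2) (\<tau> * e0\<^sup>2 / 4))"
    have \<epsilon>2: "\<epsilon>2 > 0" "\<epsilon>2 \<le> e0" "\<epsilon>2 \<le> e0 / 2" "\<epsilon>2 \<le> \<tau> * e0\<^sup>2 / 4" using e0 \<tau> by (auto simp: \<epsilon>2_def)
    have low: "J (\<eta> u) \<le> c - \<epsilon>2" if u: "u \<in> X" "N u \<le> R + 1" and Ju: "J u \<le> c + \<epsilon>2" for u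
    proof (cases "c - e0 / 2 \<le> J u")
      case True
      then show ?thesis using dec[OF u] Ju \<epsilon>2 cut_1[OF True] by simp
    next
      case False
      have "J (\<eta> u) \<le> J u - \<tau> * cut (J u) * e0\<^sup>2 / 2" using dec[OF u] Ju \<epsilon>2 by simp
      also have "\<dots> \<le> J u" using \<tau> cut01[of "J u"] by simp
      finally show ?thesis using False \<epsilon>2 by linarith
    qed
    have lk: "linked J R (c - \<epsilon>2)"
      unfolding linked_def
    proof (intro allI impI)
      fix d :: real assume d: "d > 0"
      obtain d3 where d3: "d3 > 0" "\<And>u v. u \<in> X \<Longrightarrow> v \<in> X \<Longrightarrow> N u \<le> R + 1 \<Longrightarrow> N v \<le> R + 1
        \<Longrightarrow> N (u - v) \<le> d3 \<Longrightarrow> N (V u - V v) \<le> d / (2 * \<tau>)"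
        using V_unif[of "d / (2 * \<tau>)"] d \<tau> by auto
      \<comment> \<open>Step length of the chain before deformation. The entry 1 keeps the last
        point, which may overshoot R by one step, inside radius \<open>R + 1\<close>.\<close>
      define d' where "d' = min (min 1 d2) (min d3 (d / (2 * Lc)))"
      have d': "d' > 0" "d' \<le> 1" "d' \<le> d2" "d' \<le> d3" "d' \<le> d / (2 * Lc)"
        using d d2 d3 Lc by (auto simp: d'_def)
      have d'': "Lc * d' \<le> d / 2"
        using mult_left_mono[OF d'(5), of Lc] Lc by simp
      have \<eta>_close: "N (\<eta> v - \<eta> u) \<le> d"
        if uv: "u \<in> X" "v \<in> X" "N u \<le> R + 1" "N v \<le> R + 1" "N (v - u) \<le> d'" for u v
      proof -
        let ?a = "\<tau> * (cut (J v) - cut (J u))" and ?b = "\<tau> * cut (J u)"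
        have eq: "\<eta> v - \<eta> u = (v - u) - (?a *\<^sub>R V v + ?b *\<^sub>R (V v - V u))"
          by (simp add: \<eta>_def algebra_simps)
        have "N (\<eta> v - \<eta> u) \<le> N (v - u) + N (?a *\<^sub>R V v + ?b *\<^sub>R (V v - V u))"
          unfolding eq using uv V by (intro N_triangle_diff) auto
        also have "\<dots> \<le> N (v - u) + (N (?a *\<^sub>R V v) + N (?b *\<^sub>R (V v - V u)))"
          using uv V by (intro add_left_mono N_triangle) auto
        also have "N (?a *\<^sub>R V v) \<le> (\<tau> * ((2 / e0) * ((K + 1) * d'))) * K"
        proof -
          have "\<bar>?a\<bar> = \<tau> * \<bar>cut (J v) - cut (J u)\<bar>" using \<tau> by (simp add: abs_mult)
          also have "\<dots> \<le> \<tau> * ((2 / e0) * \<bar>J v - J u\<bar>)"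
            using \<tau> cut_lip by (intro mult_left_mono) auto
          also have "\<dots> \<le> \<tau> * ((2 / e0) * ((K + 1) * d'))"
          proof -
            have "\<bar>J v - J u\<bar> \<le> (K + 1) * N (v - u)" using J_lip uv d' by simp
            also have "\<dots> \<le> (K + 1) * d'" using K uv by (intro mult_left_mono) auto
            finally show ?thesis using \<tau> e0 by (intro mult_left_mono) auto
          qed
          finally have "\<bar>?a\<bar> \<le> \<tau> * ((2 / e0) * ((K + 1) * d'))" .
          from mult_mono[OF this V_bound[of v]] have "\<bar>?a\<bar> * N (V v) \<le> (\<tau> * ((2 / e0) * ((K + 1) * d'))) * K"
            using uv V K \<tau> e0 d' by simp
          then show ?thesis using N_scale[OF V[of v], of ?a] uv by simp
        qed
        also have "N (?b *\<^sub>R (V v - V u)) \<le> \<tau> * (d / (2 * \<tau>))"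
        proof -
          have "\<bar>?b\<bar> \<le> \<tau>" using \<tau> cut01[of "J u"] by (simp add: abs_mult mult_left_le)
          moreover have "N (V v - V u) \<le> d / (2 * \<tau>)" using d3(2)[of v u] uv d' by simp
          ultimately have "\<bar>?b\<bar> * N (V v - V u) \<le> \<tau> * (d / (2 * \<tau>))"
            using uv \<tau> V by (intro mult_mono) auto
          then show ?thesis using N_scale[of "V v - V u" ?b] uv V by simp
        qed
        finally have "N (\<eta> v - \<eta> u) \<le> N (v - u) + (\<tau> * (2 / e0 * ((K + 1) * d')) * K + \<tau> * (d / (2 * \<tau>)))"
          by simp
        also have "\<dots> \<le> d' + (\<tau> * (2 / e0 * ((K + 1) * d')) * K + \<tau> * (d / (2 * \<tau>)))"
          using uv by simp
        also have "\<dots> = Lc * d' + d / 2" using \<tau> by (simp add: Lc_def algebra_simps)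
        finally show ?thesis using d'' by linarith
      qed
      have "linked J R (c + \<epsilon>2)"
      proof -
        obtain a where "a \<in> A" "a < c + \<epsilon>2"
          using cInf_lessD[of A "c + \<epsilon>2"] C0 \<epsilon>2 unfolding c_def by auto
        then show ?thesis using linked_mono[of J R a "c + \<epsilon>2"] by (simp add: A_def)
      qed
      then obtain u where u: "u \<in> reach J R (c + \<epsilon>2) d'" "R \<le> N u"
        using d' unfolding linked_def by blast
      have J0': "J 0 \<le> c + \<epsilon>2" using J_0 c_ge ring \<epsilon>2 by simp
      have ok: "N w \<le> R + 1" "w \<in> X" "J w \<le> c + \<epsilon>2" if "w \<in> reach J R (c + \<epsilon>2) d'" for w
        using reach_norm[OF that] d' R reach_in[OF that] reach_le[OF that J0'] by auto
      \<comment> \<open>The image of a chain is a chain as long as no image point has norm R or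
        more; if one has, the image already ends there and the goal is reached early.\<close>
      have "\<eta> w \<in> reach J R (c - \<epsilon>2) d \<or> (\<exists>w'\<in>reach J R (c - \<epsilon>2) d. R \<le> N w')"
        if "w \<in> reach J R (c + \<epsilon>2) d'" for w
        using that
      proof (induction rule: reach.induct)
        case reach_0
        then show ?case using reach.reach_0 by (simp add: \<eta>0)
      next
        case (reach_step x y)
        have y: "y \<in> reach J R (c + \<epsilon>2) d'"
          by (rule reach.reach_step[OF reach_step.hyps(1)]) (use reach_step.hyps in auto)
        show ?case
        proof (cases "\<exists>w'\<in>reach J R (c - \<epsilon>2) d. R \<le> N w'")
          case False
          then have x: "\<eta> x \<in> reach J R (c - \<epsilon>2) d" using reach_step by blast
          have "\<eta> y \<in> reach J R (c - \<epsilon>2) d"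
          proof (rule reach.reach_step[OF x])
            show "N (\<eta> x) < R" using False x by force
            show "\<eta> y \<in> X" using ok[OF y] \<eta>X by blast
            show "J (\<eta> y) \<le> c - \<epsilon>2" using low ok[OF y] by blast
            show "N (\<eta> y - \<eta> x) \<le> d"
              using \<eta>_close ok[OF y] ok[OF reach_step.hyps(1)] reach_step.hyps by blast
          qed
          then show ?thesis by blast
        qed blast
      qed
      from this[OF u(1)] show "\<exists>u\<in>reach J R (c - \<epsilon>2) d. R \<le> N u"
      proof
        assume *: "\<eta> u \<in> reach J R (c - \<epsilon>2) d"
        \<comment> \<open>The sign of \<open>B (V u) u\<close> makes the gradient step nondecreasing
          in norm, so the image of an end point is again an end point.\<close>
        have ou: "B (V u) u \<le> 0"
          using out ok[OF u(1)] u(2) \<epsilon>2 e0 c_le by auto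
        let ?t = "\<tau> * cut (J u)"
        have "(N (\<eta> u))\<^sup>2 = (N u)\<^sup>2 - 2 * ?t * B (V u) u + ?t\<^sup>2 * (N (V u))\<^sup>2"
          unfolding \<eta>_def using ok[OF u(1)] V B_sym[of u "V u"]
          by (simp add: N_diff_sq B_simps N_scale power_mult_distrib)
        moreover have "?t * B (V u) u \<le> 0"
          using ou \<tau> cut01[of "J u"] by (simp add: mult_nonneg_nonpos)
        moreover have "0 \<le> ?t\<^sup>2 * (N (V u))\<^sup>2" by simp
        ultimately have "(N u)\<^sup>2 \<le> (N (\<eta> u))\<^sup>2" by linarith
        then have "N u \<le> N (\<eta> u)" by (rule power2_le_imp_le) (use \<eta>X ok[OF u(1)] in auto)
        then show ?thesis using * u(2) order_trans by (intro bexI[of _ "\<eta> u"]) auto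
      qed
    qed
    have "c - \<epsilon>2 \<in> A" using lk e0 \<epsilon>2 by (simp add: A_def)
    then have "c \<le> c - \<epsilon>2" unfolding c_def using bdd by (rule cInf_lower)
    then show False using \<epsilon>2 by simp
  qed
  then show ?thesis using c_ge by blast
qed

end

section \<open>Kirchhoff functionals on compactly embedded spaces\<close>

text \<open>\<open>L\<close> plays the role of the L2 seminorm. \<open>compact\<close> is the
  compact embedding, and \<open>lsc\<close> says that closed balls of \<open>N\<close> are closed
  under \<open>L\<close>-convergence of sequences.\<close>

locale compact_embedding = semi_inner +
  fixes L :: "'a \<Rightarrow> real"
  assumes L_scale: "\<And>u r. u \<in> X \<Longrightarrow> L (r *\<^sub>R u) = \<bar>r\<bar> * L u"
    and compact: "\<And>u K. (\<And>j::nat. u j \<in> X) \<Longrightarrow> (\<And>j. N (u j) \<le> K) \<Longrightarrow>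
      \<exists>r v. strict_mono (r :: nat \<Rightarrow> nat) \<and> v \<in> X \<and> (\<lambda>j. L (u (r j) - v)) \<longlonglongrightarrow> 0"
    and lsc: "\<And>u v K. (\<And>j::nat. u j \<in> X) \<Longrightarrow> v \<in> X \<Longrightarrow> (\<And>j. N (u j) \<le> K) \<Longrightarrow>
      (\<lambda>j. L (u j - v)) \<longlonglongrightarrow> 0 \<Longrightarrow> N v \<le> K"
begin

section \<open>Weak convergence, completeness and duality\<close>

lemma L_minus: "u \<in> X \<Longrightarrow> L (- u) = L u"
  using L_scale[of u "-1"] by simp

text \<open>Otherwise \<open>\<phi> + t *\<^sub>R w j\<close>, which tends to \<open>\<phi>\<close> for \<open>L\<close>, would have norm below that of \<open>\<phi>\<close>
  for small \<open>t\<close>, against lower semicontinuity.\<close>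

lemma weak_null_upper:
  assumes w: "\<And>j::nat. w j \<in> X" "\<And>j. N (w j) \<le> K" "(\<lambda>j. L (w j)) \<longlonglongrightarrow> 0"
    and \<phi>: "\<phi> \<in> X" and "\<epsilon> > 0"
  shows "\<forall>\<^sub>F j in sequentially. - \<epsilon> < B \<phi> (w j)"
proof (rule ccontr)
  assume "\<not> ?thesis"
  then have "\<exists>\<^sub>F j in sequentially. B \<phi> (w j) \<le> - \<epsilon>"
    by (simp add: not_eventually not_less)
  then obtain r :: "nat \<Rightarrow> nat" where r: "strict_mono r" "\<And>j. B \<phi> (w (r j)) \<le> - \<epsilon>"
    using infinite_enumerate[of "{j. B \<phi> (w j) \<le> - \<epsilon>}"] frequently_cofinite cofinite_eq_sequentially
    by (metis (mono_tags, lifting) mem_Collect_eq)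
  have K: "0 \<le> K" using order_trans[OF N_nonneg w(2)] w(1) by blast
  \<comment> \<open>With this t the quadratic term is at most \<open>t * \<epsilon>\<close>, half of
    what the cross term gains; the 1 in the denominator covers \<open>K = 0\<close>.\<close>
  define t where "t = \<epsilon> / (K\<^sup>2 + 1)"
  have t: "t > 0" "t * K\<^sup>2 \<le> \<epsilon>"
    using \<open>\<epsilon> > 0\<close> by (auto simp: t_def field_simps add_pos_nonneg)
  have bound: "N (\<phi> + t *\<^sub>R w (r j)) \<le> sqrt ((N \<phi>)\<^sup>2 - t * \<epsilon>)" for j
  proof (rule real_le_rsqrt)
    have "t\<^sup>2 * (N (w (r j)))\<^sup>2 \<le> t\<^sup>2 * K\<^sup>2"
      using w K by (intro mult_left_mono power_mono) auto
    also have "\<dots> = t * (t * K\<^sup>2)" by (simp add: power2_eq_square)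
    also have "\<dots> \<le> t * \<epsilon>" using t by (intro mult_left_mono) auto
    finally have 1: "t\<^sup>2 * (N (w (r j)))\<^sup>2 \<le> t * \<epsilon>" .
    have 2: "t * B \<phi> (w (r j)) \<le> t * - \<epsilon>" using r t by (intro mult_left_mono) auto
    have "(N (\<phi> + t *\<^sub>R w (r j)))\<^sup>2 = (N \<phi>)\<^sup>2 + 2 * (t * B \<phi> (w (r j))) + t\<^sup>2 * (N (w (r j)))\<^sup>2"
      using w \<phi> t by (simp add: N_add_sq B_simps N_scale power_mult_distrib)
    then show "(N (\<phi> + t *\<^sub>R w (r j)))\<^sup>2 \<le> (N \<phi>)\<^sup>2 - t * \<epsilon>" using 1 2 by simp
  qed
  have conv: "(\<lambda>j. L ((\<phi> + t *\<^sub>R w (r j)) - \<phi>)) \<longlonglongrightarrow> 0"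
    using tendsto_mult_left[OF LIMSEQ_subseq_LIMSEQ[OF w(3) r(1)], of t] w t
    by (simp add: L_scale o_def)
  have "N \<phi> \<le> sqrt ((N \<phi>)\<^sup>2 - t * \<epsilon>)"
    using w \<phi> by (intro lsc[OF _ _ bound conv]) auto
  also have "\<dots> < sqrt ((N \<phi>)\<^sup>2)" using t \<open>\<epsilon> > 0\<close> by (simp only: real_sqrt_less_iff) simp
  finally show False using \<phi> by simp
qed

lemma weak_null:
  assumes w: "\<And>j::nat. w j \<in> X" "\<And>j. N (w j) \<le> K" "(\<lambda>j. L (w j)) \<longlonglongrightarrow> 0"
    and \<phi>: "\<phi> \<in> X"
  shows "(\<lambda>j. B \<phi> (w j)) \<longlonglongrightarrow> 0"
proof (rule tendstoI)
  fix \<epsilon> :: real assume "\<epsilon> > 0"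
  from weak_null_upper[OF w \<phi> this] weak_null_upper[OF w, of "- \<phi>", OF _ this]
  show "\<forall>\<^sub>F j in sequentially. dist (B \<phi> (w j)) 0 < \<epsilon>"
    using \<phi> w by (auto simp: B_simps elim: eventually_elim2)
qed

text \<open>An \<open>L\<close>-limit of a subsequence is the candidate. Lower semicontinuity lets j
  tend to infinity in the Cauchy estimate for \<open>u i - u j\<close>, which upgrades
  \<open>L\<close>-convergence to convergence in \<open>N\<close>.\<close>

lemma complete:
  assumes u: "\<And>j::nat. u j \<in> X"
    and cauchy: "\<And>\<epsilon>. \<epsilon> > 0 \<Longrightarrow> \<exists>k. \<forall>i\<ge>k. \<forall>j\<ge>k. N (u i - u j) \<le> \<epsilon>"
  shows "\<exists>v\<in>X. (\<lambda>j. N (u j - v)) \<longlonglongrightarrow> 0"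
proof -
  obtain k1 where k1: "\<And>i j. i \<ge> k1 \<Longrightarrow> j \<ge> k1 \<Longrightarrow> N (u i - u j) \<le> 1"
    using cauchy[of 1] by auto
  have "N (u (j + k1)) \<le> N (u k1) + 1" for j
    using k1[of "j + k1" k1] N_diff_bound[of "u (j + k1)" "u k1"] u by force
  from compact[of "\<lambda>j. u (j + k1)", OF u this]
  obtain r v where r: "strict_mono (r :: nat \<Rightarrow> nat)" "v \<in> X"
    "(\<lambda>j. L (u (r j + k1) - v)) \<longlonglongrightarrow> 0" by auto
  have "N (u i - v) \<le> \<epsilon>" if "\<epsilon> > 0" and k: "\<And>i j. i \<ge> k \<Longrightarrow> j \<ge> k \<Longrightarrow> N (u i - u j) \<le> \<epsilon>" and "i \<ge> k"
    for \<epsilon> k i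
  proof (rule lsc[of "\<lambda>j. u i - u (r (j + k) + k1)"])
    show "N (u i - u (r (j + k) + k1)) \<le> \<epsilon>" for j
      using k[OF \<open>i \<ge> k\<close>, of "r (j + k) + k1"] seq_suble[OF r(1), of "j + k"] by simp
    have "u i - u (r (j + k) + k1) - (u i - v) = - (u (r (j + k) + k1) - v)" for j by simp
    then show "(\<lambda>j. L (u i - u (r (j + k) + k1) - (u i - v))) \<longlonglongrightarrow> 0"
      using LIMSEQ_ignore_initial_segment[OF r(3), of k] u r by (simp only: L_minus X_closed)
  qed (use u r in auto)
  then have lim: "\<exists>k. \<forall>i\<ge>k. N (u i - v) \<le> \<epsilon>" if "\<epsilon> > 0" for \<epsilon>
    using cauchy[OF that] that by meson
  have "(\<lambda>j. N (u j - v)) \<longlonglongrightarrow> 0"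
  proof (rule LIMSEQ_I)
    fix e :: real assume "e > 0"
    then obtain k where "\<forall>i\<ge>k. N (u i - v) \<le> e / 2" using lim[of "e / 2"] by auto
    then show "\<exists>no. \<forall>n\<ge>no. norm (N (u n - v) - 0) < e"
      using u r \<open>e > 0\<close> by (intro exI[of _ k]) (force simp: abs_of_nonneg)
  qed
  then show ?thesis using r by blast
qed

text \<open>The representing vector is the minimiser of \<open>v \<mapsto> (N v)\<^sup>2 / 2 - l v\<close>.\<close>

theorem Riesz:
  assumes add: "\<And>u v. u \<in> X \<Longrightarrow> v \<in> X \<Longrightarrow> l (u + v) = l u + (l v :: real)"
    and scale: "\<And>u r. u \<in> X \<Longrightarrow> l (r *\<^sub>R u) = r * l u"
    and bound: "\<And>u. u \<in> X \<Longrightarrow> \<bar>l u\<bar> \<le> C * N u"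
  shows "\<exists>v\<in>X. \<forall>u\<in>X. B v u = l u"
proof -
  define I where "I u = (N u)\<^sup>2 / 2 - l u" for u
  have I_low: "- C\<^sup>2 / 2 \<le> I u" if "u \<in> X" for u
    using bound[OF that] zero_le_power2[of "N u - C"] by (simp add: I_def power2_diff abs_le_iff ac_simps)
  have I_bdd: "bdd_below (I ` X)" using I_low by (auto intro!: bdd_belowI)
  define m where "m = Inf (I ` X)"
  have m_le: "m \<le> I u" if "u \<in> X" for u
    unfolding m_def using I_bdd that by (intro cInf_lower) auto
  have "\<exists>u\<in>X. I u < m + 1 / real (Suc j)" for j
  proof -
    have "X \<noteq> {}" using X_closed(1) by blast
    then show ?thesis
      using cInf_lessD[of "I ` X" "m + 1 / real (Suc j)"] by (auto simp: m_def[symmetric] simp del: of_nat_Suc)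
  qed
  then obtain u where u: "\<And>j. u j \<in> X" "\<And>j. I (u j) < m + 1 / real (Suc j)" by metis
  \<comment> \<open>Parallelogram identity: the midpoint also has value at least m, so two almost
    minimisers are close to each other.\<close>
  have par: "(N (u i - u j))\<^sup>2 \<le> 4 * (1 / real (Suc i) + 1 / real (Suc j))" for i j
  proof -
    have "I (u i) + I (u j) - 2 * I ((1/2) *\<^sub>R (u i + u j)) = (N (u i - u j))\<^sup>2 / 4"
      using u by (simp add: I_def add scale N_scale N_add_sq N_diff_sq power_divide)
        (simp add: field_simps)
    moreover have "m \<le> I ((1/2) *\<^sub>R (u i + u j))" using u by (intro m_le) simp
    ultimately show ?thesis using u(2)[of i] u(2)[of j] by argo
  qed
  have cauchy: "\<exists>k. \<forall>i\<ge>k. \<forall>j\<ge>k. N (u i - u j) \<le> \<epsilon>" if e: "\<epsilon> > 0" for \<epsilon>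
  proof -
    obtain k :: nat where k: "8 / \<epsilon>\<^sup>2 < real k" using reals_Archimedean2 by blast
    have "N (u i - u j) \<le> \<epsilon>" if "i \<ge> k" "j \<ge> k" for i j
    proof (rule power2_le_imp_le)
      have s: "1 / real (Suc i) \<le> \<epsilon>\<^sup>2 / 8" if "i \<ge> k" for i
      proof -
        have "8 / \<epsilon>\<^sup>2 < real (Suc i)" using k that by simp
        then show ?thesis using e by (simp add: field_simps del: of_nat_Suc)
      qed
      show "(N (u i - u j))\<^sup>2 \<le> \<epsilon>\<^sup>2"
        using par[of i j] s[OF that(1)] s[OF that(2)] by argo
    qed (use e in simp)
    then show ?thesis by blast
  qed
  obtain v where v: "v \<in> X" "(\<lambda>j. N (u j - v)) \<longlonglongrightarrow> 0"
    using complete[OF u(1) cauchy] by blast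
  have Bv: "B v h = l h" if h: "h \<in> X" for h
  proof -
    \<comment> \<open>The minimiser is only a limit, so the inequality is first derived at
      \<open>u j\<close> with the error \<open>1 / real (Suc j)\<close> and then passed to the
      limit.\<close>
    have key: "0 \<le> t * (B v h - l h) + t\<^sup>2 * (N h)\<^sup>2 / 2" for t
    proof -
      have "m \<le> I (u j) + t * (B (u j) h - l h) + t\<^sup>2 * (N h)\<^sup>2 / 2" for j
        using m_le[of "u j + t *\<^sub>R h"] u h
        by (simp add: I_def add scale N_add_sq N_scale B_simps power_mult_distrib algebra_simps)
      then have ge: "- (1 / real (Suc j)) \<le> t * (B (u j) h - l h) + t\<^sup>2 * (N h)\<^sup>2 / 2" for j
        using u(2)[of j] by (smt (verit))
      have "(\<lambda>j. B (u j) h - B v h) \<longlonglongrightarrow> 0"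
      proof (rule Lim_null_comparison)
        show "\<forall>\<^sub>F j in sequentially. norm (B (u j) h - B v h) \<le> N (u j - v) * N h"
          using Cauchy_Schwarz[of "u _ - v" h] u v h by (simp add: B_simps)
        show "(\<lambda>j. N (u j - v) * N h) \<longlonglongrightarrow> 0" using tendsto_mult_right[OF v(2)] by simp
      qed
      then have "(\<lambda>j. B (u j) h) \<longlonglongrightarrow> B v h" by (simp add: LIM_zero_iff)
      then have "(\<lambda>j. t * (B (u j) h - l h) + t\<^sup>2 * (N h)\<^sup>2 / 2) \<longlonglongrightarrow> t * (B v h - l h) + t\<^sup>2 * (N h)\<^sup>2 / 2"
        by (intro tendsto_intros)
      moreover have "(\<lambda>j. - (1 / real (Suc j))) \<longlonglongrightarrow> - 0"
        using LIMSEQ_inverse_real_of_nat by (intro tendsto_minus) (simp add: inverse_eq_divide)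
      ultimately show ?thesis using LIMSEQ_le[of "\<lambda>j. - (1 / real (Suc j))"] ge by fastforce
    qed
    define d where "d = B v h - l h"
    \<comment> \<open>The choice \<open>t = - d / P\<close> almost minimises the quadratic; the
      added 1 covers directions h with \<open>N h = 0\<close>.\<close>
    define P where "P = (N h)\<^sup>2 + 1"
    have P: "P > 0" "(N h)\<^sup>2 \<le> P" by (simp_all add: P_def add_nonneg_pos)
    have "0 \<le> (- d / P) * d + (- d / P)\<^sup>2 * (N h)\<^sup>2 / 2"
      using key[of "- d / P"] by (simp only: d_def)
    also have "\<dots> \<le> (- d / P) * d + (- d / P)\<^sup>2 * P / 2"
      using P by (intro add_left_mono divide_right_mono mult_left_mono) auto
    also have "\<dots> = - (d\<^sup>2 / (2 * P))"
      using P by (simp add: power2_eq_square field_simps)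
    finally have "d = 0" using P by (simp add: divide_le_0_iff)
    then show ?thesis by (simp add: d_def)
  qed
  then show ?thesis using v by blast
qed

end

text \<open>\<open>Mh\<close> stands for the primitive of M and is known only through its mean value
  property; \<open>D u\<close> is the derivative of \<Phi> at u. In both moduli the small term
  \<eta> absorbs growth and the term with \<open>L\<close> carries the compactness.\<close>

locale kirchhoff = compact_embedding +
  fixes M Mh :: "real \<Rightarrow> real" and \<Phi> :: "'a \<Rightarrow> real" and D :: "'a \<Rightarrow> 'a \<Rightarrow> real" and m0 :: real
  assumes M_cont: "continuous_on {0..} M"
    and m0: "0 < m0" "\<And>t. 0 \<le> t \<Longrightarrow> m0 \<le> M t"
    and Mh: "\<And>a b. 0 \<le> a \<Longrightarrow> a \<le> b \<Longrightarrow> \<exists>x\<in>{a..b}. Mh b - Mh a = M x * (b - a)"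
    and Mh_0: "Mh 0 = 0"
    and L_bound: "\<exists>C. \<forall>u\<in>X. 0 \<le> L u \<and> L u \<le> C * N u"
    and D_add: "\<And>u a b. u \<in> X \<Longrightarrow> a \<in> X \<Longrightarrow> b \<in> X \<Longrightarrow> D u (a + b) = D u a + D u b"
    and D_scale: "\<And>u a r. u \<in> X \<Longrightarrow> a \<in> X \<Longrightarrow> D u (r *\<^sub>R a) = r * D u a"
    and D_0: "\<And>a. a \<in> X \<Longrightarrow> D 0 a = 0"
    and D_mod: "\<And>K \<eta>. K > 0 \<Longrightarrow> \<eta> > 0 \<Longrightarrow> \<exists>C\<ge>0. \<forall>u\<in>X. \<forall>v\<in>X. \<forall>a\<in>X. N u \<le> K \<longrightarrow> N v \<le> K \<longrightarrow>
      \<bar>D u a - D v a\<bar> \<le> (\<eta> + C * L (u - v)) * N a"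
    and \<Phi>_mod: "\<And>K \<eta>. K > 0 \<Longrightarrow> \<eta> > 0 \<Longrightarrow> \<exists>C\<ge>0. \<forall>u\<in>X. \<forall>h\<in>X. N u \<le> K \<longrightarrow> N h \<le> K \<longrightarrow>
      \<bar>\<Phi> (u + h) - \<Phi> u - D u h\<bar> \<le> (\<eta> + C * L h) * N h"
    and \<Phi>_0: "\<Phi> 0 = 0"
begin

section \<open>The functional, its gradient and their moduli of continuity\<close>

definition J :: "'a \<Rightarrow> real" where "J u = Mh ((N u)\<^sup>2) / 2 - \<Phi> u"

lemma D_bound:
  assumes "K > 0"
  shows "\<exists>C\<ge>0. \<forall>u\<in>X. \<forall>a\<in>X. N u \<le> K \<longrightarrow> \<bar>D u a\<bar> \<le> C * N a"
proof -
  obtain C where C: "C \<ge> 0" "\<And>u v a. u \<in> X \<Longrightarrow> v \<in> X \<Longrightarrow> a \<in> X \<Longrightarrow> N u \<le> K \<Longrightarrow> N v \<le> K \<Longrightarrow>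
      \<bar>D u a - D v a\<bar> \<le> (1 + C * L (u - v)) * N a"
    using D_mod[OF assms, of 1] by force
  obtain C' where C': "\<And>u. u \<in> X \<Longrightarrow> 0 \<le> L u" "\<And>u. u \<in> X \<Longrightarrow> L u \<le> C' * N u"
    using L_bound by blast
  have "\<bar>D u a\<bar> \<le> (1 + C * (\<bar>C'\<bar> * K)) * N a" if ua: "u \<in> X" "a \<in> X" "N u \<le> K" for u a
  proof -
    have "\<bar>D u a\<bar> \<le> (1 + C * L u) * N a"
      using C(2)[of u 0 a] ua assms D_0 by simp
    also have "L u \<le> \<bar>C'\<bar> * K"
      using C'(2)[OF ua(1)] mult_mono[OF abs_ge_self ua(3), of C'] ua by simp
    finally show ?thesis using C ua by (simp add: mult_left_mono mult_right_mono)
  qed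
  then show ?thesis
    using C assms by (intro exI[of _ "1 + C * (\<bar>C'\<bar> * K)"]) auto
qed

definition D_repr :: "'a \<Rightarrow> 'a" where "D_repr u = (SOME v. v \<in> X \<and> (\<forall>a\<in>X. B v a = D u a))"

lemma D_repr:
  assumes u: "u \<in> X"
  shows D_repr_in: "D_repr u \<in> X" and B_D_repr: "a \<in> X \<Longrightarrow> B (D_repr u) a = D u a"
proof -
  have "N u + 1 > 0" using u N_nonneg[of u] by linarith
  then obtain C where "\<And>a. a \<in> X \<Longrightarrow> \<bar>D u a\<bar> \<le> C * N a"
    using D_bound[of "N u + 1"] u by force
  with u have "\<exists>v\<in>X. \<forall>a\<in>X. B v a = D u a"
    by (intro Riesz) (auto simp: D_add D_scale)
  then have "\<exists>v. v \<in> X \<and> (\<forall>a\<in>X. B v a = D u a)" by blast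
  from someI_ex[OF this]
  show "D_repr u \<in> X" "a \<in> X \<Longrightarrow> B (D_repr u) a = D u a" by (auto simp: D_repr_def)
qed

text \<open>The gradient of J. The factor 1/2 in J cancels the 2 from differentiating the squared
  norm.\<close>

definition V :: "'a \<Rightarrow> 'a" where "V u = M ((N u)\<^sup>2) *\<^sub>R u - D_repr u"

lemma V_in: "u \<in> X \<Longrightarrow> V u \<in> X"
  by (simp add: V_def D_repr_in)

lemma B_V: "u \<in> X \<Longrightarrow> a \<in> X \<Longrightarrow> B (V u) a = M ((N u)\<^sup>2) * B u a - D u a"
  by (simp add: V_def D_repr_in B_simps B_D_repr)

lemma N_leI:
  assumes "u \<in> X" "\<And>a. a \<in> X \<Longrightarrow> B u a \<le> c * N a" "0 \<le> c"
  shows "N u \<le> c"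
proof (cases "N u = 0")
  case False
  then have "0 < N u" using assms(1) N_nonneg[of u] by linarith
  moreover have "N u * N u \<le> c * N u" using assms(1) assms(2)[of u] by (simp add: N_sq flip: power2_eq_square)
  ultimately show ?thesis by simp
qed (use assms in simp)

text \<open>This expresses that the gradient of \<Phi> is a compact map: on balls it turns
  \<open>L\<close>-convergence into convergence in \<open>N\<close>.\<close>

lemma N_D_repr_diff:
  assumes "K > 0" "\<eta> > 0"
  shows "\<exists>C\<ge>0. \<forall>u\<in>X. \<forall>v\<in>X. N u \<le> K \<longrightarrow> N v \<le> K \<longrightarrow> N (D_repr u - D_repr v) \<le> \<eta> + C * L (u - v)"
proof -
  obtain C where C: "C \<ge> 0" "\<And>u v a. u \<in> X \<Longrightarrow> v \<in> X \<Longrightarrow> a \<in> X \<Longrightarrow> N u \<le> K \<Longrightarrow> N v \<le> K \<Longrightarrow>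
      \<bar>D u a - D v a\<bar> \<le> (\<eta> + C * L (u - v)) * N a"
    using D_mod[OF assms] by force
  have "N (D_repr u - D_repr v) \<le> \<eta> + C * L (u - v)" if "u \<in> X" "v \<in> X" "N u \<le> K" "N v \<le> K" for u v
  proof (rule N_leI)
    show "B (D_repr u - D_repr v) a \<le> (\<eta> + C * L (u - v)) * N a" if "a \<in> X" for a
      using C(2)[of u v a] that \<open>u \<in> X\<close> \<open>v \<in> X\<close> \<open>N u \<le> K\<close> \<open>N v \<le> K\<close>
      by (simp add: B_simps D_repr_in B_D_repr)
    show "0 \<le> \<eta> + C * L (u - v)"
      using L_bound that C assms by (intro add_nonneg_nonneg mult_nonneg_nonneg) auto
  qed (use that D_repr_in in auto)
  then show ?thesis using C(1) by blast
qed

lemma M_unif: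
  assumes "\<epsilon> > 0"
  shows "\<exists>\<delta>>0. \<forall>x\<in>{0..K}. \<forall>y\<in>{0..K}. \<bar>x - y\<bar> < \<delta> \<longrightarrow> \<bar>M x - M y\<bar> < \<epsilon>"
proof -
  have "uniformly_continuous_on {0..K} M"
    by (intro compact_uniformly_continuous continuous_on_subset[OF M_cont]) auto
  then show ?thesis
    using assms unfolding uniformly_continuous_on_def dist_real_def
    by (metis abs_minus_commute)
qed

lemma M_bounded: "\<exists>C>0. \<forall>x\<in>{0..K}. \<bar>M x\<bar> \<le> C"
proof -
  have "bounded (M ` {0..K})"
    by (intro compact_imp_bounded compact_continuous_image continuous_on_subset[OF M_cont]) auto
  then show ?thesis unfolding bounded_pos by auto
qed

lemma sq_diff_bound:
  assumes "u \<in> X" "v \<in> X" "N u \<le> K" "N v \<le> K"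
  shows "\<bar>(N u)\<^sup>2 - (N v)\<^sup>2\<bar> \<le> 2 * K * N (u - v)"
proof -
  have "0 \<le> K" using assms N_nonneg[of u] by linarith
  have "\<bar>(N u)\<^sup>2 - (N v)\<^sup>2\<bar> = (N u + N v) * \<bar>N u - N v\<bar>"
    using assms by (simp add: square_diff_square_factored power2_eq_square abs_mult)
  also have "\<dots> \<le> (2 * K) * N (u - v)"
    using assms N_diff_bound[of u v] \<open>0 \<le> K\<close> by (intro mult_mono) auto
  finally show ?thesis .
qed

lemma V_unif:
  assumes K: "K > 0" and e: "\<epsilon> > 0"
  shows "\<exists>\<delta>>0. \<forall>u\<in>X. \<forall>v\<in>X. N u \<le> K \<longrightarrow> N v \<le> K \<longrightarrow> N (u - v) \<le> \<delta> \<longrightarrow> N (V u - V v) \<le> \<epsilon>"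
proof -
  obtain C where C: "C \<ge> 0" "\<And>u v. u \<in> X \<Longrightarrow> v \<in> X \<Longrightarrow> N u \<le> K \<Longrightarrow> N v \<le> K \<Longrightarrow>
      N (D_repr u - D_repr v) \<le> \<epsilon> / 4 + C * L (u - v)"
    using N_D_repr_diff[OF K, of "\<epsilon> / 4"] e by force
  obtain C1 where C1: "\<And>u. u \<in> X \<Longrightarrow> L u \<le> C1 * N u"
    using L_bound by blast
  obtain d1 where d1: "d1 > 0" "\<And>x y. x \<in> {0..K\<^sup>2} \<Longrightarrow> y \<in> {0..K\<^sup>2} \<Longrightarrow> \<bar>x - y\<bar> < d1 \<Longrightarrow> \<bar>M x - M y\<bar> < \<epsilon> / (4 * K)"
    using M_unif[of "\<epsilon> / (4 * K)" "K\<^sup>2"] e K by force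
  obtain C2 where C2: "C2 > 0" "\<And>x. x \<in> {0..K\<^sup>2} \<Longrightarrow> \<bar>M x\<bar> \<le> C2"
    using M_bounded[of "K\<^sup>2"] by force
  define A where "A = C * \<bar>C1\<bar> + C2"
  have A: "A > 0" using C C2 by (simp add: A_def add_nonneg_pos)
  \<comment> \<open>The first entry limits the terms linear in \<open>N (u - v)\<close> to half of
    \<epsilon>; the second keeps the squared norms closer than d1, where M varies little.\<close>
  define \<delta> where "\<delta> = min (\<epsilon> / (2 * A)) (d1 / (4 * K))"
  have \<delta>: "\<delta> > 0" "\<delta> \<le> \<epsilon> / (2 * A)" "\<delta> \<le> d1 / (4 * K)"
    using A e d1 K by (auto simp: \<delta>_def)
  have "N (V u - V v) \<le> \<epsilon>" if uv: "u \<in> X" "v \<in> X" "N u \<le> K" "N v \<le> K" "N (u - v) \<le> \<delta>" for u v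
  proof -
    let ?a = "M ((N u)\<^sup>2)" and ?b = "M ((N v)\<^sup>2)"
    have in': "(N u)\<^sup>2 \<in> {0..K\<^sup>2}" "(N v)\<^sup>2 \<in> {0..K\<^sup>2}"
      using uv by (auto intro: power_mono)
    have "\<bar>(N u)\<^sup>2 - (N v)\<^sup>2\<bar> \<le> 2 * K * N (u - v)" using sq_diff_bound uv by blast
    also have "\<dots> \<le> 2 * K * (d1 / (4 * K))" using uv \<delta> K by (intro mult_left_mono) auto
    also have "\<dots> < d1" using K d1 by simp
    finally have "\<bar>(N u)\<^sup>2 - (N v)\<^sup>2\<bar> < d1" .
    then have ab: "\<bar>?a - ?b\<bar> \<le> \<epsilon> / (4 * K)" using d1(2)[OF in'] by simp
    have eq: "V u - V v = ((?a - ?b) *\<^sub>R u + ?b *\<^sub>R (u - v)) - (D_repr u - D_repr v)"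
      by (simp add: V_def algebra_simps)
    have "N (V u - V v) \<le> N ((?a - ?b) *\<^sub>R u + ?b *\<^sub>R (u - v)) + N (D_repr u - D_repr v)"
      unfolding eq using uv D_repr_in by (intro N_triangle_diff) auto
    also have "N ((?a - ?b) *\<^sub>R u + ?b *\<^sub>R (u - v)) \<le> N ((?a - ?b) *\<^sub>R u) + N (?b *\<^sub>R (u - v))"
      using uv by (intro N_triangle) auto
    also have "N ((?a - ?b) *\<^sub>R u) \<le> \<epsilon> / (4 * K) * K"
    proof -
      have "\<bar>?a - ?b\<bar> * N u \<le> \<epsilon> / (4 * K) * K" using ab uv e K by (intro mult_mono) auto
      then show ?thesis using N_scale[of u "?a - ?b"] uv by simp
    qed
    also have "N (?b *\<^sub>R (u - v)) \<le> C2 * N (u - v)"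
    proof -
      have "\<bar>?b\<bar> * N (u - v) \<le> C2 * N (u - v)" using C2 in' uv by (intro mult_right_mono) auto
      then show ?thesis using N_scale[of "u - v" ?b] uv by simp
    qed
    also have "N (D_repr u - D_repr v) \<le> \<epsilon> / 4 + C * (\<bar>C1\<bar> * N (u - v))"
    proof -
      have "L (u - v) \<le> C1 * N (u - v)" using C1 uv by simp
      also have "\<dots> \<le> \<bar>C1\<bar> * N (u - v)" using uv by (intro mult_right_mono) auto
      finally have "C * L (u - v) \<le> C * (\<bar>C1\<bar> * N (u - v))" using C by (intro mult_left_mono)
      then show ?thesis using C(2)[of u v] uv by linarith
    qed
    finally have "N (V u - V v) \<le> \<epsilon> / 4 + \<epsilon> / 4 + A * N (u - v)"
      using K by (simp add: A_def algebra_simps)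
    also have "A * N (u - v) \<le> A * (\<epsilon> / (2 * A))"
      using uv \<delta> A by (intro mult_left_mono) auto
    finally show ?thesis using A by simp
  qed
  then show ?thesis using \<delta>(1) by blast
qed

lemma V_bound:
  assumes K: "K > 0"
  shows "\<exists>C. \<forall>u\<in>X. N u \<le> K \<longrightarrow> N (V u) \<le> C"
proof -
  obtain C where C: "C \<ge> 0" "\<And>u a. u \<in> X \<Longrightarrow> a \<in> X \<Longrightarrow> N u \<le> K \<Longrightarrow> \<bar>D u a\<bar> \<le> C * N a"
    using D_bound[OF K] by force
  obtain C2 where C2: "C2 > 0" "\<And>x. x \<in> {0..K\<^sup>2} \<Longrightarrow> \<bar>M x\<bar> \<le> C2"
    using M_bounded[of "K\<^sup>2"] by force
  have "N (V u) \<le> C2 * K + C" if u: "u \<in> X" "N u \<le> K" for u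
  proof (rule N_leI)
    show "B (V u) a \<le> (C2 * K + C) * N a" if a: "a \<in> X" for a
    proof -
      have "\<bar>M ((N u)\<^sup>2)\<bar> \<le> C2" using u by (intro C2) (auto intro: power_mono)
      moreover have "\<bar>B u a\<bar> \<le> K * N a"
        using Cauchy_Schwarz[of u a] mult_right_mono[OF u(2), of "N a"] u a by simp
      ultimately have "\<bar>M ((N u)\<^sup>2) * B u a\<bar> \<le> C2 * (K * N a)"
        unfolding abs_mult using C2 by (intro mult_mono) auto
      then show ?thesis using C(2)[of u a] u a by (simp add: B_V algebra_simps)
    qed
  qed (use u V_in C C2 K in auto)
  then show ?thesis by blast
qed

lemma J_deriv:
  assumes K: "K > 0" and e: "\<epsilon> > 0"
  shows "\<exists>\<delta>>0. \<forall>u\<in>X. \<forall>h\<in>X. N u \<le> K \<longrightarrow> N h \<le> \<delta> \<longrightarrow> \<bar>J (u + h) - J u - B (V u) h\<bar> \<le> \<epsilon> * N h"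
proof -
  \<comment> \<open>One unit of room, so that \<open>u + h\<close> stays in the ball when h has norm
    at most 1.\<close>
  define K' where "K' = K + 1"
  have K': "K' > 0" using K by (simp add: K'_def)
  obtain C where C: "C \<ge> 0" "\<And>u h. u \<in> X \<Longrightarrow> h \<in> X \<Longrightarrow> N u \<le> K' \<Longrightarrow> N h \<le> K' \<Longrightarrow>
      \<bar>\<Phi> (u + h) - \<Phi> u - D u h\<bar> \<le> (\<epsilon> / 4 + C * L h) * N h"
    using \<Phi>_mod[OF K', of "\<epsilon> / 4"] e by force
  obtain C1 where C1: "\<And>u. u \<in> X \<Longrightarrow> L u \<le> C1 * N u"
    using L_bound by blast
  obtain d1 where d1: "d1 > 0" "\<And>x y. x \<in> {0..K'\<^sup>2} \<Longrightarrow> y \<in> {0..K'\<^sup>2} \<Longrightarrow> \<bar>x - y\<bar> < d1 \<Longrightarrow> \<bar>M x - M y\<bar> < \<epsilon> / (4 * K')"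
    using M_unif[of "\<epsilon> / (4 * K')" "K'\<^sup>2"] e K' by force
  obtain C2 where C2: "C2 > 0" "\<And>x. x \<in> {0..K'\<^sup>2} \<Longrightarrow> \<bar>M x\<bar> \<le> C2"
    using M_bounded[of "K'\<^sup>2"] by force
  define A where "A = C * \<bar>C1\<bar> + C2"
  have A: "A > 0" using C C2 by (simp add: A_def add_nonneg_pos)
  define \<delta> where "\<delta> = min (min 1 (\<epsilon> / (2 * A))) (d1 / (4 * K'))"
  have \<delta>: "\<delta> > 0" "\<delta> \<le> 1" "\<delta> \<le> \<epsilon> / (2 * A)" "\<delta> \<le> d1 / (4 * K')"
    using A e d1 K' by (auto simp: \<delta>_def)
  have "\<bar>J (u + h) - J u - B (V u) h\<bar> \<le> \<epsilon> * N h"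
    if uh: "u \<in> X" "h \<in> X" "N u \<le> K" "N h \<le> \<delta>" for u h
  proof -
    have nk: "N u \<le> K'" "N (u + h) \<le> K'" "N h \<le> K'"
      using uh \<delta> N_triangle[of u h] K unfolding K'_def by linarith+
    have in': "(N u)\<^sup>2 \<in> {0..K'\<^sup>2}" "(N (u + h))\<^sup>2 \<in> {0..K'\<^sup>2}"
      using uh nk by (auto intro: power_mono)
    have sq: "\<bar>(N (u + h))\<^sup>2 - (N u)\<^sup>2\<bar> \<le> 2 * K' * N h"
      using sq_diff_bound[of "u + h" u K'] uh nk by simp
    have "2 * K' * N h \<le> 2 * K' * (d1 / (4 * K'))" using uh \<delta> K' by (intro mult_left_mono) auto
    also have "\<dots> < d1" using K' d1 by simp
    finally have small: "2 * K' * N h < d1" .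
    \<comment> \<open>Mean value point between the two squared norms; their order is not known, and
      the mean value property is stated for ordered arguments only.\<close>
    obtain x where x: "Mh ((N (u + h))\<^sup>2) - Mh ((N u)\<^sup>2) = M x * ((N (u + h))\<^sup>2 - (N u)\<^sup>2)"
      "min ((N u)\<^sup>2) ((N (u + h))\<^sup>2) \<le> x" "x \<le> max ((N u)\<^sup>2) ((N (u + h))\<^sup>2)"
    proof (cases "(N u)\<^sup>2 \<le> (N (u + h))\<^sup>2")
      case True
      then show ?thesis using Mh[of "(N u)\<^sup>2" "(N (u + h))\<^sup>2"] that by fastforce
    next
      case False
      then obtain x where "x \<in> {(N (u + h))\<^sup>2..(N u)\<^sup>2}"
        "Mh ((N u)\<^sup>2) - Mh ((N (u + h))\<^sup>2) = M x * ((N u)\<^sup>2 - (N (u + h))\<^sup>2)"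
        using Mh[of "(N (u + h))\<^sup>2" "(N u)\<^sup>2"] by fastforce
      then show ?thesis using False that[of x] by (simp add: algebra_simps)
    qed
    have xin: "x \<in> {0..K'\<^sup>2}" using x(2,3) in' by (auto simp: min_def max_def split: if_splits) (smt (verit) zero_le_power2)+
    have "\<bar>x - (N u)\<^sup>2\<bar> < d1" using x(2,3) sq small by linarith
    then have Mx: "\<bar>M x - M ((N u)\<^sup>2)\<bar> \<le> \<epsilon> / (4 * K')" using d1(2)[OF xin in'(1)] by simp
    have exp: "(N (u + h))\<^sup>2 - (N u)\<^sup>2 = 2 * B u h + (N h)\<^sup>2"
      using uh by (simp add: N_add_sq)
    \<comment> \<open>Three errors are separated: the variation of M, the quadratic term of the
      squared norm, and the remainder of \<Phi>.\<close>
    have "J (u + h) - J u - B (V u) h =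
      (M x - M ((N u)\<^sup>2)) * ((N (u + h))\<^sup>2 - (N u)\<^sup>2) / 2 + M ((N u)\<^sup>2) * (N h)\<^sup>2 / 2
        - (\<Phi> (u + h) - \<Phi> u - D u h)"
    proof -
      have alg: "p2 / 2 - q2 - (p1 / 2 - q1) - (m * b - d) = (y - m) * (n2 - n1) / 2 + m * g / 2 - (q2 - q1 - d)"
        if "p2 - p1 = y * (n2 - n1)" "n2 - n1 = 2 * b + g" for p2 p1 q2 q1 m b d y n2 n1 g :: real
      proof -
        have "p2 = p1 + y * (2 * b + g)" using that by simp
        then show ?thesis unfolding that(2) by (simp add: field_simps)
      qed
      show ?thesis
        unfolding J_def B_V[OF uh(1,2)] by (rule alg[OF x(1) exp])
    qed
    moreover have "\<bar>(M x - M ((N u)\<^sup>2)) * ((N (u + h))\<^sup>2 - (N u)\<^sup>2)\<bar> \<le> \<epsilon> / (4 * K') * (2 * K' * N h)"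
      unfolding abs_mult using Mx sq e K' by (intro mult_mono) auto
    moreover have "\<bar>M ((N u)\<^sup>2) * (N h)\<^sup>2\<bar> \<le> C2 * (N h)\<^sup>2"
      unfolding abs_mult using C2(2)[OF in'(1)] by (simp add: mult_right_mono)
    moreover have "\<bar>\<Phi> (u + h) - \<Phi> u - D u h\<bar> \<le> (\<epsilon> / 4 + C * (\<bar>C1\<bar> * N h)) * N h"
    proof -
      have "L h \<le> C1 * N h" using C1 uh by simp
      also have "\<dots> \<le> \<bar>C1\<bar> * N h" using uh by (intro mult_right_mono) auto
      finally have "(\<epsilon> / 4 + C * L h) * N h \<le> (\<epsilon> / 4 + C * (\<bar>C1\<bar> * N h)) * N h"
        using C uh by (intro mult_right_mono add_left_mono mult_left_mono) auto
      then show ?thesis using C(2)[of u h] uh nk by linarith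
    qed
    moreover have "\<epsilon> / (4 * K') * (2 * K' * N h) = \<epsilon> / 2 * N h" using K' by simp
    ultimately have "\<bar>J (u + h) - J u - B (V u) h\<bar> \<le>
        \<epsilon> / 4 * N h + C2 * (N h)\<^sup>2 / 2 + (\<epsilon> / 4 + C * (\<bar>C1\<bar> * N h)) * N h"
      by linarith
    also have "\<dots> \<le> \<epsilon> / 4 * N h + C2 * (N h)\<^sup>2 + (\<epsilon> / 4 + C * (\<bar>C1\<bar> * N h)) * N h"
      using C2 by simp
    also have "\<dots> = (\<epsilon> / 2 + A * N h) * N h" by (simp add: A_def algebra_simps power2_eq_square)
    also have "\<dots> \<le> (\<epsilon> / 2 + A * (\<epsilon> / (2 * A))) * N h"
      using uh \<delta> A by (intro mult_right_mono add_left_mono mult_left_mono) auto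
    finally show ?thesis using A by simp
  qed
  then show ?thesis using \<delta>(1) by blast
qed

text \<open>Almost critical points in a ball have an \<open>L\<close>-limit u. Testing the gradient
  with the difference from u, the nonlinear part drops out by compactness, and the lower bound
  \<open>m0\<close> on M turns what is left into convergence in \<open>N\<close>. The level is at
  least \<alpha> > 0, which excludes a limit of norm zero.\<close>

theorem critical_point:
  assumes ring: "0 < \<rho>1" "\<rho>1 < \<rho>2" "\<rho>2 \<le> R" "0 < \<alpha>"
      "\<And>u. u \<in> X \<Longrightarrow> \<rho>1 \<le> N u \<Longrightarrow> N u \<le> \<rho>2 \<Longrightarrow> \<alpha> \<le> J u"
    and ray: "e \<in> X" "N e > 0" "\<And>t. 0 \<le> t \<Longrightarrow> J (t *\<^sub>R e) \<le> C0"
    and out: "\<And>u. u \<in> X \<Longrightarrow> R \<le> N u \<Longrightarrow> J u \<le> C0 + 1 \<Longrightarrow> M ((N u)\<^sup>2) * (N u)\<^sup>2 \<le> D u u"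
  shows "\<exists>u\<in>X. N u > 0 \<and> (\<forall>a\<in>X. M ((N u)\<^sup>2) * B u a = D u a)"
proof -
  have R: "R > 0" "R + 1 > 0" using ring by auto
  obtain K where K: "\<And>u. u \<in> X \<Longrightarrow> N u \<le> R + 1 \<Longrightarrow> N (V u) \<le> K"
    using V_bound[OF R(2)] by blast
  have J0: "J 0 = 0" by (simp add: J_def Mh_0 \<Phi>_0)
  have out': "B (V u) u \<le> 0" if "u \<in> X" "R \<le> N u" "N u \<le> R + 1" "J u \<le> C0 + 1" for u
    using out[OF that(1,2,4)] that by (simp add: B_V N_sq)
  obtain c where c: "c \<ge> \<alpha>" "\<And>\<epsilon>. \<epsilon> > 0 \<Longrightarrow> \<exists>u\<in>X. N u \<le> R + 1 \<and> \<bar>J u - c\<bar> \<le> \<epsilon> \<and> N (V u) \<le> \<epsilon>"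
    using mountain_pass[of V R K J, OF V_in V_unif[OF R(2)] K J_deriv[OF R(2)] J0 ring ray out'] by blast
  have "\<exists>u. u \<in> X \<and> N u \<le> R + 1 \<and> \<bar>J u - c\<bar> \<le> 1 / real (Suc j) \<and> N (V u) \<le> 1 / real (Suc j)" for j
    using c(2)[of "1 / real (Suc j)"] by (auto simp del: of_nat_Suc)
  then obtain w where w: "\<And>j. w j \<in> X" "\<And>j. N (w j) \<le> R + 1" "\<And>j. \<bar>J (w j) - c\<bar> \<le> 1 / real (Suc j)"
    "\<And>j. N (V (w j)) \<le> 1 / real (Suc j)" by metis
  obtain r u where r: "strict_mono r" and u: "u \<in> X" and conv: "(\<lambda>j. L (w (r j) - u)) \<longlonglongrightarrow> 0"
    using compact[of w, OF w(1,2)] by blast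
  define x where "x j = w (r j)" for j
  have inv: "(\<lambda>j. 1 / real (Suc (r j))) \<longlonglongrightarrow> 0"
    using LIMSEQ_subseq_LIMSEQ[OF LIMSEQ_inverse_real_of_nat r] by (simp add: o_def inverse_eq_divide)
  have x: "x j \<in> X" "N (x j) \<le> R + 1" "\<bar>J (x j) - c\<bar> \<le> 1 / real (Suc (r j))"
    "N (V (x j)) \<le> 1 / real (Suc (r j))" for j
    unfolding x_def using w by blast+
  have Lx: "(\<lambda>j. L (x j - u)) \<longlonglongrightarrow> 0" using conv by (simp add: x_def)
  have Nu: "N u \<le> R + 1" using lsc[OF x(1) u x(2) Lx] .
  have d: "x j - u \<in> X" "N (x j - u) \<le> 2 * (R + 1)" for j
    using x u N_triangle_diff[of "x j" u] Nu by (auto intro: order_trans) (smt (verit) x)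
  have Nd: "0 \<le> N (x j - u)" for j using d by simp
  note weak = weak_null[OF d Lx]
  have VJ: "(\<lambda>j. B (V (x j)) (x j - u)) \<longlonglongrightarrow> 0"
  proof (rule Lim_null_comparison)
    have "\<bar>B (V (x j)) (x j - u)\<bar> \<le> 1 / real (Suc (r j)) * (2 * (R + 1))" for j
    proof -
      have "\<bar>B (V (x j)) (x j - u)\<bar> \<le> N (V (x j)) * N (x j - u)" using V_in[OF x(1)] d by (intro Cauchy_Schwarz)
      also have "\<dots> \<le> 1 / real (Suc (r j)) * (2 * (R + 1))"
        using x(4)[of j] d[of j] Nd by (intro mult_mono) auto
      finally show ?thesis .
    qed
    then show "\<forall>\<^sub>F j in sequentially. norm (B (V (x j)) (x j - u)) \<le> 1 / real (Suc (r j)) * (2 * (R + 1))"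
      by simp
    show "(\<lambda>j. 1 / real (Suc (r j)) * (2 * (R + 1))) \<longlonglongrightarrow> 0" using tendsto_mult_right[OF inv] by simp
  qed
  have kconv: "(\<lambda>j. N (D_repr (x j) - D_repr u)) \<longlonglongrightarrow> 0"
  proof (rule LIMSEQ_I)
    fix \<epsilon> :: real assume e: "\<epsilon> > 0"
    obtain C where C: "C \<ge> 0" "\<And>u v. u \<in> X \<Longrightarrow> v \<in> X \<Longrightarrow> N u \<le> R + 1 \<Longrightarrow> N v \<le> R + 1 \<Longrightarrow>
      N (D_repr u - D_repr v) \<le> \<epsilon> / 2 + C * L (u - v)"
      using N_D_repr_diff[OF R(2), of "\<epsilon> / 2"] e by force
    have "(\<lambda>j. \<epsilon> / 2 + C * L (x j - u)) \<longlonglongrightarrow> \<epsilon> / 2 + C * 0" by (intro tendsto_intros Lx)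
    then have "\<forall>\<^sub>F j in sequentially. \<epsilon> / 2 + C * L (x j - u) < \<epsilon>"
      using e by (simp add: order_tendstoD(2))
    then obtain no where no: "\<And>j. j \<ge> no \<Longrightarrow> \<epsilon> / 2 + C * L (x j - u) < \<epsilon>"
      by (auto simp: eventually_sequentially)
    have "norm (N (D_repr (x j) - D_repr u) - 0) < \<epsilon>" if "j \<ge> no" for j
    proof -
      have "0 \<le> N (D_repr (x j) - D_repr u)" using D_repr_in[OF x(1)] D_repr_in[OF u] by simp
      moreover have "N (D_repr (x j) - D_repr u) \<le> \<epsilon> / 2 + C * L (x j - u)" using C(2)[OF x(1) u x(2) Nu] .
      ultimately show ?thesis using no[OF that] by simp
    qed
    then show "\<exists>no. \<forall>n\<ge>no. norm (N (D_repr (x n) - D_repr u) - 0) < \<epsilon>" by blast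
  qed
  \<comment> \<open>The representative converges in norm, so it may be replaced by its limit, a
    fixed vector tested against a weakly null sequence.\<close>
  have kJ: "(\<lambda>j. B (D_repr (x j)) (x j - u)) \<longlonglongrightarrow> 0"
  proof -
    have "(\<lambda>j. B (D_repr (x j) - D_repr u) (x j - u)) \<longlonglongrightarrow> 0"
    proof (rule Lim_null_comparison)
      have "\<bar>B (D_repr (x j) - D_repr u) (x j - u)\<bar> \<le> N (D_repr (x j) - D_repr u) * (2 * (R + 1))" for j
      proof -
        have "\<bar>B (D_repr (x j) - D_repr u) (x j - u)\<bar> \<le> N (D_repr (x j) - D_repr u) * N (x j - u)"
          using D_repr_in x u d by (intro Cauchy_Schwarz) auto
        also have "\<dots> \<le> N (D_repr (x j) - D_repr u) * (2 * (R + 1))"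
          using d D_repr_in x u by (intro mult_left_mono) auto
        finally show ?thesis .
      qed
      then show "\<forall>\<^sub>F j in sequentially. norm (B (D_repr (x j) - D_repr u) (x j - u)) \<le> N (D_repr (x j) - D_repr u) * (2 * (R + 1))"
        by simp
      show "(\<lambda>j. N (D_repr (x j) - D_repr u) * (2 * (R + 1))) \<longlonglongrightarrow> 0" using tendsto_mult_right[OF kconv] by simp
    qed
    from tendsto_add[OF this weak[OF D_repr_in[OF u]]]
    show ?thesis using D_repr_in[OF x(1)] D_repr_in[OF u] d by (simp add: B_diff_left)
  qed
  \<comment> \<open>The factor of \<open>B (x j) (x j - u)\<close> depends on j through the norm;
    \<open>m0\<close> bounds it away from zero uniformly.\<close>
  have Bx: "(\<lambda>j. B (x j) (x j - u)) \<longlonglongrightarrow> 0"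
  proof (rule Lim_null_comparison)
    have "\<bar>B (x j) (x j - u)\<bar> \<le> \<bar>B (V (x j)) (x j - u) + B (D_repr (x j)) (x j - u)\<bar> / m0" for j
    proof -
      have "B (V (x j)) (x j - u) + B (D_repr (x j)) (x j - u) = M ((N (x j))\<^sup>2) * B (x j) (x j - u)"
        using x d D_repr_in by (simp add: B_V B_D_repr)
      then have "\<bar>B (V (x j)) (x j - u) + B (D_repr (x j)) (x j - u)\<bar> = M ((N (x j))\<^sup>2) * \<bar>B (x j) (x j - u)\<bar>"
        using m0(2)[of "(N (x j))\<^sup>2"] m0(1) by (simp add: abs_mult)
      also have "\<dots> \<ge> m0 * \<bar>B (x j) (x j - u)\<bar>"
        using m0(2)[of "(N (x j))\<^sup>2"] by (intro mult_right_mono) auto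
      finally show ?thesis using m0(1) by (simp add: field_simps)
    qed
    then show "\<forall>\<^sub>F j in sequentially. norm (B (x j) (x j - u)) \<le> \<bar>B (V (x j)) (x j - u) + B (D_repr (x j)) (x j - u)\<bar> / m0"
      by simp
    show "(\<lambda>j. \<bar>B (V (x j)) (x j - u) + B (D_repr (x j)) (x j - u)\<bar> / m0) \<longlonglongrightarrow> 0"
      using tendsto_divide[OF tendsto_rabs[OF tendsto_add[OF VJ kJ]] tendsto_const[of m0]] m0 by simp
  qed
  have strong: "(\<lambda>j. N (x j - u)) \<longlonglongrightarrow> 0"
  proof -
    have "(N (x j - u))\<^sup>2 = B (x j) (x j - u) - B u (x j - u)" for j
      using x u by (simp add: N_sq B_diff_left)
    then have "(\<lambda>j. (N (x j - u))\<^sup>2) \<longlonglongrightarrow> 0" using tendsto_diff[OF Bx weak[OF u]] by simp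
    then have "(\<lambda>j. sqrt ((N (x j - u))\<^sup>2)) \<longlonglongrightarrow> sqrt 0" by (rule tendsto_real_sqrt)
    then show ?thesis using Nd by simp
  qed
  have "N (V u) \<le> \<epsilon>" if e: "\<epsilon> > 0" for \<epsilon>
  proof -
    obtain \<delta> where \<delta>: "\<delta> > 0" "\<And>v. v \<in> X \<Longrightarrow> N v \<le> R + 1 \<Longrightarrow> N (v - u) \<le> \<delta> \<Longrightarrow> N (V v - V u) \<le> \<epsilon> / 2"
      using V_unif[OF R(2), of "\<epsilon> / 2"] e u Nu by force
    have "\<forall>\<^sub>F j in sequentially. N (x j - u) < \<delta> \<and> 1 / real (Suc (r j)) < \<epsilon> / 2"
      using order_tendstoD(2)[OF strong \<delta>(1)] order_tendstoD(2)[OF inv, of "\<epsilon> / 2"] e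
      by (auto intro: eventually_conj)
    from eventually_happens'[OF sequentially_bot this]
    obtain j where j: "N (x j - u) < \<delta>" "1 / real (Suc (r j)) < \<epsilon> / 2" by blast
    have "N (V u) \<le> N (V (x j)) + N (V (x j) - V u)"
      using N_diff_bound[of "V (x j)" "V u"] V_in x u by force
    then show ?thesis using \<delta>(2)[of "x j"] x[of j] j by linarith
  qed
  then have "N (V u) \<le> 0" by (rule field_le_epsilon[of _ 0, simplified])
  then have NV: "N (V u) = 0" using V_in[OF u] N_nonneg[of "V u"] by linarith
  have "\<bar>J u - c\<bar> \<le> \<epsilon>" if e: "\<epsilon> > 0" for \<epsilon>
  proof -
    obtain \<delta> where \<delta>: "\<delta> > 0" "\<And>h. h \<in> X \<Longrightarrow> N h \<le> \<delta> \<Longrightarrow> \<bar>J (u + h) - J u - B (V u) h\<bar> \<le> 1 * N h"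
      using J_deriv[OF R(2), of 1] u Nu by force
    have "\<forall>\<^sub>F j in sequentially. N (x j - u) < min \<delta> (\<epsilon> / 2) \<and> 1 / real (Suc (r j)) < \<epsilon> / 2"
      using e \<delta>(1)
      by (intro eventually_conj order_tendstoD(2)[OF strong] order_tendstoD(2)[OF inv]) auto
    from eventually_happens'[OF sequentially_bot this]
    obtain j where j: "N (x j - u) < min \<delta> (\<epsilon> / 2)" "1 / real (Suc (r j)) < \<epsilon> / 2" by blast
    have "\<bar>J (u + (x j - u)) - J u - B (V u) (x j - u)\<bar> \<le> 1 * N (x j - u)"
      using \<delta>(2)[of "x j - u"] d j by simp
    moreover have "B (V u) (x j - u) = 0"
      using Cauchy_Schwarz[of "V u" "x j - u"] NV V_in u d by simp
    ultimately have "\<bar>J (x j) - J u\<bar> \<le> N (x j - u)" by simp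
    then show ?thesis using x(3)[of j] j by linarith
  qed
  then have "\<bar>J u - c\<bar> \<le> 0" by (rule field_le_epsilon[of _ 0, simplified])
  then have "J u > 0" using c ring by simp
  \<comment> \<open>\<open>N u = 0\<close> does not make u the zero vector, so the value of \<Phi>
    at u comes from its expansion at 0.\<close>
  moreover have "J u = 0" if z: "N u = 0"
  proof -
    obtain C1 where C1: "\<And>u. u \<in> X \<Longrightarrow> 0 \<le> L u \<and> L u \<le> C1 * N u"
      using L_bound by blast
    have "L u = 0" using C1[OF u] z by simp
    moreover obtain C where "\<bar>\<Phi> (0 + u) - \<Phi> 0 - D 0 u\<bar> \<le> (1 + C * L u) * N u"
      using \<Phi>_mod[OF R(2), of 1] u Nu R by (metis N_zero X_closed(1) less_eq_real_def zero_less_one)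
    ultimately show ?thesis using z u by (simp add: J_def Mh_0 \<Phi>_0 D_0)
  qed
  ultimately have "N u > 0" using N_nonneg[OF u] by fastforce
  moreover have "M ((N u)\<^sup>2) * B u a = D u a" if "a \<in> X" for a
    using Cauchy_Schwarz[of "V u" a] NV V_in u that B_V[of u a] by simp
  ultimately show ?thesis using u by blast
qed

end

section \<open>The fractional Sobolev space\<close>

text \<open>Pointwise scaling turns spaces of real functions into subspaces of a
  \<open>real_vector\<close> type, which is what \<open>semi_inner\<close> works with.\<close>

instantiation "fun" :: (type, real_vector) real_vector
begin

definition scaleR_fun :: "real \<Rightarrow> ('a \<Rightarrow> 'b) \<Rightarrow> 'a \<Rightarrow> 'b" where
  "scaleR_fun r f = (\<lambda>x. r *\<^sub>R f x)"

instance
  by standard (simp_all add: scaleR_fun_def fun_eq_iff scaleR_add_right scaleR_add_left)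

end

lemma scaleR_fun_apply [simp]: "(r *\<^sub>R f) x = r *\<^sub>R f x"
  by (simp add: scaleR_fun_def)

section \<open>Square integrable functions and null sets of pairs\<close>

definition sq_integrable :: "'a measure \<Rightarrow> ('a \<Rightarrow> real) set" where
  "sq_integrable M = {f. f \<in> borel_measurable M \<and> integrable M (\<lambda>x. (f x)\<^sup>2)}"

lemma sq_integrableD [measurable_dest]: "f \<in> sq_integrable M \<Longrightarrow> f \<in> borel_measurable M"
  by (simp add: sq_integrable_def)

lemma sq_integrable_mult:
  assumes "f \<in> sq_integrable M" "g \<in> sq_integrable M"
  shows "integrable M (\<lambda>x. f x * g x)"
proof (rule Bochner_Integration.integrable_bound)
  show "integrable M (\<lambda>x. (f x)\<^sup>2 + (g x)\<^sup>2)" "(\<lambda>x. f x * g x) \<in> borel_measurable M"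
    using assms by (auto simp: sq_integrable_def)
  have "\<bar>f x * g x\<bar> \<le> (f x)\<^sup>2 + (g x)\<^sup>2" for x
    using sum_squares_bound[of "\<bar>f x\<bar>" "\<bar>g x\<bar>"] zero_le_power2[of "f x"] zero_le_power2[of "g x"]
    unfolding abs_mult power2_abs by linarith
  then show "AE x in M. norm (f x * g x) \<le> norm ((f x)\<^sup>2 + (g x)\<^sup>2)"
    by (simp add: abs_of_nonneg)
qed

lemma sq_integrable_add:
  assumes "f \<in> sq_integrable M" "g \<in> sq_integrable M"
  shows "(\<lambda>x. f x + g x) \<in> sq_integrable M"
  using assms sq_integrable_mult[OF assms]
  by (auto simp: sq_integrable_def power2_sum mult.assoc)

lemma sq_integrable_scale:
  "f \<in> sq_integrable M \<Longrightarrow> (\<lambda>x. r * f x) \<in> sq_integrable M"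
  by (auto simp: sq_integrable_def power_mult_distrib)

lemma sq_integrable_diff:
  assumes "f \<in> sq_integrable M" "g \<in> sq_integrable M"
  shows "(\<lambda>x. f x - g x) \<in> sq_integrable M"
  using sq_integrable_add[OF assms(1) sq_integrable_scale[OF assms(2), of "-1"]] by simp

text \<open>A second instance of the abstract calculus: it supplies the Cauchy-Schwarz inequality
  for integrals and the triangle inequality for \<open>L\<close>.\<close>

lemma semi_inner_L2: "semi_inner (sq_integrable M) (\<lambda>f g. \<integral>x. f x * g x \<partial>M)"
proof
  show "subspace (sq_integrable M)"
    using sq_integrable_add[of _ M] sq_integrable_scale[of _ M]
    by (auto simp: subspace_def plus_fun_def scaleR_fun_def) (auto simp: sq_integrable_def zero_fun_def)
qed (auto simp: sq_integrable_mult algebra_simps)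

lemma integral_Cauchy_Schwarz:
  assumes "f \<in> sq_integrable M" "g \<in> sq_integrable M"
  shows "(\<integral>x. f x * g x \<partial>M)\<^sup>2 \<le> (\<integral>x. (f x)\<^sup>2 \<partial>M) * (\<integral>x. (g x)\<^sup>2 \<partial>M)"
proof -
  interpret semi_inner "sq_integrable M" "\<lambda>f g. \<integral>x. f x * g x \<partial>M" by (rule semi_inner_L2)
  have "\<bar>\<integral>x. f x * g x \<partial>M\<bar>\<^sup>2 \<le> (N f * N g)\<^sup>2"
    by (intro power_mono Cauchy_Schwarz assms) simp
  also have "(N f * N g)\<^sup>2 = (\<integral>x. (f x)\<^sup>2 \<partial>M) * (\<integral>x. (g x)\<^sup>2 \<partial>M)"
    unfolding power_mult_distrib N_sq[OF assms(1)] N_sq[OF assms(2)] by (simp only: power2_eq_square)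
  finally show ?thesis by simp
qed

lemma sq_integrable_indicator:
  assumes "A \<in> sets M" "emeasure M A < \<infinity>"
  shows "indicator A \<in> sq_integrable M"
proof -
  have "(\<lambda>x. (indicator A x :: real)\<^sup>2) = indicator A" by (auto split: split_indicator)
  then show ?thesis using assms by (simp add: sq_integrable_def)
qed

text \<open>The exceptional set is enlarged to a Borel null set A; the two strips over A are null in
  the product. This transfers statements about u to its difference quotients.\<close>

lemma AE_prod_lborel:
  assumes "AE x in (lborel :: 'a::euclidean_space measure). P x"
  shows "AE p in (lborel :: ('a \<times> 'a) measure). P (fst p) \<and> P (snd p)"
proof -
  obtain A where A: "{x. \<not> P x} \<subseteq> A" "A \<in> sets borel" "emeasure lborel A = 0"
    using AE_E[OF assms] by auto
  have z: "emeasure (lborel :: ('a \<times> 'a) measure) (A \<times> UNIV) = 0"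
    "emeasure (lborel :: ('a \<times> 'a) measure) (UNIV \<times> A) = 0"
    unfolding lborel_prod[symmetric] using A
    by (simp_all add: lborel.emeasure_pair_measure_Times)
  have s: "A \<times> (UNIV :: 'a set) \<in> sets borel" "(UNIV :: 'a set) \<times> A \<in> sets borel"
    using pair_measureI[OF A(2), of "UNIV :: 'a set" borel] pair_measureI[OF _ A(2), of "UNIV :: 'a set" borel]
    unfolding borel_prod by simp_all
  show ?thesis
  proof (rule AE_I'[of "A \<times> UNIV \<union> UNIV \<times> A"])
    show "A \<times> UNIV \<union> UNIV \<times> A \<in> null_sets lborel"
      using z s by (intro null_sets.Un) (auto simp: null_sets_def)
  qed (use A in auto)
qed

lemma nn_integral_lborel_pair:
  assumes "f \<in> borel_measurable borel"
  shows "(\<integral>\<^sup>+p. f p \<partial>(lborel :: ('a::euclidean_space \<times> 'b::euclidean_space) measure)) = (\<integral>\<^sup>+x. \<integral>\<^sup>+y. f (x, y) \<partial>lborel \<partial>lborel)"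
proof -
  have "f \<in> borel_measurable (lborel \<Otimes>\<^sub>M lborel)" using assms by (simp add: lborel_prod)
  from lborel.nn_integral_fst[OF this] show ?thesis by (simp add: lborel_prod)
qed

locale gagliardo_space =
  fixes s :: real and \<Omega> :: "(real ^ 'n) set"
  assumes s: "0 < s" "s < 1" "s < real CARD('n) / 2"
    and open_\<Omega>: "open \<Omega>" and bounded_\<Omega>: "bounded \<Omega>"
begin

text \<open>Half of the Gagliardo exponent, so that the energy is the squared L2 norm of this
  function of two points and \<open>B\<close> is an L2 product pulled back along a linear
  map.\<close>

definition diff_quot :: "(real ^ 'n \<Rightarrow> real) \<Rightarrow> (real ^ 'n) \<times> (real ^ 'n) \<Rightarrow> real" where
  "diff_quot u = (\<lambda>(x, y). (u x - u y) / norm (x - y) powr (real CARD('n) / 2 + s))"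

text \<open>Borel representatives that vanish everywhere, not just almost everywhere, outside
  \<Omega>. Product measurability is then available directly and the pointwise estimates have no
  exceptional points; \<open>X0_representative\<close> links them to \<open>X0\<close>.\<close>

definition X :: "(real ^ 'n \<Rightarrow> real) set" where
  "X = {u. u \<in> borel_measurable borel \<and> (\<forall>x. x \<notin> \<Omega> \<longrightarrow> u x = 0) \<and> u \<in> sq_integrable lborel
    \<and> diff_quot u \<in> sq_integrable lborel}"

definition B :: "(real ^ 'n \<Rightarrow> real) \<Rightarrow> (real ^ 'n \<Rightarrow> real) \<Rightarrow> real" where
  "B u v = (\<integral>p. diff_quot u p * diff_quot v p \<partial>lborel)"

definition L :: "(real ^ 'n \<Rightarrow> real) \<Rightarrow> real" where
  "L u = sqrt (\<integral>x. (u x)\<^sup>2 \<partial>lborel)"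

lemma diff_quot_add: "diff_quot (u + v) = (\<lambda>p. diff_quot u p + diff_quot v p)"
  and diff_quot_scale: "diff_quot (r *\<^sub>R u) = (\<lambda>p. r * diff_quot u p)"
  by (auto simp: diff_quot_def fun_eq_iff diff_divide_distrib add_divide_distrib right_diff_distrib)

lemma \<Omega>_borel [measurable]: "\<Omega> \<in> sets borel"
  using open_\<Omega> by simp

lemma diff_quot_measurable [measurable]:
  assumes u: "u \<in> borel_measurable borel"
  shows "diff_quot u \<in> borel_measurable borel"
proof -
  have [measurable]: "(\<lambda>p. u (fst p)) \<in> borel_measurable borel" "(\<lambda>p. u (snd p)) \<in> borel_measurable borel"
    by (intro measurable_compose[OF _ u] borel_measurable_continuous_onI continuous_intros)+
  have [measurable]: "(\<lambda>p :: (real ^ 'n) \<times> (real ^ 'n). norm (fst p - snd p)) \<in> borel_measurable borel"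
    by (intro borel_measurable_continuous_onI continuous_intros)
  show ?thesis unfolding diff_quot_def case_prod_beta by measurable
qed

lemma diff_quot_Pair_measurable [measurable]:
  assumes [measurable]: "u \<in> borel_measurable borel"
  shows "(\<lambda>y. diff_quot u (x, y)) \<in> borel_measurable borel"
  unfolding diff_quot_def case_prod_conv by measurable

lemma X_D:
  assumes "u \<in> X"
  shows X_measurable [measurable_dest]: "u \<in> borel_measurable borel"
    and X_outside: "x \<notin> \<Omega> \<Longrightarrow> u x = 0"
    and X_sq: "u \<in> sq_integrable lborel" and X_diff_quot: "diff_quot u \<in> sq_integrable lborel"
  using assms by (auto simp: X_def)

sublocale semi_inner X B
proof
  show "subspace X"
    unfolding subspace_def
  proof (intro conjI ballI allI)
    have "diff_quot 0 = 0" by (auto simp: diff_quot_def fun_eq_iff)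
    then show "0 \<in> X" by (simp add: X_def sq_integrable_def zero_fun_def)
    show "u + v \<in> X" if uv: "u \<in> X" "v \<in> X" for u v
    proof -
      have "diff_quot (u + v) \<in> sq_integrable lborel"
        unfolding diff_quot_add using uv by (intro sq_integrable_add X_diff_quot)
      moreover have "u + v \<in> sq_integrable lborel"
        unfolding plus_fun_def using uv by (intro sq_integrable_add X_sq)
      ultimately show ?thesis
        using uv by (simp add: X_def) (simp add: sq_integrable_def)
    qed
    show "r *\<^sub>R u \<in> X" if u: "u \<in> X" for u r
    proof -
      have "diff_quot (r *\<^sub>R u) \<in> sq_integrable lborel"
        unfolding diff_quot_scale using u by (intro sq_integrable_scale X_diff_quot)
      moreover have "r *\<^sub>R u \<in> sq_integrable lborel"
        unfolding scaleR_fun_def real_scaleR_def using u by (intro sq_integrable_scale X_sq)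
      ultimately show ?thesis
        using u by (simp add: X_def) (simp add: sq_integrable_def)
    qed
  qed
  show "B (u + v) w = B u w + B v w" if "u \<in> X" "v \<in> X" "w \<in> X" for u v w
    using that by (simp add: B_def diff_quot_add algebra_simps sq_integrable_mult X_diff_quot)
qed (auto simp: B_def diff_quot_scale algebra_simps)

lemma L_scale: "L (r *\<^sub>R u) = \<bar>r\<bar> * L u"
  by (simp add: L_def power_mult_distrib real_sqrt_mult)

lemma L_sq: "(L u)\<^sup>2 = (\<integral>x. (u x)\<^sup>2 \<partial>lborel)"
  by (simp add: L_def)

lemma L_nonneg [simp]: "0 \<le> L u"
  by (simp add: L_def)

text \<open>The energy integrated in the second point only. As an extended number it is defined for
  every x, so that the estimates against it hold at every point and are integrated
  afterwards.\<close>

definition energy_density :: "(real ^ 'n \<Rightarrow> real) \<Rightarrow> real ^ 'n \<Rightarrow> ennreal" where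
  "energy_density u x = (\<integral>\<^sup>+y. ennreal ((diff_quot u (x, y))\<^sup>2) \<partial>lborel)"

lemma energy_density_measurable [measurable]:
  assumes [measurable]: "u \<in> borel_measurable borel"
  shows "energy_density u \<in> borel_measurable borel"
proof -
  have "(\<lambda>p. ennreal ((diff_quot u p)\<^sup>2)) \<in> borel_measurable (borel \<Otimes>\<^sub>M lborel)"
    by (simp add: borel_prod measurable_cong_sets[OF sets_pair_measure_cong[OF refl sets_lborel] refl])
  then show ?thesis unfolding energy_density_def by (intro lborel.borel_measurable_nn_integral) simp
qed

lemma nn_integral_diff_quot:
  assumes "u \<in> X"
  shows "(\<integral>\<^sup>+p. ennreal ((diff_quot u p)\<^sup>2) \<partial>lborel) = ennreal ((N u)\<^sup>2)"
  using X_diff_quot[OF assms] assms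
  by (simp add: N_sq B_def nn_integral_eq_integral sq_integrable_def flip: power2_eq_square)

lemma nn_integral_energy_density:
  assumes "u \<in> X"
  shows "(\<integral>\<^sup>+x. energy_density u x \<partial>lborel) = ennreal ((N u)\<^sup>2)"
proof -
  have "ennreal ((N u)\<^sup>2) = (\<integral>\<^sup>+p. ennreal ((diff_quot u p)\<^sup>2) \<partial>lborel)"
    by (rule nn_integral_diff_quot[OF assms, symmetric])
  also have "\<dots> = (\<integral>\<^sup>+x. energy_density u x \<partial>lborel)"
    unfolding energy_density_def using X_measurable[OF assms] by (intro nn_integral_lborel_pair) measurable
  finally show ?thesis by simp
qed

lemma nn_integral_cmult_diff_quot:
  assumes "u \<in> X"
  shows "(\<integral>\<^sup>+y. c * ennreal ((diff_quot u (x, y))\<^sup>2) \<partial>lborel) = c * energy_density u x"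
  unfolding energy_density_def using diff_quot_Pair_measurable[OF X_measurable[OF assms]]
  by (intro nn_integral_cmult measurable_compose[OF _ measurable_ennreal] borel_measurable_power) simp

lemma nn_integral_L:
  assumes "u \<in> X"
  shows "(\<integral>\<^sup>+x. ennreal ((u x)\<^sup>2) \<partial>lborel) = ennreal ((L u)\<^sup>2)"
  using X_sq[OF assms] by (simp add: L_sq nn_integral_eq_integral sq_integrable_def)

lemma diff_quot_sq: "(diff_quot u (x, y))\<^sup>2 = (u x - u y)\<^sup>2 / norm (x - y) powr (real CARD('n) + 2 * s)"
  by (simp add: diff_quot_def power_divide power2_eq_square[of "_ powr _"] flip: powr_add)

lemma diff_sq_le:
  assumes "norm (x - y) \<le> r"
  shows "(u x - u y)\<^sup>2 \<le> r powr (real CARD('n) + 2 * s) * (diff_quot u (x, y))\<^sup>2"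
proof (cases "x = y")
  case False
  have "(u x - u y)\<^sup>2 = norm (x - y) powr (real CARD('n) + 2 * s) * (diff_quot u (x, y))\<^sup>2"
    using False by (simp add: diff_quot_sq)
  also have "\<dots> \<le> r powr (real CARD('n) + 2 * s) * (diff_quot u (x, y))\<^sup>2"
    using assms s by (intro mult_right_mono powr_mono2) auto
  finally show ?thesis .
qed simp

text \<open>Functions in \<open>X\<close> vanish on a ball of positive measure at bounded distance from
  \<open>\<Omega>\<close>; comparing with these zeros controls the values in \<open>\<Omega>\<close>.\<close>

lemma Poincare_pointwise:
  "\<exists>C\<ge>0. \<forall>u\<in>X. \<forall>x. ennreal ((u x)\<^sup>2) \<le> ennreal C * energy_density u x"
proof -
  obtain r where r: "r > 0" "\<And>x. x \<in> \<Omega> \<Longrightarrow> norm x \<le> r"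
    using bounded_\<Omega> by (auto simp: bounded_pos)
  obtain b :: "real ^ 'n" where b: "norm b = 1" using vector_choose_size[of 1] by auto
  \<comment> \<open>The unit ball around this point lies outside the ball of radius r that contains
    \<Omega>; its points are at most \<open>r + (r + 2) + 1\<close> away from those of
    \<Omega>.\<close>
  define z where "z = (r + 2) *\<^sub>R b"
  have z: "norm z = r + 2" using b r by (simp add: z_def)
  define Z where "Z = ball z 1"
  have Z_out: "y \<notin> \<Omega>" if "y \<in> Z" for y
    using that r(2)[of y] norm_triangle_ineq2[of z y] z by (auto simp: Z_def dist_norm)
  have Z_dist: "norm (x - y) \<le> 2 * r + 3" if "x \<in> \<Omega>" "y \<in> Z" for x y
  proof -
    have "norm (x - y) \<le> norm x + norm z + norm (z - y)"
      using norm_triangle_ineq4[of x z] norm_triangle_ineq[of "x - z" "z - y"] by simp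
    then show ?thesis using r(2)[OF that(1)] that(2) z by (simp add: Z_def dist_norm)
  qed
  define m where "m = measure lborel Z"
  have m: "m > 0" "emeasure lborel Z = ennreal m"
    unfolding m_def Z_def using content_ball_pos[of 1 z] emeasure_bounded_finite[OF bounded_ball, of z 1]
    by (auto simp: emeasure_eq_ennreal_measure)
  define c where "c = (2 * r + 3) powr (real CARD('n) + 2 * s)"
  have "ennreal ((u x)\<^sup>2) \<le> ennreal (c / m) * energy_density u x" if u: "u \<in> X" for u x
  proof (cases "x \<in> \<Omega>")
    case True
    have "ennreal m * ennreal ((u x)\<^sup>2) = (\<integral>\<^sup>+y. ennreal ((u x)\<^sup>2) * indicator Z y \<partial>lborel)"
      by (subst nn_integral_cmult_indicator) (auto simp: Z_def m(2)[unfolded Z_def] mult.commute)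
    also have "\<dots> \<le> (\<integral>\<^sup>+y. ennreal c * ennreal ((diff_quot u (x, y))\<^sup>2) \<partial>lborel)"
    proof (rule nn_integral_mono)
      fix y
      show "ennreal ((u x)\<^sup>2) * indicator Z y \<le> ennreal c * ennreal ((diff_quot u (x, y))\<^sup>2)"
      proof (cases "y \<in> Z")
        case yZ: True
        then show ?thesis
          using diff_sq_le[OF Z_dist[OF True yZ], of u] X_outside[OF u Z_out[OF yZ]]
          by (simp add: c_def ennreal_leI flip: ennreal_mult)
      qed simp
    qed
    also have "\<dots> = ennreal c * energy_density u x" by (rule nn_integral_cmult_diff_quot[OF u])
    finally have "ennreal (1 / m) * (ennreal m * ennreal ((u x)\<^sup>2)) \<le> ennreal (1 / m) * (ennreal c * energy_density u x)"
      by (rule mult_left_mono) simp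
    moreover have "ennreal (1 / m) * (ennreal m * ennreal ((u x)\<^sup>2)) = ennreal ((u x)\<^sup>2)"
      using m(1) by (simp flip: ennreal_mult)
    moreover have "ennreal (1 / m) * (ennreal c * energy_density u x) = ennreal (c / m) * energy_density u x"
      using m(1) by (simp add: c_def mult.assoc[symmetric] flip: ennreal_mult)
    ultimately show ?thesis by simp
  qed (simp add: X_outside[OF u])
  then show ?thesis using m(1) by (intro exI[of _ "c / m"]) (auto simp: c_def)
qed

lemma ennreal_int_bound:
  assumes u: "u \<in> X" and f: "\<And>x. ennreal (f x) \<le> ennreal a * ennreal ((u x)\<^sup>2) + ennreal b * energy_density u x"
    and ab: "0 \<le> a" "0 \<le> b"
  shows "(\<integral>\<^sup>+x. ennreal (f x) \<partial>lborel) \<le> ennreal (a * (L u)\<^sup>2 + b * (N u)\<^sup>2)"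
proof -
  have [measurable]: "u \<in> borel_measurable borel" using u by (rule X_measurable)
  have "(\<integral>\<^sup>+x. ennreal (f x) \<partial>lborel) \<le> (\<integral>\<^sup>+x. ennreal a * ennreal ((u x)\<^sup>2) + ennreal b * energy_density u x \<partial>lborel)"
    by (intro nn_integral_mono f)
  also have "\<dots> = ennreal a * (\<integral>\<^sup>+x. ennreal ((u x)\<^sup>2) \<partial>lborel) + ennreal b * (\<integral>\<^sup>+x. energy_density u x \<partial>lborel)"
    by (simp add: nn_integral_add nn_integral_cmult)
  also have "\<dots> = ennreal (a * (L u)\<^sup>2 + b * (N u)\<^sup>2)"
    using ab by (simp add: nn_integral_L[OF u] nn_integral_energy_density[OF u] ennreal_mult ennreal_plus)
  finally show ?thesis .
qed

lemma Poincare: "\<exists>C\<ge>0. \<forall>u\<in>X. L u \<le> C * N u"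
proof -
  obtain C where C: "C \<ge> 0" "\<And>u x. u \<in> X \<Longrightarrow> ennreal ((u x)\<^sup>2) \<le> ennreal C * energy_density u x"
    using Poincare_pointwise by blast
  have "L u \<le> sqrt C * N u" if u: "u \<in> X" for u
  proof (rule power2_le_imp_le)
    have "ennreal ((L u)\<^sup>2) \<le> ennreal (0 * (L u)\<^sup>2 + C * (N u)\<^sup>2)"
      unfolding nn_integral_L[OF u, symmetric] using C u by (intro ennreal_int_bound) auto
    then show "(L u)\<^sup>2 \<le> (sqrt C * N u)\<^sup>2" using C by (simp add: power_mult_distrib)
  qed (use u C in simp)
  then show ?thesis using C(1) by (intro exI[of _ "sqrt C"]) auto
qed

definition Poincare_const :: real where "Poincare_const = (SOME C. C \<ge> 0 \<and> (\<forall>u\<in>X. L u \<le> C * N u))"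

lemma Poincare_const: "0 \<le> Poincare_const" "u \<in> X \<Longrightarrow> L u \<le> Poincare_const * N u"
proof -
  have "Poincare_const \<ge> 0 \<and> (\<forall>u\<in>X. L u \<le> Poincare_const * N u)"
    unfolding Poincare_const_def by (rule someI_ex) (use Poincare in blast)
  then show "0 \<le> Poincare_const" "u \<in> X \<Longrightarrow> L u \<le> Poincare_const * N u" by auto
qed

end

section \<open>Dyadic averages and the Sobolev inequality\<close>

context gagliardo_space
begin

text \<open>Half-open dyadic cubes of side \<open>2^-k\<close>. Rounding down makes them a partition
  at each scale and nested between scales.\<close>

definition cell :: "nat \<Rightarrow> ('n \<Rightarrow> int) \<Rightarrow> (real ^ 'n) set" where
  "cell k z = {y. \<forall>i. \<lfloor>2 ^ k * y $ i\<rfloor> = z i}"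

definition cell_index :: "nat \<Rightarrow> real ^ 'n \<Rightarrow> 'n \<Rightarrow> int" where
  "cell_index k x = (\<lambda>i. \<lfloor>2 ^ k * x $ i\<rfloor>)"

text \<open>The reciprocal of the volume of a cell.\<close>

definition cell_density :: "nat \<Rightarrow> real" where "cell_density k = (2 ^ k) ^ CARD('n)"

definition cell_average :: "nat \<Rightarrow> ('n \<Rightarrow> int) \<Rightarrow> (real ^ 'n \<Rightarrow> real) \<Rightarrow> real" where
  "cell_average k z u = cell_density k * (\<integral>y. indicator (cell k z) y * u y \<partial>lborel)"

abbreviation avg :: "nat \<Rightarrow> (real ^ 'n \<Rightarrow> real) \<Rightarrow> real ^ 'n \<Rightarrow> real" where
  "avg k u x \<equiv> cell_average k (cell_index k x) u"

lemma cell_density_pos [simp]: "cell_density k > 0" by (simp add: cell_density_def)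

lemma in_cell: "y \<in> cell k z \<longleftrightarrow> cell_index k y = z"
  by (auto simp: cell_def cell_index_def)

lemma cell_iff: "y \<in> cell k z \<longleftrightarrow> (\<forall>i. of_int (z i) / 2 ^ k \<le> y $ i \<and> y $ i < (of_int (z i) + 1) / 2 ^ k)"
  by (simp add: cell_def floor_eq_iff field_simps)

lemma cell_borel [measurable]: "cell k z \<in> sets borel"
proof -
  have [measurable]: "(\<lambda>y :: real ^ 'n. y $ i) \<in> borel_measurable borel" for i
    by (intro borel_measurable_continuous_onI continuous_intros)
  have "{y \<in> space (borel :: (real ^ 'n) measure). \<forall>i. of_int (z i) / 2 ^ k \<le> y $ i \<and> y $ i < (of_int (z i) + 1) / 2 ^ k} \<in> sets borel"
    by measurable
  moreover have "cell k z = {y \<in> space (borel :: (real ^ 'n) measure). \<forall>i. of_int (z i) / 2 ^ k \<le> y $ i \<and> y $ i < (of_int (z i) + 1) / 2 ^ k}"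
    by (auto simp: cell_iff)
  ultimately show ?thesis by simp
qed

text \<open>The half-open cube is squeezed between an open and a closed box of equal volume.\<close>

lemma
  shows measure_cell: "measure lborel (cell k z) = 1 / cell_density k"
    and emeasure_cell: "emeasure lborel (cell k z) = ennreal (1 / cell_density k)"
proof -
  define a b :: "real ^ 'n" where "a = (\<chi> i. of_int (z i) / 2 ^ k)" and "b = (\<chi> i. (of_int (z i) + 1) / 2 ^ k)"
  have sub: "box a b \<subseteq> cell k z" "cell k z \<subseteq> cbox a b"
    by (auto simp: cell_iff mem_box_cart a_def b_def less_imp_le)
  have "cbox a b \<noteq> {}" by (simp add: interval_ne_empty_cart a_def b_def divide_right_mono)
  then have c: "measure lborel (cbox a b) = 1 / cell_density k"
    by (simp add: content_cbox_cart a_def b_def cell_density_def add_divide_distrib power_one_over)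
  have fin: "emeasure lborel (cbox a b) < \<infinity>" by (rule emeasure_bounded_finite) simp
  have fin': "emeasure lborel (cell k z) < \<infinity>"
    using emeasure_mono[OF sub(2), of lborel] fin by (simp add: order_le_less_trans)
  have "measure lborel (box a b) \<le> measure lborel (cell k z)"
    using fin' sub by (intro measure_mono_fmeasurable) (auto simp: fmeasurable_def)
  moreover have "measure lborel (cell k z) \<le> measure lborel (cbox a b)"
    using fin sub by (intro measure_mono_fmeasurable) (auto simp: fmeasurable_def)
  ultimately show *: "measure lborel (cell k z) = 1 / cell_density k" using c by (simp add: measure_lborel_box_eq measure_lborel_cbox_eq)
  show "emeasure lborel (cell k z) = ennreal (1 / cell_density k)"
    using fin' * by (simp add: emeasure_eq_ennreal_measure)
qed

lemma cell_sq: "indicator (cell k z) \<in> sq_integrable lborel"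
  by (intro sq_integrable_indicator) (simp_all add: emeasure_cell)

lemma cell_mult_sq:
  assumes "u \<in> X"
  shows "(\<lambda>y. indicator (cell k z) y * u y) \<in> sq_integrable lborel"
proof -
  have [measurable]: "u \<in> borel_measurable borel" using assms by (rule X_measurable)
  have "integrable lborel (\<lambda>y. (indicator (cell k z) y * u y)\<^sup>2)"
    by (rule Bochner_Integration.integrable_bound[of _ "\<lambda>y. (u y)\<^sup>2"])
      (use X_sq[OF assms] in \<open>auto simp: sq_integrable_def split: split_indicator\<close>)
  then show ?thesis by (simp add: sq_integrable_def)
qed

lemma integrable_cell:
  assumes "u \<in> X"
  shows "integrable lborel (\<lambda>y. indicator (cell k z) y * u y)"
  using sq_integrable_mult[OF cell_sq X_sq[OF assms]] .

lemma cell_average_diff: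
  assumes "u \<in> X" "v \<in> X"
  shows "cell_average k z (u - v) = cell_average k z u - cell_average k z v"
  using integrable_cell[OF assms(1), of k z] integrable_cell[OF assms(2), of k z]
  by (simp add: cell_average_def algebra_simps)

text \<open>The left side is the square of the average of \<open>c - u\<close>, so this is Jensen's
  inequality, obtained by Cauchy-Schwarz against the indicator of the cell.\<close>

lemma cell_average_deviation:
  assumes u: "u \<in> X"
  shows "ennreal ((c - cell_average k z u)\<^sup>2) \<le> ennreal (cell_density k) * (\<integral>\<^sup>+y. indicator (cell k z) y * ennreal ((c - u y)\<^sup>2) \<partial>lborel)"
proof -
  define g where "g y = indicator (cell k z) y * c - indicator (cell k z) y * u y" for y
  have g: "g \<in> sq_integrable lborel"
    unfolding g_def using sq_integrable_scale[OF cell_sq, of c k z] cell_mult_sq[OF u]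
    by (intro sq_integrable_diff) (simp_all add: mult.commute)
  have ig: "(\<integral>y. indicator (cell k z) y * g y \<partial>lborel) = (c - cell_average k z u) / cell_density k"
  proof -
    have "(\<integral>y. indicator (cell k z) y * g y \<partial>lborel) = (\<integral>y. indicator (cell k z) y * c - indicator (cell k z) y * u y \<partial>lborel)"
      by (intro Bochner_Integration.integral_cong) (auto simp: g_def split: split_indicator)
    also have "\<dots> = c / cell_density k - cell_average k z u / cell_density k"
    proof -
      have i: "integrable lborel (indicator (cell k z) :: _ \<Rightarrow> real)"
        by (rule integrable_real_indicator) (simp_all add: emeasure_cell)
      have 1: "integrable lborel (\<lambda>y. indicator (cell k z) y * c)"
        using i by (rule integrable_mult_left)
      have 2: "(\<integral>y. indicator (cell k z) y * c \<partial>lborel) = c / cell_density k" by (simp add: measure_cell)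
      have 3: "(\<integral>y. indicator (cell k z) y * u y \<partial>lborel) = cell_average k z u / cell_density k"
        using less_imp_neq[OF cell_density_pos[of k]] by (auto simp: cell_average_def)
      show ?thesis by (simp only: Bochner_Integration.integral_diff[OF 1 integrable_cell[OF u]] 2 3)
    qed
    finally show ?thesis by (simp add: diff_divide_distrib)
  qed
  have "((c - cell_average k z u) / cell_density k)\<^sup>2 \<le> (\<integral>y. (indicator (cell k z) y)\<^sup>2 \<partial>lborel) * (\<integral>y. (g y)\<^sup>2 \<partial>lborel)"
    using integral_Cauchy_Schwarz[OF cell_sq[of k z] g] unfolding ig .
  also have "(\<integral>y. (indicator (cell k z) y)\<^sup>2 \<partial>lborel) = 1 / cell_density k"
  proof -
    have "(\<lambda>y. (indicator (cell k z) y :: real)\<^sup>2) = indicator (cell k z)" by (auto split: split_indicator)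
    then show ?thesis by (simp add: measure_cell)
  qed
  finally have "(c - cell_average k z u)\<^sup>2 \<le> cell_density k * (\<integral>y. (g y)\<^sup>2 \<partial>lborel)"
    using cell_density_pos[of k] by (simp add: power_divide power2_eq_square[of "cell_density k"] field_simps)
  then have "ennreal ((c - cell_average k z u)\<^sup>2) \<le> ennreal (cell_density k) * ennreal (\<integral>y. (g y)\<^sup>2 \<partial>lborel)"
    using cell_density_pos[of k] by (simp add: ennreal_leI less_imp_le flip: ennreal_mult)
  also have "ennreal (\<integral>y. (g y)\<^sup>2 \<partial>lborel) = (\<integral>\<^sup>+y. ennreal ((g y)\<^sup>2) \<partial>lborel)"
    using g by (intro nn_integral_eq_integral[symmetric]) (auto simp: sq_integrable_def)
  also have "\<dots> = (\<integral>\<^sup>+y. indicator (cell k z) y * ennreal ((c - u y)\<^sup>2) \<partial>lborel)"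
    by (intro nn_integral_cong) (auto simp: g_def split: split_indicator)
  finally show ?thesis .
qed

text \<open>Per dyadic scale, the squared error of averaging shrinks by \<open>cell_decay\<close>
  and the supremum bound of the averages grows by \<open>cell_growth\<close>.
  \<open>cell_const\<close> comes from bounding the diameter of a cell by \<open>n / 2^k\<close>,
  with n the dimension.\<close>

definition cell_decay :: real where "cell_decay = 2 powr (- 2 * s)"
definition cell_growth :: real where "cell_growth = 2 powr (real CARD('n) / 2 - s)"
definition cell_const :: real where "cell_const = real CARD('n) powr (real CARD('n) + 2 * s)"

lemma cell_decay: "0 < cell_decay" "cell_decay < 1" using s by (auto simp: cell_decay_def powr_less_one)

lemma cell_growth: "1 < cell_growth" using s by (simp add: cell_growth_def gr_one_powr)

lemma cell_const: "0 < cell_const" by (simp add: cell_const_def)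

lemma cell_diameter:
  assumes "x \<in> cell k z" "y \<in> cell k z"
  shows "norm (x - y) \<le> real CARD('n) / 2 ^ k"
proof -
  have "\<bar>(x - y) $ i\<bar> \<le> 1 / 2 ^ k" for i
  proof -
    have "(of_int (z i) + 1) / 2 ^ k = of_int (z i) / 2 ^ k + (1 :: real) / 2 ^ k" by (simp add: add_divide_distrib)
    then show ?thesis using assms[unfolded cell_iff] by (smt (verit) vector_minus_component)
  qed
  then have "(\<Sum>i\<in>UNIV. \<bar>(x - y) $ i\<bar>) \<le> (\<Sum>i\<in>(UNIV :: 'n set). 1 / 2 ^ k)" by (intro sum_mono)
  then show ?thesis using norm_le_l1_cart[of "x - y"] by simp
qed

lemma scale_identity: "cell_density k * (real CARD('n) / 2 ^ k) powr (real CARD('n) + 2 * s) = cell_const * cell_decay ^ k"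
proof -
  have "cell_density k = (2 ^ k) powr real CARD('n)" by (simp add: cell_density_def powr_realpow)
  moreover have "cell_decay ^ k = (2 ^ k) powr (- 2 * s)"
    by (simp add: cell_decay_def powr_power powr_powr[symmetric] flip: powr_realpow) (simp add: powr_powr mult.commute)
  moreover have "(real CARD('n) / 2 ^ k) powr (real CARD('n) + 2 * s)
      = cell_const / (2 ^ k) powr (real CARD('n) + 2 * s)"
    by (simp add: powr_divide cell_const_def)
  moreover have "(2 ^ k :: real) powr real CARD('n) / (2 ^ k) powr (real CARD('n) + 2 * s) = (2 ^ k) powr (- 2 * s)"
    by (simp flip: powr_diff)
  ultimately show ?thesis by (metis times_divide_eq_right mult.commute)
qed

text \<open>The squared error at x is at most the average of the squared differences from x over its
  cell. There the distance is at most the diameter, so each squared difference is a small multiple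
  of the squared quotient.\<close>

lemma avg_approx:
  assumes u: "u \<in> X"
  shows "ennreal ((u x - avg k u x)\<^sup>2) \<le> ennreal (cell_const * cell_decay ^ k) * energy_density u x"
proof -
  define d where "d = (real CARD('n) / 2 ^ k) powr (real CARD('n) + 2 * s)"
  have "ennreal ((u x - avg k u x)\<^sup>2) \<le> ennreal (cell_density k) * (\<integral>\<^sup>+y. indicator (cell k (cell_index k x)) y * ennreal ((u x - u y)\<^sup>2) \<partial>lborel)"
    by (rule cell_average_deviation[OF u])
  also have "\<dots> \<le> ennreal (cell_density k) * (\<integral>\<^sup>+y. ennreal d * ennreal ((diff_quot u (x, y))\<^sup>2) \<partial>lborel)"
  proof (intro mult_left_mono nn_integral_mono)
    show "indicator (cell k (cell_index k x)) y * ennreal ((u x - u y)\<^sup>2) \<le> ennreal d * ennreal ((diff_quot u (x, y))\<^sup>2)" for y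
    proof (cases "y \<in> cell k (cell_index k x)")
      case True
      have "(u x - u y)\<^sup>2 \<le> d * (diff_quot u (x, y))\<^sup>2"
        unfolding d_def by (rule diff_sq_le) (use cell_diameter[of x k "cell_index k x" y] True in \<open>simp add: in_cell\<close>)
      then show ?thesis by (simp add: True d_def ennreal_leI flip: ennreal_mult)
    qed simp
  qed simp
  also have "\<dots> = ennreal (cell_density k * d) * energy_density u x"
    by (simp add: nn_integral_cmult_diff_quot[OF u] mult.assoc ennreal_mult d_def less_imp_le)
  finally show ?thesis by (simp add: d_def scale_identity)
qed

lemma cell_index_Suc: "cell_index (Suc k) x = cell_index (Suc k) y \<Longrightarrow> cell_index k x = cell_index k y"
proof -
  assume *: "cell_index (Suc k) x = cell_index (Suc k) y"
  have "\<lfloor>a\<rfloor> = \<lfloor>a'\<rfloor>" if "\<lfloor>2 * a\<rfloor> = \<lfloor>2 * a'\<rfloor>" for a a' :: real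
    using floor_divide_real_eq_div[of 2 "2 * a"] floor_divide_real_eq_div[of 2 "2 * a'"] that by simp
  from this[of "2 ^ k * x $ i" "2 ^ k * y $ i" for i] show ?thesis
    using * by (auto simp: cell_index_def fun_eq_iff mult.assoc)
qed

lemma cell_growth_sq: "cell_growth\<^sup>2 = 2 ^ CARD('n) * cell_decay"
proof -
  have "2 ^ CARD('n) = (2 :: real) powr real CARD('n)" by (simp add: powr_realpow)
  then show ?thesis by (simp add: cell_growth_def cell_decay_def power2_eq_square flip: powr_add)
qed

text \<open>The coarse average is constant on the finer cell and equals the coarse average at each
  of its points. The difference is therefore an average of errors already controlled by
  \<open>avg_approx\<close>, and integrating the energy density gives the full energy.\<close>

lemma avg_step:
  assumes u: "u \<in> X"
  shows "\<bar>avg (Suc k) u x - avg k u x\<bar> \<le> sqrt (2 ^ CARD('n) * cell_const) * cell_growth ^ k * N u"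
proof -
  define c where "c = avg k u x"
  have [measurable]: "u \<in> borel_measurable borel" using u by (rule X_measurable)
  have "ennreal ((c - avg (Suc k) u x)\<^sup>2)
      \<le> ennreal (cell_density (Suc k)) * (\<integral>\<^sup>+y. indicator (cell (Suc k) (cell_index (Suc k) x)) y * ennreal ((c - u y)\<^sup>2) \<partial>lborel)"
    by (rule cell_average_deviation[OF u])
  also have "\<dots> \<le> ennreal (cell_density (Suc k)) * (\<integral>\<^sup>+y. ennreal (cell_const * cell_decay ^ k) * energy_density u y \<partial>lborel)"
  proof (intro mult_left_mono nn_integral_mono)
    fix y
    show "indicator (cell (Suc k) (cell_index (Suc k) x)) y * ennreal ((c - u y)\<^sup>2) \<le> ennreal (cell_const * cell_decay ^ k) * energy_density u y"
    proof (cases "y \<in> cell (Suc k) (cell_index (Suc k) x)")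
      case True
      then have "cell_index k y = cell_index k x" using cell_index_Suc[of k y x] by (simp add: in_cell)
      then have "c = avg k u y" by (simp add: c_def)
      then show ?thesis using avg_approx[OF u, of y k] True by (simp add: power2_commute)
    qed simp
  qed simp
  also have "\<dots> = ennreal (cell_density (Suc k)) * (ennreal (cell_const * cell_decay ^ k) * ennreal ((N u)\<^sup>2))"
    by (subst nn_integral_cmult) (auto simp: nn_integral_energy_density[OF u])
  also have "\<dots> = ennreal (cell_density (Suc k) * (cell_const * cell_decay ^ k * (N u)\<^sup>2))"
    using cell_const cell_decay by (simp add: ennreal_mult less_imp_le)
  finally have "(c - avg (Suc k) u x)\<^sup>2 \<le> cell_density (Suc k) * (cell_const * cell_decay ^ k * (N u)\<^sup>2)"
    using cell_const cell_decay by (simp add: less_imp_le)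
  also have "\<dots> = (2 ^ CARD('n) * cell_const) * (cell_growth\<^sup>2) ^ k * (N u)\<^sup>2"
    unfolding cell_growth_sq by (simp add: cell_density_def power_mult_distrib algebra_simps flip: power_mult)
  also have "\<dots> = (sqrt (2 ^ CARD('n) * cell_const) * cell_growth ^ k * N u)\<^sup>2"
    using cell_const by (simp add: power_mult_distrib mult.commute flip: power_mult)
  finally have "\<bar>c - avg (Suc k) u x\<bar> \<le> \<bar>sqrt (2 ^ CARD('n) * cell_const) * cell_growth ^ k * N u\<bar>"
    by (simp only: abs_le_square_iff)
  then show ?thesis using cell_const cell_growth u by (simp add: c_def abs_mult abs_minus_commute)
qed

lemma avg_0_le:
  assumes u: "u \<in> X"
  shows "\<bar>avg 0 u x\<bar> \<le> L u"
proof -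
  have "ennreal ((0 - avg 0 u x)\<^sup>2) \<le> ennreal (cell_density 0) * (\<integral>\<^sup>+y. indicator (cell 0 (cell_index 0 x)) y * ennreal ((0 - u y)\<^sup>2) \<partial>lborel)"
    by (rule cell_average_deviation[OF u])
  also have "\<dots> \<le> ennreal (cell_density 0) * (\<integral>\<^sup>+y. ennreal ((u y)\<^sup>2) \<partial>lborel)"
    by (intro mult_left_mono nn_integral_mono) (auto split: split_indicator)
  finally have "(avg 0 u x)\<^sup>2 \<le> (L u)\<^sup>2" by (simp add: cell_density_def nn_integral_L[OF u])
  then show ?thesis by (simp add: abs_le_square_iff[symmetric])
qed

text \<open>The first entry starts the induction at scale 0, with 1 added for positivity. The second
  is the least constant for which adding one increment at scale k stays within the bound for scale
  \<open>Suc k\<close>.\<close>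

definition avg_bound :: real where "avg_bound = max (Poincare_const + 1) (sqrt (2 ^ CARD('n) * cell_const) / (cell_growth - 1))"

lemma avg_bound_pos: "avg_bound > 0" using Poincare_const(1) by (simp add: avg_bound_def)

lemma avg_le:
  assumes u: "u \<in> X"
  shows "\<bar>avg k u x\<bar> \<le> avg_bound * cell_growth ^ k * N u"
proof (induction k)
  case 0
  have "L u \<le> Poincare_const * N u" using Poincare_const u by blast
  also have "\<dots> \<le> avg_bound * N u" using u by (intro mult_right_mono) (auto simp: avg_bound_def)
  finally show ?case using avg_0_le[OF u, of x] by simp
next
  case (Suc k)
  define c where "c = sqrt (2 ^ CARD('n) * cell_const)"
  have "c / (cell_growth - 1) \<le> avg_bound" by (simp add: avg_bound_def c_def)
  then have "c \<le> avg_bound * (cell_growth - 1)" using cell_growth by (simp add: field_simps)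
  then have "c * (cell_growth ^ k * N u) \<le> avg_bound * (cell_growth - 1) * (cell_growth ^ k * N u)"
    using cell_growth u by (intro mult_right_mono) auto
  moreover have "\<bar>avg (Suc k) u x\<bar> \<le> c * cell_growth ^ k * N u + avg_bound * cell_growth ^ k * N u"
    using Suc avg_step[OF u, of k x] unfolding c_def by linarith
  ultimately show ?case by (simp add: algebra_simps)
qed

text \<open>Small values are covered by the square of u. For a value between two consecutive levels,
  two factors of u give the error at scale k, decaying like \<open>cell_decay ^ k\<close>, while the
  remaining power \<open>p - 2\<close> is at most the next level and grows like
  \<open>cell_growth powr (p - 2)\<close> to the power k.\<close>

lemma Lp_pointwise:
  assumes p: "2 \<le> p" "p \<le> 2 * real CARD('n) / (real CARD('n) - 2 * s)"
  shows "\<exists>C\<ge>0. \<forall>u\<in>X. N u \<le> 1 \<longrightarrow> (\<forall>x. ennreal (\<bar>u x\<bar> powr p) \<le> ennreal C * ennreal ((u x)\<^sup>2) + ennreal C * energy_density u x)"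
proof -
  define lev where "lev k = 2 * avg_bound * cell_growth ^ k" for k :: nat
  have lev_pos: "lev k > 0" for k using avg_bound_pos cell_growth by (simp add: lev_def)
  \<comment> \<open>Here the critical exponent appears: with n the dimension,
    \<open>(n / 2 - s) * (p - 2) \<le> 2 * s\<close> says exactly that
    \<open>p \<le> 2 * n / (n - 2 * s)\<close>.\<close>
  have key: "cell_growth powr (p - 2) * cell_decay \<le> 1"
  proof -
    have "p * (real CARD('n) - 2 * s) \<le> 2 * real CARD('n)"
      using p(2) s by (simp add: field_simps)
    then have "(real CARD('n) / 2 - s) * (p - 2) + - 2 * s \<le> 0" by (simp add: algebra_simps)
    moreover have "cell_growth powr (p - 2) * cell_decay = 2 powr ((real CARD('n) / 2 - s) * (p - 2) + - 2 * s)"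
      by (simp only: cell_growth_def cell_decay_def powr_powr powr_add)
    ultimately show ?thesis using powr_mono[of "(real CARD('n) / 2 - s) * (p - 2) + - 2 * s" 0 2] by simp
  qed
  define C1 where "C1 = lev 0 powr (p - 2)"
  define C2 where "C2 = 4 * (2 * avg_bound * cell_growth) powr (p - 2) * cell_const"
  define C where "C = max C1 C2"
  have C: "C1 \<le> C" "C2 \<le> C" "0 \<le> C" by (auto simp: C_def C1_def le_max_iff_disj)
  have split: "\<bar>t\<bar> powr p = \<bar>t\<bar> powr (p - 2) * t\<^sup>2" for t :: real
  proof (cases "t = 0")
    case False
    have "\<bar>t\<bar> powr p = \<bar>t\<bar> powr ((p - 2) + 2)" by simp
    also have "\<dots> = \<bar>t\<bar> powr (p - 2) * \<bar>t\<bar> powr 2" by (rule powr_add)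
    also have "\<bar>t\<bar> powr 2 = t\<^sup>2" using False by (simp add: powr_numeral)
    finally show ?thesis .
  qed simp
  have "ennreal (\<bar>u x\<bar> powr p) \<le> ennreal C * ennreal ((u x)\<^sup>2) + ennreal C * energy_density u x"
    if u: "u \<in> X" "N u \<le> 1" for u x
  proof (cases "\<bar>u x\<bar> \<le> lev 0")
    case True
    have "\<bar>u x\<bar> powr p \<le> C1 * (u x)\<^sup>2"
      unfolding split C1_def using True p by (intro mult_right_mono powr_mono2) auto
    also have "\<dots> \<le> C * (u x)\<^sup>2" using C by (intro mult_right_mono) auto
    finally have "ennreal (\<bar>u x\<bar> powr p) \<le> ennreal C * ennreal ((u x)\<^sup>2)"
      using C by (simp add: ennreal_leI flip: ennreal_mult)
    then show ?thesis by (simp add: add_increasing2)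
  next
    case False
    have "\<exists>k. \<bar>u x\<bar> \<le> lev k"
    proof -
      obtain k where "\<bar>u x\<bar> / (2 * avg_bound) < cell_growth ^ k" using real_arch_pow[OF cell_growth] by blast
      then show ?thesis using avg_bound_pos by (intro exI[of _ k]) (simp add: lev_def field_simps)
    qed
    \<comment> \<open>The last level still exceeded. Levels are twice the bound on the averages, so
      the average at scale k is less than half of the value of u.\<close>
    then obtain k where k: "\<not> \<bar>u x\<bar> \<le> lev k" "\<bar>u x\<bar> \<le> lev (Suc k)"
      using exists_least_lemma[of "\<lambda>k. \<bar>u x\<bar> \<le> lev k"] False by blast
    have "\<bar>avg k u x\<bar> \<le> avg_bound * cell_growth ^ k * N u" by (rule avg_le[OF u(1)])
    also have "\<dots> \<le> avg_bound * cell_growth ^ k" using avg_bound_pos cell_growth u by (simp add: mult_left_le)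
    finally have half: "2 * \<bar>avg k u x\<bar> < \<bar>u x\<bar>" using k(1) by (simp add: lev_def)
    have arith: "b \<le> 2 * d" if "2 * a < b" "b - a \<le> d" for a b d :: real
      using that by linarith
    have "\<bar>u x\<bar> \<le> 2 * \<bar>u x - avg k u x\<bar>" by (rule arith[OF half abs_triangle_ineq2])
    then have "\<bar>u x\<bar>\<^sup>2 \<le> (2 * \<bar>u x - avg k u x\<bar>)\<^sup>2" by (rule power_mono) simp
    then have sq: "(u x)\<^sup>2 \<le> 4 * (u x - avg k u x)\<^sup>2" by (simp add: power_mult_distrib)
    have "\<bar>u x\<bar> powr p \<le> lev (Suc k) powr (p - 2) * (4 * (u x - avg k u x)\<^sup>2)"
      unfolding split using k p sq by (intro mult_mono powr_mono2) auto
    also have "lev (Suc k) powr (p - 2) = (2 * avg_bound * cell_growth) powr (p - 2) * (cell_growth powr (p - 2)) ^ k"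
      using avg_bound_pos cell_growth by (simp add: lev_def powr_mult powr_power powr_realpow[symmetric] powr_powr mult.commute mult.left_commute)
    finally have "ennreal (\<bar>u x\<bar> powr p) \<le> ennreal (4 * (2 * avg_bound * cell_growth) powr (p - 2) * (cell_growth powr (p - 2)) ^ k) * ennreal ((u x - avg k u x)\<^sup>2)"
      by (simp add: ennreal_leI mult.assoc mult.left_commute flip: ennreal_mult)
    also have "\<dots> \<le> ennreal (4 * (2 * avg_bound * cell_growth) powr (p - 2) * (cell_growth powr (p - 2)) ^ k) * (ennreal (cell_const * cell_decay ^ k) * energy_density u x)"
      by (intro mult_left_mono avg_approx[OF u(1)]) simp
    also have "\<dots> = ennreal (C2 * (cell_growth powr (p - 2) * cell_decay) ^ k) * energy_density u x"
      using cell_const cell_decay cell_growth by (simp add: C2_def mult.assoc[symmetric] power_mult_distrib flip: ennreal_mult) (simp add: mult_ac)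
    also have "\<dots> \<le> ennreal C * energy_density u x"
    proof -
      have "(cell_growth powr (p - 2) * cell_decay) ^ k \<le> 1" using key cell_decay by (intro power_le_one) auto
      moreover have "0 \<le> C2" using cell_const by (simp add: C2_def)
      ultimately have "C2 * (cell_growth powr (p - 2) * cell_decay) ^ k \<le> C"
        using C(2) by (meson mult_left_le order_trans)
      then show ?thesis by (intro mult_right_mono ennreal_leI) auto
    qed
    finally show ?thesis by (simp add: add_increasing)
  qed
  then show ?thesis using C(3) by blast
qed

theorem Sobolev:
  assumes p: "2 \<le> p" "p \<le> 2 * real CARD('n) / (real CARD('n) - 2 * s)"
  shows "\<exists>C\<ge>0. \<forall>u\<in>X. integrable lborel (\<lambda>x. \<bar>u x\<bar> powr p) \<and> (\<integral>x. \<bar>u x\<bar> powr p \<partial>lborel) \<le> C * N u powr p"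
proof -
  obtain C where C: "C \<ge> 0" "\<And>u x. u \<in> X \<Longrightarrow> N u \<le> 1 \<Longrightarrow> ennreal (\<bar>u x\<bar> powr p) \<le> ennreal C * ennreal ((u x)\<^sup>2) + ennreal C * energy_density u x"
    using Lp_pointwise[OF p] by blast
  define C' where "C' = C * (Poincare_const\<^sup>2 + 1)"
  have C': "C' \<ge> 0" using C by (simp add: C'_def)
  have unit: "(\<integral>\<^sup>+x. ennreal (\<bar>u x\<bar> powr p) \<partial>lborel) \<le> ennreal (C' * (N u)\<^sup>2)" if u: "u \<in> X" "N u \<le> 1" for u
  proof -
    have "(\<integral>\<^sup>+x. ennreal (\<bar>u x\<bar> powr p) \<partial>lborel) \<le> ennreal (C * (L u)\<^sup>2 + C * (N u)\<^sup>2)"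
      using C u by (intro ennreal_int_bound) auto
    also have "\<dots> \<le> ennreal (C' * (N u)\<^sup>2)"
    proof -
      have "(L u)\<^sup>2 \<le> (Poincare_const * N u)\<^sup>2" using Poincare_const u by (intro power_mono) auto
      then have "C * (L u)\<^sup>2 \<le> C * (Poincare_const * N u)\<^sup>2" using C by (intro mult_left_mono)
      then show ?thesis by (intro ennreal_leI) (simp add: C'_def algebra_simps power_mult_distrib)
    qed
    finally show ?thesis .
  qed
  have gen: "(\<integral>\<^sup>+x. ennreal (\<bar>u x\<bar> powr p) \<partial>lborel) \<le> ennreal (C' * N u powr p)" if u: "u \<in> X" for u
  \<comment> \<open>Functions of norm zero cannot be normalised, but they fall under
    \<open>unit\<close> directly.\<close>
  proof (cases "N u = 0")
    case True
    then show ?thesis using unit[OF u] by simp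
  next
    case False
    then have Nu: "N u > 0" using u N_nonneg[of u] by linarith
    define v where "v = (1 / N u) *\<^sub>R u"
    have v: "v \<in> X" "N v = 1" using u Nu by (auto simp: v_def N_scale)
    have [measurable]: "v \<in> borel_measurable borel" using v by (intro X_measurable)
    have "u x = N u * v x" for x using Nu by (simp add: v_def)
    then have "(\<integral>\<^sup>+x. ennreal (\<bar>u x\<bar> powr p) \<partial>lborel) = (\<integral>\<^sup>+x. ennreal (N u powr p) * ennreal (\<bar>v x\<bar> powr p) \<partial>lborel)"
      using Nu by (intro nn_integral_cong) (metis abs_mult abs_of_pos abs_ge_zero ennreal_mult powr_ge_zero powr_mult less_imp_le)
    also have "\<dots> = ennreal (N u powr p) * (\<integral>\<^sup>+x. ennreal (\<bar>v x\<bar> powr p) \<partial>lborel)"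
      by (intro nn_integral_cmult) measurable
    also have "\<dots> \<le> ennreal (N u powr p) * ennreal C'"
      using unit[OF v(1)] v(2) by (intro mult_left_mono) auto
    also have "\<dots> = ennreal (C' * N u powr p)" using C' by (simp add: mult.commute flip: ennreal_mult)
    finally show ?thesis .
  qed
  have "integrable lborel (\<lambda>x. \<bar>u x\<bar> powr p) \<and> (\<integral>x. \<bar>u x\<bar> powr p \<partial>lborel) \<le> C' * N u powr p" if u: "u \<in> X" for u
  proof -
    have [measurable]: "u \<in> borel_measurable borel" using u by (rule X_measurable)
    have int: "integrable lborel (\<lambda>x. \<bar>u x\<bar> powr p)"
      using gen[OF u] by (intro integrableI_bounded) (auto simp: order_le_less_trans less_top[symmetric] top_unique)
    have "ennreal (\<integral>x. \<bar>u x\<bar> powr p \<partial>lborel) \<le> ennreal (C' * N u powr p)"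
      using gen[OF u] by (subst nn_integral_eq_integral[symmetric, OF int]) auto
    then show ?thesis using int C' by simp
  qed
  then show ?thesis using C' by blast
qed

end

section \<open>Compactness of the embedding into square integrable functions\<close>

lemma summable_AE_of_L1:
  fixes g :: "nat \<Rightarrow> 'a \<Rightarrow> real"
  assumes [measurable]: "\<And>m. g m \<in> borel_measurable M" and nn: "\<And>m x. 0 \<le> g m x"
    and le: "\<And>m. (\<integral>\<^sup>+x. ennreal (g m x) \<partial>M) \<le> ennreal (c m)" and c: "summable c" "\<And>m. 0 \<le> c m"
  shows "AE x in M. summable (\<lambda>m. g m x)"
proof -
  have "(\<integral>\<^sup>+x. (\<Sum>m. ennreal (g m x)) \<partial>M) = (\<Sum>m. \<integral>\<^sup>+x. ennreal (g m x) \<partial>M)"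
    by (intro nn_integral_suminf) measurable
  also have "\<dots> \<le> (\<Sum>m. ennreal (c m))" by (intro suminf_le le) auto
  also have "\<dots> < \<infinity>" using ennreal_suminf_neq_top[OF c] by (simp add: less_top)
  finally have "AE x in M. (\<Sum>m. ennreal (g m x)) \<noteq> \<infinity>"
    by (intro nn_integral_noteq_infinite) auto
  then show ?thesis by eventually_elim (use nn summable_suminf_not_top in auto)
qed

text \<open>The parameter \<open>start\<close> allows the bound to hold only on a tail, as in a
  Cauchy estimate.\<close>

lemma Fatou_sq:
  fixes f :: "nat \<Rightarrow> 'a \<Rightarrow> real"
  assumes [measurable]: "\<And>j. f j \<in> borel_measurable M" "g \<in> borel_measurable M"
    and lim: "AE x in M. (\<lambda>j. f j x) \<longlonglongrightarrow> g x"
    and le: "\<And>j. j \<ge> start \<Longrightarrow> (\<integral>\<^sup>+x. ennreal ((f j x)\<^sup>2) \<partial>M) \<le> c"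
  shows "(\<integral>\<^sup>+x. ennreal ((g x)\<^sup>2) \<partial>M) \<le> c"
proof -
  have "AE x in M. ennreal ((g x)\<^sup>2) = liminf (\<lambda>j. ennreal ((f j x)\<^sup>2))"
    using lim
  proof eventually_elim
    fix x assume "(\<lambda>j. f j x) \<longlonglongrightarrow> g x"
    then have "(\<lambda>j. ennreal ((f j x)\<^sup>2)) \<longlonglongrightarrow> ennreal ((g x)\<^sup>2)"
      by (intro tendsto_ennrealI tendsto_power)
    then show "ennreal ((g x)\<^sup>2) = liminf (\<lambda>j. ennreal ((f j x)\<^sup>2))"
      by (intro lim_imp_Liminf[symmetric]) auto
  qed
  then have "(\<integral>\<^sup>+x. ennreal ((g x)\<^sup>2) \<partial>M) = (\<integral>\<^sup>+x. liminf (\<lambda>j. ennreal ((f j x)\<^sup>2)) \<partial>M)"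
    by (rule nn_integral_cong_AE)
  also have "\<dots> \<le> liminf (\<lambda>j. \<integral>\<^sup>+x. ennreal ((f j x)\<^sup>2) \<partial>M)"
    by (intro nn_integral_liminf) measurable
  also have "\<dots> \<le> liminf (\<lambda>j. c)"
    using le by (intro Liminf_mono) (auto simp: eventually_sequentially)
  also have "\<dots> = c" by (simp add: Liminf_const)
  finally show ?thesis .
qed

lemma sq_integrableI:
  assumes "f \<in> borel_measurable M" "(\<integral>\<^sup>+x. ennreal ((f x)\<^sup>2) \<partial>M) \<le> ennreal c"
  shows "f \<in> sq_integrable M"
  using assms by (auto simp: sq_integrable_def intro!: integrableI_bounded intro: order_le_less_trans)

context gagliardo_space
begin

text \<open>Convergence almost everywhere passes to the difference quotients on pairs, and Fatou
  bounds the energy of the limit.\<close>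

lemma X_limit:
  assumes u: "\<And>j. u j \<in> X" "\<And>j. N (u j) \<le> K"
    and v: "v \<in> borel_measurable borel" "\<And>x. x \<notin> \<Omega> \<Longrightarrow> v x = 0" "v \<in> sq_integrable lborel"
    and lim: "AE x in lborel. (\<lambda>j. u j x) \<longlonglongrightarrow> v x"
  shows "v \<in> X \<and> N v \<le> K"
proof -
  have K: "0 \<le> K" using order_trans[OF N_nonneg[OF u(1)] u(2)] .
  have m: "diff_quot (u j) \<in> borel_measurable lborel" "diff_quot v \<in> borel_measurable lborel" for j
    using diff_quot_measurable[OF X_measurable[OF u(1)]] diff_quot_measurable[OF v(1)] by simp_all
  have "AE p in lborel. (\<lambda>j. diff_quot (u j) p) \<longlonglongrightarrow> diff_quot v p"
    using AE_prod_lborel[OF lim]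
  proof eventually_elim
    fix p :: "(real ^ 'n) \<times> (real ^ 'n)"
    assume "(\<lambda>j. u j (fst p)) \<longlonglongrightarrow> v (fst p) \<and> (\<lambda>j. u j (snd p)) \<longlonglongrightarrow> v (snd p)"
    then show "(\<lambda>j. diff_quot (u j) p) \<longlonglongrightarrow> diff_quot v p"
      unfolding diff_quot_def case_prod_beta divide_inverse by (intro tendsto_mult tendsto_diff tendsto_const) auto
  qed
  then have le: "(\<integral>\<^sup>+p. ennreal ((diff_quot v p)\<^sup>2) \<partial>lborel) \<le> ennreal (K\<^sup>2)"
  proof (rule Fatou_sq[where f = "\<lambda>j. diff_quot (u j)" and start = 0, OF m])
    show "(\<integral>\<^sup>+p. ennreal ((diff_quot (u j) p)\<^sup>2) \<partial>lborel) \<le> ennreal (K\<^sup>2)" for j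
      unfolding nn_integral_diff_quot[OF u(1)] by (intro ennreal_leI power_mono u(2) N_nonneg u(1))
  qed
  then have vX: "v \<in> X" using v m by (auto simp: X_def intro: sq_integrableI)
  then have "(N v)\<^sup>2 \<le> K\<^sup>2" using le K by (simp add: nn_integral_diff_quot)
  then show ?thesis using vX K by (auto intro: power2_le_imp_le)
qed

lemma lsc_L2:
  assumes u: "\<And>j. u j \<in> X" "v \<in> X" "\<And>j. N (u j) \<le> K" and L: "(\<lambda>j. L (u j - v)) \<longlonglongrightarrow> 0"
  shows "N v \<le> K"
proof -
  have i: "integrable lborel (\<lambda>x. ((u j - v) x)\<^sup>2)" for j
    using X_sq[of "u j - v"] u by (simp add: sq_integrable_def)
  have "(\<lambda>j. \<integral>x. norm (((u j - v) x)\<^sup>2) \<partial>lborel) = (\<lambda>j. (L (u j - v))\<^sup>2)"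
    by (simp add: L_sq)
  also have "\<dots> \<longlonglongrightarrow> 0" using tendsto_power[OF L, of 2] by simp
  finally obtain r where r: "strict_mono r" "AE x in lborel. (\<lambda>j. ((u (r j) - v) x)\<^sup>2) \<longlonglongrightarrow> 0"
    using tendsto_L1_AE_subseq[of lborel "\<lambda>j x. ((u j - v) x)\<^sup>2", OF i] by blast
  have "AE x in lborel. (\<lambda>j. u (r j) x) \<longlonglongrightarrow> v x"
    using r(2)
  proof eventually_elim
    fix x assume "(\<lambda>j. ((u (r j) - v) x)\<^sup>2) \<longlonglongrightarrow> 0"
    from tendsto_real_sqrt[OF this] have "(\<lambda>j. \<bar>u (r j) x - v x\<bar>) \<longlonglongrightarrow> 0" by simp
    then show "(\<lambda>j. u (r j) x) \<longlonglongrightarrow> v x" by (simp add: tendsto_rabs_zero_iff LIM_zero_iff)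
  qed
  then show ?thesis
    using X_limit[of "\<lambda>j. u (r j)" K v] u X_D[OF u(2)] by blast
qed

lemma cell_index_surj: "\<exists>x. cell_index k x = z"
proof
  show "cell_index k (\<chi> i. of_int (z i) / 2 ^ k) = z" by (simp add: cell_index_def)
qed

text \<open>At a fixed scale a function in \<open>X\<close> is described by finitely many averages;
  this is the finite dimensional core of the compactness proof.\<close>

lemma finite_cell_index: "finite (cell_index k ` \<Omega>)"
proof -
  obtain r where r: "\<And>x. x \<in> \<Omega> \<Longrightarrow> norm x \<le> r" using bounded_\<Omega> by (auto simp: bounded_iff)
  define m where "m = \<lceil>2 ^ k * r\<rceil> + 1"
  have "cell_index k x i \<in> {-m..m}" if x: "x \<in> \<Omega>" for x i
  proof -
    have "\<bar>x $ i\<bar> \<le> r" using component_le_norm_cart[of x i] r[OF x] by linarith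
    then have "\<bar>2 ^ k * x $ i\<bar> \<le> 2 ^ k * r" by (simp add: abs_mult)
    then show ?thesis unfolding m_def cell_index_def by simp linarith
  qed
  then have "cell_index k ` \<Omega> \<subseteq> PiE UNIV (\<lambda>_. {-m..m})" by (auto simp: PiE_UNIV_domain)
  then show ?thesis by (rule finite_subset) (intro finite_PiE; simp)
qed

definition m\<Omega> :: real where "m\<Omega> = measure lborel \<Omega>"

lemma emeasure_\<Omega>: "emeasure lborel \<Omega> = ennreal m\<Omega>" and m\<Omega>_nonneg: "0 \<le> m\<Omega>"
  using emeasure_bounded_finite[OF bounded_\<Omega>] by (auto simp: m\<Omega>_def emeasure_eq_ennreal_measure)

text \<open>The square of d is split into the error of averaging, small for large k on bounded sets,
  and the square of the average, small once the averages on \<Omega> are.\<close>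

lemma averages_control:
  assumes d: "d \<in> X" "N d \<le> 2 * K" and \<eta>: "\<And>x. x \<in> \<Omega> \<Longrightarrow> \<bar>avg k d x\<bar> \<le> \<eta>"
  shows "(L d)\<^sup>2 \<le> 2 * (cell_const * cell_decay ^ k) * (2 * K)\<^sup>2 + 2 * \<eta>\<^sup>2 * m\<Omega>"
proof -
  have [measurable]: "d \<in> borel_measurable borel" using d by (intro X_measurable)
  have pw: "ennreal ((d x)\<^sup>2) \<le> ennreal (2 * (cell_const * cell_decay ^ k)) * energy_density d x + ennreal (2 * \<eta>\<^sup>2) * indicator \<Omega> x" for x
  proof (cases "x \<in> \<Omega>")
    case True
    have "(d x)\<^sup>2 \<le> 2 * (d x - avg k d x)\<^sup>2 + 2 * (avg k d x)\<^sup>2"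
      using zero_le_power2[of "d x - 2 * avg k d x"] by (simp add: power2_eq_square algebra_simps)
    also have "\<dots> \<le> 2 * (d x - avg k d x)\<^sup>2 + 2 * \<eta>\<^sup>2"
      using \<eta>[OF True] by (simp add: abs_le_square_iff[symmetric])
    finally have "ennreal ((d x)\<^sup>2) \<le> ennreal (2 * (d x - avg k d x)\<^sup>2 + 2 * \<eta>\<^sup>2)"
      by (rule ennreal_leI)
    also have "\<dots> = ennreal (2 * (d x - avg k d x)\<^sup>2) + ennreal (2 * \<eta>\<^sup>2)"
      by (rule ennreal_plus) auto
    also have "ennreal (2 * (d x - avg k d x)\<^sup>2) = ennreal 2 * ennreal ((d x - avg k d x)\<^sup>2)"
      by (rule ennreal_mult) auto
    also have "ennreal 2 * ennreal ((d x - avg k d x)\<^sup>2) + ennreal (2 * \<eta>\<^sup>2) \<le> ennreal 2 * (ennreal (cell_const * cell_decay ^ k) * energy_density d x) + ennreal (2 * \<eta>\<^sup>2)"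
      by (rule add_right_mono, rule mult_left_mono[OF avg_approx[OF d(1)]]) simp
    also have "\<dots> = ennreal (2 * (cell_const * cell_decay ^ k)) * energy_density d x + ennreal (2 * \<eta>\<^sup>2)"
      using cell_const cell_decay by (subst ennreal_mult) (auto simp: mult.assoc less_imp_le)
    finally show ?thesis using True by simp
  qed (simp add: X_outside[OF d(1)])
  have "ennreal ((L d)\<^sup>2) \<le> (\<integral>\<^sup>+x. ennreal (2 * (cell_const * cell_decay ^ k)) * energy_density d x + ennreal (2 * \<eta>\<^sup>2) * indicator \<Omega> x \<partial>lborel)"
    unfolding nn_integral_L[OF d(1), symmetric] by (intro nn_integral_mono pw)
  also have "\<dots> = ennreal (2 * (cell_const * cell_decay ^ k)) * ennreal ((N d)\<^sup>2) + ennreal (2 * \<eta>\<^sup>2) * ennreal m\<Omega>"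
    by (simp add: nn_integral_add nn_integral_cmult nn_integral_energy_density[OF d(1)] nn_integral_cmult_indicator emeasure_\<Omega>)
  also have "\<dots> = ennreal (2 * (cell_const * cell_decay ^ k) * (N d)\<^sup>2 + 2 * \<eta>\<^sup>2 * m\<Omega>)"
    using cell_const cell_decay m\<Omega>_nonneg by (simp add: ennreal_mult less_imp_le)
  finally have "(L d)\<^sup>2 \<le> 2 * (cell_const * cell_decay ^ k) * (N d)\<^sup>2 + 2 * \<eta>\<^sup>2 * m\<Omega>"
    using cell_const cell_decay m\<Omega>_nonneg by (subst (asm) ennreal_le_iff) (auto simp: less_imp_le)
  also have "\<dots> \<le> 2 * (cell_const * cell_decay ^ k) * (2 * K)\<^sup>2 + 2 * \<eta>\<^sup>2 * m\<Omega>"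
    using cell_const cell_decay d by (intro add_right_mono mult_left_mono power_mono) (auto simp: less_imp_le)
  finally show ?thesis .
qed

lemma L2_Cauchy_subsequence:
  assumes u: "\<And>j. u j \<in> X" "\<And>j. N (u j) \<le> K"
  shows "\<exists>r. strict_mono (r :: nat \<Rightarrow> nat) \<and> (\<forall>\<epsilon>>0. \<exists>m. \<forall>i\<ge>m. \<forall>j\<ge>m. L (u (r i) - u (r j)) \<le> \<epsilon>)"
proof -
  have K: "0 \<le> K" using order_trans[OF N_nonneg[OF u(1)] u(2)] .
  \<comment> \<open>Dividing by the growth factor gives one bound for all scales, so a single
    diagonal argument over the countable set of cells makes all averages converge.\<close>
  define a where "a j kz = (case kz of (k, z) \<Rightarrow> cell_average k z (u j) / cell_growth ^ k)" for j and kz :: "nat \<times> ('n \<Rightarrow> int)"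
  have a: "norm (a j kz) \<le> avg_bound * K" for j kz
  proof -
    obtain k z where kz: "kz = (k, z)" by fastforce
    obtain x where "cell_index k x = z" using cell_index_surj by blast
    then have "\<bar>cell_average k z (u j)\<bar> \<le> avg_bound * cell_growth ^ k * N (u j)" using avg_le[OF u(1), of k x j] by simp
    also have "\<dots> \<le> avg_bound * cell_growth ^ k * K" using u avg_bound_pos cell_growth by (intro mult_left_mono) auto
    finally show ?thesis using cell_growth by (simp add: a_def kz field_simps)
  qed
  obtain r where r: "strict_mono (r :: nat \<Rightarrow> nat)" "\<And>kz. \<exists>l. (\<lambda>j. a (r j) kz) \<longlonglongrightarrow> l"
    using function_convergent_subsequence[of UNIV a "avg_bound * K"] a by auto
  have conv: "Cauchy (\<lambda>j. cell_average k z (u (r j)))" for k z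
  proof -
    obtain l where "(\<lambda>j. a (r j) (k, z)) \<longlonglongrightarrow> l" using r(2)[of "(k, z)"] by auto
    from tendsto_mult_right[OF this, of "cell_growth ^ k"] have "(\<lambda>j. cell_average k z (u (r j))) \<longlonglongrightarrow> l * cell_growth ^ k"
      using cell_growth by (simp add: a_def)
    then show ?thesis by (intro convergent_Cauchy convergentI)
  qed
  have "\<exists>m. \<forall>i\<ge>m. \<forall>j\<ge>m. L (u (r i) - u (r j)) \<le> \<epsilon>" if e: "\<epsilon> > 0" for \<epsilon>
  proof -
    have lim: "(\<lambda>k. 2 * (cell_const * cell_decay ^ k) * (2 * K)\<^sup>2) \<longlonglongrightarrow> 2 * (cell_const * 0) * (2 * K)\<^sup>2"
      using cell_decay by (intro tendsto_intros LIMSEQ_power_zero) auto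
    have "\<forall>\<^sub>F k in sequentially. 2 * (cell_const * cell_decay ^ k) * (2 * K)\<^sup>2 < \<epsilon>\<^sup>2 / 2"
      by (rule order_tendstoD(2)[OF lim]) (use e in simp)
    from eventually_happens'[OF sequentially_bot this]
    obtain k where k: "2 * (cell_const * cell_decay ^ k) * (2 * K)\<^sup>2 < \<epsilon>\<^sup>2 / 2" by blast
    \<comment> \<open>Chosen so that the contribution of the averages is at most half of the square
      of \<epsilon>; the added 1 covers measure zero.\<close>
    define \<eta> where "\<eta> = \<epsilon> / (2 * sqrt (m\<Omega> + 1))"
    have m1: "m\<Omega> + 1 > 0" using m\<Omega>_nonneg by linarith
    have \<eta>: "\<eta> > 0" using e m1 by (simp add: \<eta>_def)
    have "2 * \<eta>\<^sup>2 * m\<Omega> = \<epsilon>\<^sup>2 / 2 * (m\<Omega> / (m\<Omega> + 1))"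
      using m1 by (simp add: \<eta>_def power_divide power_mult_distrib field_simps)
    also have "\<dots> \<le> \<epsilon>\<^sup>2 / 2 * 1" using m\<Omega>_nonneg by (intro mult_left_mono) (auto simp: divide_simps)
    finally have \<eta>2: "2 * \<eta>\<^sup>2 * m\<Omega> \<le> \<epsilon>\<^sup>2 / 2" by simp
    have "\<forall>z\<in>cell_index k ` \<Omega>. \<exists>m. \<forall>i\<ge>m. \<forall>j\<ge>m. \<bar>cell_average k z (u (r i)) - cell_average k z (u (r j))\<bar> < \<eta>"
      using conv \<eta> by (auto simp: Cauchy_def dist_real_def)
    then obtain mm where mm: "\<And>z i j. z \<in> cell_index k ` \<Omega> \<Longrightarrow> i \<ge> mm z \<Longrightarrow> j \<ge> mm z \<Longrightarrow>
        \<bar>cell_average k z (u (r i)) - cell_average k z (u (r j))\<bar> < \<eta>" by metis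
    \<comment> \<open>The inserted 0 keeps the set nonempty for \<open>Max\<close>.\<close>
    define m where "m = Max (insert 0 (mm ` cell_index k ` \<Omega>))"
    have m: "mm z \<le> m" if "z \<in> cell_index k ` \<Omega>" for z
      unfolding m_def using that finite_cell_index[of k] by (intro Max_ge) auto
    have "L (u (r i) - u (r j)) \<le> \<epsilon>" if ij: "i \<ge> m" "j \<ge> m" for i j
    proof (rule power2_le_imp_le)
      have "(L (u (r i) - u (r j)))\<^sup>2 \<le> 2 * (cell_const * cell_decay ^ k) * (2 * K)\<^sup>2 + 2 * \<eta>\<^sup>2 * m\<Omega>"
      proof (rule averages_control)
        show "N (u (r i) - u (r j)) \<le> 2 * K"
          using N_triangle_diff[OF u(1) u(1), of "r i" "r j"] u(2)[of "r i"] u(2)[of "r j"] by linarith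
        show "\<bar>avg k (u (r i) - u (r j)) x\<bar> \<le> \<eta>" if x: "x \<in> \<Omega>" for x
        proof -
          have z: "cell_index k x \<in> cell_index k ` \<Omega>" using x by blast
          have "mm (cell_index k x) \<le> i" "mm (cell_index k x) \<le> j" using m[OF z] ij by auto
          from mm[OF z this] show ?thesis by (simp add: cell_average_diff u)
        qed
      qed (use u in simp)
      then show "(L (u (r i) - u (r j)))\<^sup>2 \<le> \<epsilon>\<^sup>2" using k \<eta>2 by linarith
    qed (use e in simp)
    then show ?thesis by blast
  qed
  then show ?thesis using r(1) by blast
qed

text \<open>The Riesz-Fischer argument, carried out so that the limit is a Borel function that
  vanishes everywhere outside \<Omega> and has finite energy, hence lies in
  \<open>X\<close>.\<close>

lemma L2_limit:
  assumes w: "\<And>j. w j \<in> X" "\<And>j. N (w j) \<le> K"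
    and cauchy: "\<And>\<epsilon>. \<epsilon> > 0 \<Longrightarrow> \<exists>m. \<forall>i\<ge>m. \<forall>j\<ge>m. L (w i - w j) \<le> \<epsilon>"
  shows "\<exists>t v. strict_mono (t :: nat \<Rightarrow> nat) \<and> v \<in> X \<and> (\<lambda>j. L (w (t j) - v)) \<longlonglongrightarrow> 0"
proof -
  have "\<exists>T. \<forall>i\<ge>T. \<forall>j\<ge>T. L (w i - w j) \<le> (1/2) ^ m" for m using cauchy[of "(1/2) ^ m"] by simp
  then obtain T where T: "\<And>m i j. i \<ge> T m \<Longrightarrow> j \<ge> T m \<Longrightarrow> L (w i - w j) \<le> (1/2) ^ m" by metis
  \<comment> \<open>The sum dominates \<open>T m\<close> and is nondecreasing; adding m makes the
    sequence strictly increasing.\<close>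
  define t where "t m = (\<Sum>l\<le>m. T l) + m" for m
  have t_ge: "T m \<le> t m" for m
    unfolding t_def by (simp add: member_le_sum trans_le_add1)
  have t_mono: "strict_mono t" by (intro strict_monoI_Suc) (simp add: t_def)
  define y where "y m = w (t m)" for m
  have y: "y m \<in> X" "N (y m) \<le> K" for m using w by (auto simp: y_def)
  have [measurable]: "y m \<in> borel_measurable borel" for m using y by (intro X_measurable)
  have yL: "L (y i - y j) \<le> (1/2) ^ m" if "i \<ge> m" "j \<ge> m" for i j m
  proof -
    have "t m \<le> t i" "t m \<le> t j" using that t_mono by (auto simp: strict_mono_less_eq)
    then show ?thesis unfolding y_def using t_ge[of m] by (intro T) auto
  qed
  define g where "g m x = \<bar>y (Suc m) x - y m x\<bar>" for m x
  \<comment> \<open>Cauchy-Schwarz against the indicator of the bounded set \<Omega> turns the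
    geometric L2 bound into a summable L1 bound.\<close>
  have g_le: "(\<integral>\<^sup>+x. ennreal (g m x) \<partial>lborel) \<le> ennreal (sqrt m\<Omega> * (1/2) ^ m)" for m
  proof -
    have d: "y (Suc m) - y m \<in> X" using y by simp
    have g_sq: "g m \<in> sq_integrable lborel"
    proof -
      have "g m \<in> borel_measurable lborel" unfolding g_def by measurable
      then show ?thesis using X_sq[OF d] by (simp add: sq_integrable_def) (simp add: g_def)
    qed
    have ind: "indicator \<Omega> \<in> sq_integrable lborel"
      by (intro sq_integrable_indicator) (simp_all add: emeasure_\<Omega>)
    have eq: "indicator \<Omega> x * g m x = g m x" for x
      using X_outside[OF y(1), of x] by (auto simp: g_def split: split_indicator)
    have int: "integrable lborel (g m)" using sq_integrable_mult[OF ind g_sq] by (simp add: eq)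
    have "(\<integral>x. g m x \<partial>lborel)\<^sup>2 \<le> (\<integral>x. (indicator \<Omega> x)\<^sup>2 \<partial>lborel) * (\<integral>x. (g m x)\<^sup>2 \<partial>lborel)"
      using integral_Cauchy_Schwarz[OF ind g_sq] by (simp only: eq)
    also have "(\<integral>x. (indicator \<Omega> x)\<^sup>2 \<partial>lborel) = m\<Omega>"
    proof -
      have "(\<lambda>x. (indicator \<Omega> x :: real)\<^sup>2) = indicator \<Omega>" by (auto split: split_indicator)
      then show ?thesis by (simp add: m\<Omega>_def)
    qed
    also have "(\<integral>x. (g m x)\<^sup>2 \<partial>lborel) = (L (y (Suc m) - y m))\<^sup>2" by (simp add: L_sq g_def)
    also have "m\<Omega> * (L (y (Suc m) - y m))\<^sup>2 \<le> m\<Omega> * ((1/2) ^ m)\<^sup>2"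
      using m\<Omega>_nonneg by (intro mult_left_mono power_mono yL) auto
    also have "\<dots> = (sqrt m\<Omega> * (1/2) ^ m)\<^sup>2" using m\<Omega>_nonneg by (simp add: power_mult_distrib)
    finally have "(\<integral>x. g m x \<partial>lborel) \<le> sqrt m\<Omega> * (1/2) ^ m"
      by (rule power2_le_imp_le) (use m\<Omega>_nonneg in simp)
    moreover have "(\<integral>\<^sup>+x. ennreal (g m x) \<partial>lborel) = ennreal (\<integral>x. g m x \<partial>lborel)"
      by (rule nn_integral_eq_integral[OF int]) (simp add: g_def)
    ultimately show ?thesis by (simp only: ennreal_leI)
  qed
  have sumg: "AE x in lborel. summable (\<lambda>m. g m x)"
  proof (rule summable_AE_of_L1[OF _ _ g_le])
    show "g m \<in> borel_measurable lborel" for m unfolding g_def by measurable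
    show "summable (\<lambda>m. sqrt m\<Omega> * (1/2) ^ m)" by (intro summable_mult summable_geometric) simp
  qed (auto simp: g_def m\<Omega>_nonneg)
  \<comment> \<open>Where the sequence diverges \<open>lim\<close> has an unspecified value, but
    this happens only on a null set, and outside \<Omega> the sequence is constantly 0.\<close>
  define v where "v x = lim (\<lambda>m. y m x)" for x
  have lim: "AE x in lborel. (\<lambda>m. y m x) \<longlonglongrightarrow> v x"
    using sumg
  proof eventually_elim
    fix x assume "summable (\<lambda>m. g m x)"
    then have "summable (\<lambda>m. y (Suc m) x - y m x)" unfolding g_def by (rule summable_rabs_cancel)
    then have "convergent (\<lambda>m. \<Sum>l<m. y (Suc l) x - y l x)" by (simp add: summable_iff_convergent)
    then have "convergent (\<lambda>m. y m x - y 0 x)" by (simp only: sum_lessThan_telescope[of "\<lambda>m. y m x"])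
    then have "convergent (\<lambda>m. (y m x - y 0 x) + y 0 x)" by (intro convergent_add convergent_const)
    then show "(\<lambda>m. y m x) \<longlonglongrightarrow> v x" by (simp add: v_def convergent_LIMSEQ_iff)
  qed
  have v_meas: "v \<in> borel_measurable borel" unfolding v_def by measurable
  have v_out: "v x = 0" if "x \<notin> \<Omega>" for x
    using X_outside[OF y(1) that] by (simp add: v_def)
  have near: "(\<integral>\<^sup>+x. ennreal ((y m x - v x)\<^sup>2) \<partial>lborel) \<le> ennreal (((1/2) ^ m)\<^sup>2)" for m
  proof (rule Fatou_sq[where f = "\<lambda>l x. y m x - y l x" and start = m])
    show "(\<integral>\<^sup>+x. ennreal ((y m x - y l x)\<^sup>2) \<partial>lborel) \<le> ennreal (((1/2) ^ m)\<^sup>2)" if "m \<le> l" for l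
      using nn_integral_L[of "y m - y l"] y yL[of m m l] that
      by (simp add: ennreal_leI power_mono del: power_divide)
    show "AE x in lborel. (\<lambda>l. y m x - y l x) \<longlonglongrightarrow> y m x - v x"
      using lim by eventually_elim (intro tendsto_intros)
  qed (use v_meas in measurable)
  have diff_sq: "(\<lambda>x. y m x - v x) \<in> sq_integrable lborel" for m
    using v_meas near[of m] by (intro sq_integrableI) auto
  have "v \<in> sq_integrable lborel"
    using sq_integrable_diff[OF X_sq[OF y(1)[of 0]] diff_sq[of 0]] by simp
  then have vX: "v \<in> X" using X_limit[OF y v_meas v_out _ lim] by blast
  have "L (y m - v) \<le> (1/2) ^ m" for m
  proof (rule power2_le_imp_le)
    show "(L (y m - v))\<^sup>2 \<le> ((1/2) ^ m)\<^sup>2"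
      using near[of m] nn_integral_L[of "y m - v"] y vX by (simp del: power_divide)
  qed simp
  then have "(\<lambda>m. L (y m - v)) \<longlonglongrightarrow> 0"
    by (intro Lim_null_comparison[OF _ LIMSEQ_power_zero[of "1/2 :: real"]]) (auto simp del: power_divide)
  then show ?thesis using t_mono vX unfolding y_def by blast
qed

sublocale compact_embedding X B L
proof
  fix u :: "nat \<Rightarrow> real ^ 'n \<Rightarrow> real" and K
  assume u: "\<And>j. u j \<in> X" "\<And>j. N (u j) \<le> K"
  obtain r where r: "strict_mono (r :: nat \<Rightarrow> nat)"
    "\<And>\<epsilon>. \<epsilon> > 0 \<Longrightarrow> \<exists>m. \<forall>i\<ge>m. \<forall>j\<ge>m. L (u (r i) - u (r j)) \<le> \<epsilon>"
    using L2_Cauchy_subsequence[of u K] u by blast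
  obtain t v where t: "strict_mono (t :: nat \<Rightarrow> nat)" "v \<in> X" "(\<lambda>j. L (u (r (t j)) - v)) \<longlonglongrightarrow> 0"
    using L2_limit[of "\<lambda>j. u (r j)" K] u r(2) by blast
  then show "\<exists>r v. strict_mono (r :: nat \<Rightarrow> nat) \<and> v \<in> X \<and> (\<lambda>j. L (u (r j) - v)) \<longlonglongrightarrow> 0"
    using strict_mono_o[OF r(1) t(1)] by (intro exI[of _ "r \<circ> t"] exI[of _ v]) (simp add: o_def)
next
  fix u :: "nat \<Rightarrow> real ^ 'n \<Rightarrow> real" and v K
  assume "\<And>j. u j \<in> X" "v \<in> X" "\<And>j. N (u j) \<le> K" "(\<lambda>j. L (u j - v)) \<longlonglongrightarrow> 0"
  then show "N v \<le> K" by (rule lsc_L2)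
qed (rule L_scale)

end

section \<open>Test functions and the first eigenvalue\<close>

context gagliardo_space
begin

section \<open>A test function of finite energy\<close>

lemma L_zero_iff_AE:
  assumes "u \<in> X"
  shows "L u = 0 \<longleftrightarrow> (AE x in lborel. u x = 0)"
proof
  assume "L u = 0"
  then have "(\<integral>x. (u x)\<^sup>2 \<partial>lborel) = 0" by (simp flip: L_sq)
  then show "AE x in lborel. u x = 0"
    using X_sq[OF assms] integral_nonneg_eq_0_iff_AE[of lborel "\<lambda>x. (u x)\<^sup>2"] by (simp add: sq_integrable_def)
next
  assume "AE x in lborel. u x = 0"
  then have "AE x in lborel. (u x)\<^sup>2 = 0" by eventually_elim simp
  then have "(\<integral>x. (u x)\<^sup>2 \<partial>lborel) = 0" by (rule integral_eq_zero_AE)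
  then show "L u = 0" by (simp add: L_def)
qed

text \<open>Bounds the squared difference quotient, at displacement z, of a function with Lipschitz
  constant 1 and values in the unit interval.\<close>

definition truncated_kernel :: "real ^ 'n \<Rightarrow> real" where
  "truncated_kernel z = min ((norm z)\<^sup>2) 1 / norm z powr (real CARD('n) + 2 * s)"

lemma truncated_kernel_measurable [measurable]: "truncated_kernel \<in> borel_measurable borel"
  unfolding truncated_kernel_def by measurable

text \<open>Dyadic annuli: inner ones use \<open>s < 1\<close>, outer ones \<open>s > 0\<close>.\<close>

lemma truncated_kernel_integrable: "(\<integral>\<^sup>+z. ennreal (truncated_kernel z) \<partial>lborel) < \<infinity>"
proof -
  define n where "n = real CARD('n)"
  define V where "V = unit_ball_vol n"
  have n: "n > 0" by (simp add: n_def)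
  have V: "V \<ge> 0" using n by (simp add: V_def)
  \<comment> \<open>\<open>c j\<close> bounds the kernel for norms between \<open>2^-(j+1)\<close>
    and \<open>2^-j\<close>, and \<open>d j\<close> for norms between \<open>2^j\<close> and
    \<open>2^(j+1)\<close>; enlarging annuli to balls only changes constants.\<close>
  define c where "c j = ((1/2) ^ j)\<^sup>2 / ((1/2) ^ Suc j) powr (n + 2 * s)" for j :: nat
  define d where "d j = 1 / (2 ^ j) powr (n + 2 * s)" for j :: nat
  have c0: "0 \<le> c j" and d0: "0 \<le> d j" for j by (simp_all add: c_def d_def)
  have term_le: "g j \<le> (\<Sum>j. g j)" for g :: "nat \<Rightarrow> ennreal" and j
    using sum_le_suminf[of g "{j}"] by simp
  have pw: "ennreal (truncated_kernel z) \<le> (\<Sum>j. ennreal (c j) * indicator (cball 0 ((1/2) ^ j)) z)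
      + (\<Sum>j. ennreal (d j) * indicator (cball 0 (2 ^ Suc j)) z)" for z
  proof (cases "z = 0")
    case True
    then show ?thesis by (simp add: truncated_kernel_def)
  next
    case z: False
    show ?thesis
    proof (cases "norm z \<le> 1")
      case True
      have "\<exists>j. (1/2) ^ j < norm z" using real_arch_pow_inv[of "norm z" "1/2"] z by auto
      moreover have "\<not> (1/2) ^ 0 < norm z" using True by simp
      ultimately obtain j where j: "\<not> (1/2) ^ j < norm z" "(1/2) ^ Suc j < norm z"
        using exists_least_lemma[of "\<lambda>j. (1/2) ^ j < norm z"] by blast
      have "truncated_kernel z \<le> c j"
        unfolding truncated_kernel_def c_def n_def[symmetric]
      proof (rule frac_le)
        show "min ((norm z)\<^sup>2) 1 \<le> ((1/2) ^ j)\<^sup>2"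
          using j(1) by (intro min.coboundedI1 power_mono) auto
        show "((1/2) ^ Suc j) powr (n + 2 * s) \<le> norm z powr (n + 2 * s)"
          using j(2) n s by (intro powr_mono2) auto
      qed simp_all
      then have "ennreal (truncated_kernel z) \<le> ennreal (c j) * indicator (cball 0 ((1/2) ^ j)) z"
        using j(1) by (simp add: ennreal_leI)
      also have "\<dots> \<le> (\<Sum>j. ennreal (c j) * indicator (cball 0 ((1/2) ^ j)) z)"
        by (rule term_le)
      finally show ?thesis by (simp add: add_increasing2)
    next
      case False
      obtain k where "norm z < 2 ^ k" using real_arch_pow[of 2 "norm z"] by auto
      then have "\<exists>k. norm z \<le> 2 ^ k" using less_imp_le by blast
      moreover have "\<not> norm z \<le> 2 ^ 0" using False by simp
      ultimately obtain j where j: "\<not> norm z \<le> 2 ^ j" "norm z \<le> 2 ^ Suc j"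
        using exists_least_lemma[of "\<lambda>j. norm z \<le> 2 ^ j"] by blast
      have "truncated_kernel z \<le> d j"
        unfolding truncated_kernel_def d_def n_def[symmetric]
      proof (rule frac_le)
        show "(2 ^ j) powr (n + 2 * s) \<le> norm z powr (n + 2 * s)"
          using j(1) n s by (intro powr_mono2) auto
      qed simp_all
      then have "ennreal (truncated_kernel z) \<le> ennreal (d j) * indicator (cball 0 (2 ^ Suc j)) z"
        using j(2) by (simp add: ennreal_leI)
      also have "\<dots> \<le> (\<Sum>j. ennreal (d j) * indicator (cball 0 (2 ^ Suc j)) z)"
        by (rule term_le)
      finally show ?thesis by (simp add: add_increasing)
    qed
  qed
  have ball: "emeasure lborel (cball (0 :: real ^ 'n) r) = ennreal (V * r powr n)" if "r > 0" for r
    using emeasure_cball[of r "0 :: real ^ 'n"] that by (simp add: V_def n_def powr_realpow)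
  have c_eq: "c j * (V * ((1/2) ^ j) powr n) = V * 2 powr (n + 2 * s) * ((1/2) powr (2 - 2 * s)) ^ j" for j
  proof -
    define a :: real where "a = (1/2) ^ j"
    have a: "a > 0" by (simp add: a_def)
    have "a\<^sup>2 = a powr 2" using a by (simp add: powr_numeral)
    moreover have "(a / 2) powr (n + 2 * s) = a powr (n + 2 * s) / 2 powr (n + 2 * s)"
      using a by (simp add: powr_divide)
    ultimately have "a\<^sup>2 / (a / 2) powr (n + 2 * s) * (V * a powr n)
        = V * 2 powr (n + 2 * s) * (a powr 2 * a powr n / a powr (n + 2 * s))" by simp
    also have "a powr 2 * a powr n / a powr (n + 2 * s) = a powr (2 - 2 * s)"
      by (simp flip: powr_add powr_diff)
    also have "a powr (2 - 2 * s) = ((1/2) powr (2 - 2 * s)) ^ j"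
      by (simp add: a_def powr_power powr_realpow[symmetric] powr_powr mult.commute)
    finally show ?thesis by (simp add: c_def a_def)
  qed
  have d_eq: "d j * (V * (2 ^ Suc j) powr n) = V * 2 powr n * cell_decay ^ j" for j
  proof -
    define b :: real where "b = 2 ^ j"
    have b: "b > 0" by (simp add: b_def)
    have "1 / b powr (n + 2 * s) * (V * (2 * b) powr n) = V * 2 powr n * (b powr n / b powr (n + 2 * s))"
      using b by (simp add: powr_mult)
    also have "b powr n / b powr (n + 2 * s) = b powr (- 2 * s)"
      by (simp flip: powr_diff)
    also have "b powr (- 2 * s) = cell_decay ^ j"
      by (simp add: b_def cell_decay_def powr_power powr_realpow[symmetric] powr_powr mult.commute)
    finally show ?thesis by (simp add: d_def b_def)
  qed
  have "(\<integral>\<^sup>+z. ennreal (truncated_kernel z) \<partial>lborel) \<le> (\<integral>\<^sup>+z. (\<Sum>j. ennreal (c j) * indicator (cball 0 ((1/2) ^ j)) z)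
      + (\<Sum>j. ennreal (d j) * indicator (cball 0 (2 ^ Suc j)) z) \<partial>(lborel :: (real ^ 'n) measure))"
    by (intro nn_integral_mono pw)
  also have "\<dots> = (\<Sum>j. \<integral>\<^sup>+z. ennreal (c j) * indicator (cball 0 ((1/2) ^ j)) z \<partial>(lborel :: (real ^ 'n) measure))
      + (\<Sum>j. \<integral>\<^sup>+z. ennreal (d j) * indicator (cball 0 (2 ^ Suc j)) z \<partial>(lborel :: (real ^ 'n) measure))"
  proof -
    have m': "(\<lambda>z :: real ^ 'n. ennreal (a j) * indicator (cball 0 (b j)) z) \<in> borel_measurable lborel"
      for a b and j :: nat
      by (intro borel_measurable_times_ennreal borel_measurable_const borel_measurable_indicator) simp
    note m = borel_measurable_suminf_order[OF m'[where a = c and b = "\<lambda>j. (1/2) ^ j"]]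
      borel_measurable_suminf_order[OF m'[where a = d and b = "\<lambda>j. 2 ^ Suc j"]]
    show ?thesis
      unfolding nn_integral_add[OF m] by (intro arg_cong2[where f = "(+)"] nn_integral_suminf m')
  qed
  also have "\<dots> = (\<Sum>j. ennreal (V * 2 powr (n + 2 * s) * ((1/2) powr (2 - 2 * s)) ^ j)) + (\<Sum>j. ennreal (V * 2 powr n * cell_decay ^ j))"
  proof -
    have "(\<integral>\<^sup>+z. ennreal (c j) * indicator (cball 0 ((1/2) ^ j)) z \<partial>(lborel :: (real ^ 'n) measure))
        = ennreal (V * 2 powr (n + 2 * s) * ((1/2) powr (2 - 2 * s)) ^ j)" for j
      using c0[of j] V by (subst nn_integral_cmult_indicator) (simp_all add: ball flip: c_eq ennreal_mult)
    moreover have "(\<integral>\<^sup>+z. ennreal (d j) * indicator (cball 0 (2 ^ Suc j)) z \<partial>(lborel :: (real ^ 'n) measure))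
        = ennreal (V * 2 powr n * cell_decay ^ j)" for j
      using d0[of j] V by (subst nn_integral_cmult_indicator) (simp_all add: ball flip: d_eq ennreal_mult del: power_Suc)
    ultimately show ?thesis by simp
  qed
  also have "\<dots> < \<infinity>"
  proof -
    have q: "(1/2 :: real) powr (2 - 2 * s) < 1"
      using powr_mono2[of "2 - 2 * s" "1/2" 1] s powr_less_mono2[of "2 - 2 * s" "1/2" 1] by simp
    have "summable (\<lambda>j. V * 2 powr (n + 2 * s) * ((1/2) powr (2 - 2 * s)) ^ j)"
      using q by (intro summable_mult summable_geometric) simp
    moreover have "summable (\<lambda>j. V * 2 powr n * cell_decay ^ j)"
      using cell_decay by (intro summable_mult summable_geometric) simp
    moreover have "0 \<le> V * 2 powr (n + 2 * s) * ((1/2) powr (2 - 2 * s)) ^ j" "0 \<le> V * 2 powr n * cell_decay ^ j" for j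
      using V cell_decay(1) by (intro mult_nonneg_nonneg zero_le_power powr_ge_zero; simp)+
    ultimately have "(\<Sum>j. ennreal (V * 2 powr (n + 2 * s) * ((1/2) powr (2 - 2 * s)) ^ j)) \<noteq> top \<and>
        (\<Sum>j. ennreal (V * 2 powr n * cell_decay ^ j)) \<noteq> top"
      by (intro conjI ennreal_suminf_neq_top)
    then show ?thesis unfolding less_top by (simp only: infinity_ennreal_def ennreal_add_less_top)
  qed
  finally show ?thesis .
qed

lemma nn_integral_translate:
  fixes g :: "real ^ 'n \<Rightarrow> ennreal"
  assumes [measurable]: "g \<in> borel_measurable borel"
  shows "(\<integral>\<^sup>+y. g (y - c) \<partial>lborel) = (\<integral>\<^sup>+y. g y \<partial>lborel)"
proof -
  have "(\<integral>\<^sup>+y. g y \<partial>lborel) = (\<integral>\<^sup>+y. g y \<partial>distr lborel borel ((+) (- c)))"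
    by (simp add: lborel_distr_plus)
  also have "\<dots> = (\<integral>\<^sup>+y. g (y - c) \<partial>lborel)"
    by (subst nn_integral_distr) (auto simp: add.commute)
  finally show ?thesis by simp
qed

text \<open>A tent on a small ball. It shows that the quotients defining the first eigenvalue exist,
  and it is the direction of the ray; the height at most 1 serves both the kernel bound and the
  comparison of powers there.\<close>

lemma bump_exists:
  assumes "\<Omega> \<noteq> {}"
  shows "\<exists>w\<in>X. (\<forall>x. 0 \<le> w x \<and> w x \<le> 1) \<and> N w > 0 \<and> L w > 0"
proof -
  obtain x0 r where r: "r > 0" "ball x0 r \<subseteq> \<Omega>"
    using assms open_\<Omega> by (meson equals0I open_contains_ball)
  define \<rho> where "\<rho> = min r 1"
  have \<rho>: "\<rho> > 0" "\<rho> \<le> r" "\<rho> \<le> 1" using r by (auto simp: \<rho>_def)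
  define w where "w x = max 0 (\<rho> - norm (x - x0))" for x
  define U where "U = ball x0 \<rho>"
  have w01: "0 \<le> w x" "w x \<le> 1" for x
    using \<rho> norm_ge_zero[of "x - x0"] unfolding w_def by linarith+
  have w_U: "w x = 0" if "x \<notin> U" for x
    using that by (auto simp: w_def U_def dist_norm norm_minus_commute)
  have U_\<Omega>: "U \<subseteq> \<Omega>" using r \<rho> by (auto simp: U_def)
  have [measurable]: "w \<in> borel_measurable borel"
    unfolding w_def by (intro borel_measurable_continuous_onI continuous_intros)
  have [measurable]: "U \<in> sets borel" by (simp add: U_def)
  have fin: "emeasure lborel U < \<infinity>" unfolding U_def by (rule emeasure_bounded_finite) simp
  have lip: "(w x - w y)\<^sup>2 \<le> min ((norm (x - y))\<^sup>2) 1" for x y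
  proof -
    have "\<bar>w x - w y\<bar> \<le> norm (x - y)"
      using norm_triangle_ineq[of "x - y" "y - x0"] norm_triangle_ineq[of "y - x" "x - x0"]
      unfolding w_def by (simp add: norm_minus_commute)
    then have "\<bar>w x - w y\<bar>\<^sup>2 \<le> (norm (x - y))\<^sup>2" by (intro power_mono) auto
    moreover have "\<bar>w x - w y\<bar>\<^sup>2 \<le> 1\<^sup>2"
      using w01[of x] w01[of y] by (intro power_mono) auto
    ultimately show ?thesis by simp
  qed
  define I where "I = (\<integral>\<^sup>+z. ennreal (truncated_kernel z) \<partial>lborel)"
  have I: "I < \<infinity>" using truncated_kernel_integrable by (simp add: I_def)
  have kernel_sym: "truncated_kernel (x - y) = truncated_kernel (y - x)" for x y by (simp add: truncated_kernel_def norm_minus_commute)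
  \<comment> \<open>The quotient vanishes unless one of the two points lies in U. Integrating the
    kernel over the other point gives the finite number I, and U has finite measure.\<close>
  have pw: "ennreal ((diff_quot w (x, y))\<^sup>2) \<le> indicator U x * ennreal (truncated_kernel (y - x)) + indicator U y * ennreal (truncated_kernel (x - y))" for x y
  proof (cases "x \<in> U \<or> y \<in> U")
    case True
    have "(diff_quot w (x, y))\<^sup>2 \<le> truncated_kernel (x - y)"
      unfolding diff_quot_sq truncated_kernel_def using lip by (intro divide_right_mono) auto
    then have "ennreal ((diff_quot w (x, y))\<^sup>2) \<le> ennreal (truncated_kernel (x - y))" by (rule ennreal_leI)
    then show ?thesis
      using True kernel_sym[of x y] by (auto simp: add_increasing add_increasing2 split: split_indicator)
  next
    case False
    then show ?thesis using w_U by (simp add: diff_quot_def)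
  qed
  have hm: "(\<lambda>(x, y). indicator U y * ennreal (truncated_kernel (x - y))) \<in> borel_measurable (lborel \<Otimes>\<^sub>M lborel)"
    by measurable
  have "(\<integral>\<^sup>+p. ennreal ((diff_quot w p)\<^sup>2) \<partial>lborel) = (\<integral>\<^sup>+x. \<integral>\<^sup>+y. ennreal ((diff_quot w (x, y))\<^sup>2) \<partial>lborel \<partial>lborel)"
    by (rule nn_integral_lborel_pair) measurable
  also have "\<dots> \<le> (\<integral>\<^sup>+x. \<integral>\<^sup>+y. indicator U x * ennreal (truncated_kernel (y - x)) + indicator U y * ennreal (truncated_kernel (x - y)) \<partial>lborel \<partial>lborel)"
    by (intro nn_integral_mono pw)
  also have "\<dots> = (\<integral>\<^sup>+x. indicator U x * I + (\<integral>\<^sup>+y. indicator U y * ennreal (truncated_kernel (x - y)) \<partial>lborel) \<partial>lborel)"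
    using nn_integral_translate[of "\<lambda>z. ennreal (truncated_kernel z)"]
    by (intro nn_integral_cong) (simp add: nn_integral_add nn_integral_cmult I_def)
  also have "\<dots> = (\<integral>\<^sup>+x. indicator U x * I \<partial>lborel) + (\<integral>\<^sup>+x. \<integral>\<^sup>+y. indicator U y * ennreal (truncated_kernel (x - y)) \<partial>lborel \<partial>lborel)"
    by (intro nn_integral_add) measurable
  also have "(\<integral>\<^sup>+x. \<integral>\<^sup>+y. indicator U y * ennreal (truncated_kernel (x - y)) \<partial>lborel \<partial>lborel)
      = (\<integral>\<^sup>+y. \<integral>\<^sup>+x. indicator U y * ennreal (truncated_kernel (x - y)) \<partial>lborel \<partial>lborel)"
    using lborel_pair.Fubini'[OF hm] by simp
  also have "\<dots> = (\<integral>\<^sup>+y. indicator U y * I \<partial>lborel)"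
    using nn_integral_translate[of "\<lambda>z. ennreal (truncated_kernel z)"]
    by (intro nn_integral_cong) (simp add: nn_integral_cmult I_def)
  also have "(\<integral>\<^sup>+x. indicator U x * I \<partial>lborel) + (\<integral>\<^sup>+y. indicator U y * I \<partial>lborel) < \<infinity>"
    using fin I by (simp add: nn_integral_multc ennreal_mult_less_top)
  finally have fin_energy: "(\<integral>\<^sup>+p. ennreal ((diff_quot w p)\<^sup>2) \<partial>lborel) < \<infinity>" .
  have "diff_quot w \<in> sq_integrable lborel"
    using fin_energy diff_quot_measurable[of w] by (auto simp: sq_integrable_def intro!: integrableI_bounded)
  moreover have wsq: "w \<in> sq_integrable lborel"
  proof -
    have "(\<integral>\<^sup>+x. ennreal ((w x)\<^sup>2) \<partial>lborel) \<le> (\<integral>\<^sup>+x. indicator U x \<partial>lborel)"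
      using w01 w_U by (intro nn_integral_mono) (auto split: split_indicator simp: power_le_one)
    also have "\<dots> < \<infinity>" using fin by simp
    finally show ?thesis by (auto simp: sq_integrable_def intro!: integrableI_bounded)
  qed
  ultimately have wX: "w \<in> X" using w_U U_\<Omega> by (auto simp: X_def)
  have "L w \<noteq> 0"
  proof
    assume "L w = 0"
    then have "AE x in lborel. w x = 0" using L_zero_iff_AE[OF wX] by simp
    then have "AE x in lborel. x \<notin> U"
      by eventually_elim (auto simp: w_def U_def dist_norm norm_minus_commute)
    then have "U \<in> null_sets lborel" by (subst AE_iff_null_sets) auto
    then have "measure lborel U = 0" by (simp add: null_sets_def measure_def)
    then show False using content_ball_pos[OF \<rho>(1), of x0] by (simp add: U_def)
  qed
  then have Lw: "L w > 0" using L_nonneg[of w] by linarith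
  have "N w \<noteq> 0" using Poincare_const(2)[OF wX] Lw by auto
  then have "N w > 0" using N_nonneg[OF wX] by linarith
  then show ?thesis using wX w01 Lw by blast
qed

text \<open>The direct method: compactness preserves the constraint \<open>L v = 1\<close> in the
  limit, and lower semicontinuity bounds the energy. A minimiser is produced, not just an infimum,
  because \<open>lambda1\<close> is a \<open>LEAST\<close> over the reals.\<close>

lemma first_eigenvalue:
  assumes "\<Omega> \<noteq> {}"
  shows "\<exists>v\<in>X. L v = 1 \<and> (\<forall>u\<in>X. (N v)\<^sup>2 * (L u)\<^sup>2 \<le> (N u)\<^sup>2)"
proof -
  define S where "S = {(N u)\<^sup>2 | u. u \<in> X \<and> L u = 1}"
  define \<mu> where "\<mu> = Inf S"
  have norm: "(1 / L u) *\<^sub>R u \<in> X" "L ((1 / L u) *\<^sub>R u) = 1" "(N ((1 / L u) *\<^sub>R u))\<^sup>2 = (N u)\<^sup>2 / (L u)\<^sup>2"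
    if "u \<in> X" "L u > 0" for u
    using that by (auto simp: L_scale N_scale power_divide)
  have "S \<noteq> {}" using bump_exists[OF assms] norm unfolding S_def by blast
  have bdd: "bdd_below S" by (intro bdd_belowI[of _ 0]) (auto simp: S_def)
  have "\<exists>u\<in>X. L u = 1 \<and> (N u)\<^sup>2 < \<mu> + 1 / real (Suc j)" for j
    using cInf_lessD[OF \<open>S \<noteq> {}\<close>, of "\<mu> + 1 / real (Suc j)"] unfolding \<mu>_def[symmetric]
    by (auto simp: S_def simp del: of_nat_Suc)
  then obtain u where u: "\<And>j. u j \<in> X" "\<And>j. L (u j) = 1" "\<And>j. (N (u j))\<^sup>2 < \<mu> + 1 / real (Suc j)" by metis
  have bound: "N (u j) \<le> sqrt (\<mu> + 1 / real (Suc k))" if "k \<le> j" for j k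
  proof (rule real_le_rsqrt)
    have "1 / real (Suc j) \<le> 1 / real (Suc k)" using that by (intro divide_left_mono) auto
    then show "(N (u j))\<^sup>2 \<le> \<mu> + 1 / real (Suc k)" using u(3)[of j] by linarith
  qed
  obtain r v where r: "strict_mono (r :: nat \<Rightarrow> nat)" and v: "v \<in> X" and conv: "(\<lambda>j. L (u (r j) - v)) \<longlonglongrightarrow> 0"
    using compact[of u "sqrt (\<mu> + 1 / real (Suc 0))"] u(1) bound[of 0] by auto
  \<comment> \<open>The reverse triangle inequality for \<open>L\<close>, taken from the L2 instance
    of \<open>semi_inner\<close>.\<close>
  have "\<bar>1 - L v\<bar> \<le> L (u (r j) - v)" for j
  proof -
    interpret l2: semi_inner "sq_integrable lborel" "\<lambda>f g. \<integral>x. f x * g x \<partial>lborel" by (rule semi_inner_L2)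
    have "l2.N = L" by (simp add: fun_eq_iff l2.N_def L_def power2_eq_square)
    then show ?thesis using l2.N_diff_bound[of "u (r j)" v] X_sq[OF u(1)] X_sq[OF v] u(2)[of "r j"] by simp
  qed
  then have "\<bar>1 - L v\<bar> \<le> 0" using conv by (intro LIMSEQ_le_const[OF conv]) auto
  then have Lv: "L v = 1" by simp
  have "(N v)\<^sup>2 \<le> \<mu> + 1 / real (Suc k)" for k
  proof -
    have "N v \<le> sqrt (\<mu> + 1 / real (Suc k))"
    proof (rule lsc[of "\<lambda>j. u (r (j + k))"])
      show "N (u (r (j + k))) \<le> sqrt (\<mu> + 1 / real (Suc k))" for j
        using seq_suble[OF r, of "j + k"] by (intro bound) linarith
      show "(\<lambda>j. L (u (r (j + k)) - v)) \<longlonglongrightarrow> 0" by (rule LIMSEQ_ignore_initial_segment[OF conv])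
    qed (use u v in auto)
    then have "(N v)\<^sup>2 \<le> (sqrt (\<mu> + 1 / real (Suc k)))\<^sup>2" using v by (intro power_mono) auto
    moreover have "0 \<le> \<mu> + 1 / real (Suc k)"
      using u(3)[of k] zero_le_power2[of "N (u k)"] by linarith
    ultimately show ?thesis by simp
  qed
  then have Nv: "(N v)\<^sup>2 \<le> \<mu>"
    using LIMSEQ_le_const[of "\<lambda>k. \<mu> + 1 / real (Suc k)" \<mu> "(N v)\<^sup>2"]
      tendsto_add[OF tendsto_const[of \<mu>] LIMSEQ_inverse_real_of_nat] by (auto simp: inverse_eq_divide)
  have "(N v)\<^sup>2 * (L u)\<^sup>2 \<le> (N u)\<^sup>2" if u: "u \<in> X" for u
  proof (cases "L u = 0")
    case False
    then have Lu: "L u > 0" using L_nonneg[of u] by linarith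
    then have "\<mu> \<le> (N u)\<^sup>2 / (L u)\<^sup>2"
      unfolding \<mu>_def using norm[OF u] bdd by (intro cInf_lower) (auto simp: S_def, metis)
    then have "(N v)\<^sup>2 \<le> (N u)\<^sup>2 / (L u)\<^sup>2" using Nv by linarith
    then show ?thesis using Lu by (simp add: field_simps)
  qed simp
  then show ?thesis using v Lv by blast
qed

end

section \<open>Subcritical nonlinearities\<close>

lemma primitive_0 [simp]: "primitive g 0 = 0"
  by (simp add: primitive_def zero_ereal_def[symmetric])

lemma primitive_deriv:
  assumes "continuous_on UNIV g"
  shows "(primitive g has_real_derivative g t) (at t)"
proof -
  \<comment> \<open>A symmetric interval containing both 0 and t in its interior, so that the
    one-sided statement on it becomes a derivative at t.\<close>
  define b where "b = \<bar>t\<bar> + 1"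
  have "((\<lambda>u. LBINT y=0..u. g y) has_vector_derivative g t) (at t within {-b..b})"
    using interval_integral_FTC2[of "-b" 0 b g t] continuous_on_subset[OF assms]
    by (auto simp: b_def zero_ereal_def)
  moreover have "at t within {-b..b} = at t"
    by (rule at_within_interior) (auto simp: b_def)
  ultimately show ?thesis
    unfolding has_real_derivative_iff_has_vector_derivative primitive_def[abs_def] by simp
qed

lemma primitive_MVT:
  assumes "continuous_on UNIV g" "a \<le> b"
  shows "\<exists>x\<in>{a..b}. primitive g b - primitive g a = g x * (b - a)"
proof (cases "a = b")
  case False
  then obtain z where "a < z" "z < b" "primitive g b - primitive g a = (b - a) * g z"
    using MVT2[of a b "primitive g" g] primitive_deriv[OF assms(1)] assms(2) by force
  then show ?thesis by (intro bexI[of _ z]) auto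
qed auto

lemma primitive_MVT_abs:
  assumes "continuous_on UNIV g"
  shows "\<exists>x. \<bar>x - a\<bar> \<le> \<bar>h\<bar> \<and> \<bar>x\<bar> \<le> max \<bar>a\<bar> \<bar>a + h\<bar> \<and> 0 \<le> (x - a) * h \<and> primitive g (a + h) - primitive g a = g x * h"
proof (cases "0 \<le> h")
  case True
  then obtain x where "x \<in> {a..a + h}" "primitive g (a + h) - primitive g a = g x * h"
    using primitive_MVT[OF assms, of a "a + h"] by auto
  then show ?thesis using True by (intro exI[of _ x]) auto
next
  case False
  then obtain x where x: "x \<in> {a + h..a}" "primitive g a - primitive g (a + h) = g x * - h"
    using primitive_MVT[OF assms, of "a + h" a] by auto
  then show ?thesis using False
    by (intro exI[of _ x]) (auto simp: mult_nonpos_nonpos algebra_simps)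
qed

text \<open>With a fixed range of integration, the primitive evaluated at \<open>u x\<close> becomes
  a parameter integral, whose measurability in x is immediate.\<close>

lemma primitive_eq_integral:
  assumes g: "continuous_on UNIV g"
  shows "primitive g t = t * (\<integral>y. g (t * y) * indicator {0..1} y \<partial>lborel)"
proof -
  have "(\<integral>y. (g (t * y) * t) * indicator {0..1} y \<partial>lborel) = primitive g (t * 1) - primitive g (t * 0)"
  proof (rule integral_FTC_Icc_real)
    show "((\<lambda>y. primitive g (t * y)) has_real_derivative g (t * y) * t) (at y)" for y
    proof -
      have "((\<lambda>y. t * y) has_real_derivative t) (at y)" by (auto intro!: derivative_eq_intros)
      from DERIV_chain2[OF primitive_deriv[OF g] this] show ?thesis .
    qed
    show "isCont (\<lambda>y. g (t * y) * t) y" for y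
      using g by (intro continuous_intros continuous_on_interior[of UNIV] continuous_on_compose2[OF g]) auto
  qed simp
  then show ?thesis by (simp add: mult_ac)
qed

text \<open>A crude Young inequality: replace the smaller of x and y by the larger. Normalisation
  makes up for the lost constants later.\<close>

lemma powr_Young:
  fixes x y p :: real
  assumes "0 \<le> x" "0 \<le> y" "1 \<le> p"
  shows "x powr (p - 1) * y \<le> x powr p + y powr p"
proof -
  have eq: "z powr (p - 1) * z = z powr p" if "0 \<le> z" for z :: real
    using that by (cases "z = 0") (auto simp: powr_mult_base mult.commute)
  show ?thesis
  proof (cases "y \<le> x")
    case True
    then have "x powr (p - 1) * y \<le> x powr (p - 1) * x" by (intro mult_left_mono) auto
    then show ?thesis using eq[of x] assms powr_ge_zero[of y p] by linarith
  next
    case False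
    then have "x powr (p - 1) * y \<le> y powr (p - 1) * y"
      using assms by (intro mult_right_mono powr_mono2) auto
    then show ?thesis using eq[of y] assms powr_ge_zero[of x p] by linarith
  qed
qed

lemma powr_add_le:
  fixes x y r :: real
  assumes "0 \<le> x" "0 \<le> y" "0 \<le> r"
  shows "(x + y) powr r \<le> 2 powr r * (x powr r + y powr r)"
proof -
  have "(x + y) powr r \<le> (2 * max x y) powr r" using assms by (intro powr_mono2) auto
  also have "\<dots> = 2 powr r * max x y powr r" using assms by (simp add: powr_mult)
  also have "\<dots> \<le> 2 powr r * (x powr r + y powr r)"
    by (intro mult_left_mono) (auto simp: max_def)
  finally show ?thesis .
qed

section \<open>The integral functional of the nonlinearity\<close>

locale subcritical = gagliardo_space s \<Omega> for s and \<Omega> :: "(real ^ 'n) set" +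
  fixes f :: "real ^ 'n \<Rightarrow> real \<Rightarrow> real" and c q :: real
  assumes f_cont: "continuous_on (closure \<Omega> \<times> UNIV) (\<lambda>(x, t). f x t)"
    and c: "c > 0" and q: "2 < q" "q < 2 * real CARD('n) / (real CARD('n) - 2 * s)"
    and growth: "\<And>x t. x \<in> closure \<Omega> \<Longrightarrow> \<bar>f x t\<bar> \<le> c * (1 + \<bar>t\<bar> powr (q - 1))"
begin

text \<open>The midpoint between q and the critical exponent: large enough to dominate the growth of
  f with any small factor, and still admissible in \<open>Sobolev\<close>.\<close>

definition p :: real where "p = (q + 2 * real CARD('n) / (real CARD('n) - 2 * s)) / 2"

lemma p: "q < p" "2 < p" "p \<le> 2 * real CARD('n) / (real CARD('n) - 2 * s)" "0 \<le> p - 1"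
  using q by (auto simp: p_def)

lemma closure_\<Omega>: "x \<in> \<Omega> \<Longrightarrow> x \<in> closure \<Omega>"
  using closure_subset by blast

lemma f_continuous:
  assumes "x \<in> closure \<Omega>"
  shows "continuous_on UNIV (f x)"
proof -
  have "continuous_on UNIV (\<lambda>t :: real. (x, t))" by (intro continuous_intros)
  from continuous_on_compose2[OF f_cont this] assms show ?thesis by auto
qed

lemma compact_closure_\<Omega>: "compact (closure \<Omega>)"
  using bounded_\<Omega> by (simp add: compact_closure)

lemma f_unif:
  assumes "\<eta> > 0"
  shows "\<exists>\<delta>>0. \<forall>x\<in>closure \<Omega>. \<forall>y\<in>closure \<Omega>. \<forall>a\<in>{-T..T}. \<forall>b\<in>{-T..T}.
    dist (x, a) (y, b) < \<delta> \<longrightarrow> \<bar>f x a - f y b\<bar> < \<eta>"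
proof -
  have "uniformly_continuous_on (closure \<Omega> \<times> {-T..T}) (\<lambda>(x, t). f x t)"
    by (intro compact_uniformly_continuous continuous_on_subset[OF f_cont] compact_Times compact_closure_\<Omega>) auto
  then obtain \<delta> where \<delta>: "\<delta> > 0" "\<And>z w. z \<in> closure \<Omega> \<times> {-T..T} \<Longrightarrow> w \<in> closure \<Omega> \<times> {-T..T} \<Longrightarrow>
      dist w z < \<delta> \<Longrightarrow> dist (case w of (x, t) \<Rightarrow> f x t) (case z of (x, t) \<Rightarrow> f x t) < \<eta>"
    using assms unfolding uniformly_continuous_on_def by metis
  have "\<bar>f x a - f y b\<bar> < \<eta>" if "x \<in> closure \<Omega>" "y \<in> closure \<Omega>" "a \<in> {-T..T}" "b \<in> {-T..T}" "dist (x, a) (y, b) < \<delta>"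
    for x y a b
    using \<delta>(2)[of "(y, b)" "(x, a)"] that by (simp add: dist_real_def)
  then show ?thesis using \<delta>(1) by blast
qed

text \<open>Close arguments of moderate size are handled by uniform continuity, large ones by
  \<open>q < p\<close>; otherwise the arguments are at distance at least \<open>1\<close>.\<close>

lemma f_modulus:
  assumes \<eta>: "\<eta> > 0"
  shows "\<exists>C\<ge>0. \<forall>x\<in>closure \<Omega>. \<forall>a b. \<bar>f x a - f x b\<bar> \<le> \<eta> * (1 + \<bar>a\<bar> powr (p - 1) + \<bar>b\<bar> powr (p - 1)) + C * \<bar>a - b\<bar>"
proof -
  \<comment> \<open>Beyond this threshold \<open>2 * c\<close> times the power \<open>q - 1\<close>
    is at most \<eta> times the power \<open>p - 1\<close>; being at least 1 lets the power absorb
    the constant term of the growth bound.\<close>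
  define T where "T = max 1 ((2 * c / \<eta>) powr (1 / (p - q)))"
  have T: "T \<ge> 1" by (simp add: T_def)
  have large: "\<bar>f x a\<bar> \<le> \<eta> * \<bar>a\<bar> powr (p - 1)" if "x \<in> closure \<Omega>" "T \<le> \<bar>a\<bar>" for x a
  proof -
    have a1: "1 \<le> \<bar>a\<bar>" using that T by linarith
    have "2 * c / \<eta> = ((2 * c / \<eta>) powr (1 / (p - q))) powr (p - q)"
      using p c \<eta> by (simp add: powr_powr)
    also have "\<dots> \<le> \<bar>a\<bar> powr (p - q)"
      using that p by (intro powr_mono2) (auto simp: T_def)
    finally have 1: "2 * c \<le> \<eta> * \<bar>a\<bar> powr (p - q)" using \<eta> by (simp add: field_simps)
    have "1 \<le> \<bar>a\<bar> powr (q - 1)" using a1 q by (intro ge_one_powr_ge_zero) auto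
    then have "c * (1 + \<bar>a\<bar> powr (q - 1)) \<le> c * (2 * \<bar>a\<bar> powr (q - 1))" using c by (intro mult_left_mono) auto
    also have "\<dots> = 2 * c * \<bar>a\<bar> powr (q - 1)" by simp
    also have "\<dots> \<le> \<eta> * \<bar>a\<bar> powr (p - q) * \<bar>a\<bar> powr (q - 1)" using 1 by (intro mult_right_mono) auto
    also have "\<dots> = \<eta> * \<bar>a\<bar> powr (p - 1)" by (simp add: mult.assoc flip: powr_add)
    finally show ?thesis using growth[OF that(1), of a] by linarith
  qed
  define S where "S = c * (1 + (T + 1) powr (q - 1))"
  have S: "0 \<le> S" using c by (simp add: S_def)
  have small: "\<bar>f x a\<bar> \<le> S" if "x \<in> closure \<Omega>" "\<bar>a\<bar> \<le> T + 1" for x a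
  proof -
    have "\<bar>a\<bar> powr (q - 1) \<le> (T + 1) powr (q - 1)" using that q by (intro powr_mono2) auto
    then have "c * (1 + \<bar>a\<bar> powr (q - 1)) \<le> S" unfolding S_def using c by (intro mult_left_mono) auto
    then show ?thesis using growth[OF that(1), of a] by linarith
  qed
  obtain \<delta> where \<delta>: "\<delta> > 0" "\<And>x a b. x \<in> closure \<Omega> \<Longrightarrow> a \<in> {-(T+1)..T+1} \<Longrightarrow> b \<in> {-(T+1)..T+1} \<Longrightarrow>
      dist (x, a) (x, b) < \<delta> \<Longrightarrow> \<bar>f x a - f x b\<bar> < \<eta>"
    using f_unif[OF \<eta>, of "T + 1"] by blast
  \<comment> \<open>S covers arguments at distance at least 1, and \<open>2 * S / \<delta>\<close>
    covers moderate arguments too far apart for uniform continuity.\<close>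
  define C where "C = max S (2 * S / \<delta>)"
  have C: "S \<le> C" "2 * S / \<delta> \<le> C" "0 \<le> C" using S by (auto simp: C_def le_max_iff_disj)
  have "\<bar>f x a - f x b\<bar> \<le> \<eta> * (1 + \<bar>a\<bar> powr (p - 1) + \<bar>b\<bar> powr (p - 1)) + C * \<bar>a - b\<bar>"
    if x: "x \<in> closure \<Omega>" for x a b
  proof -
    have pos: "0 \<le> \<eta> * \<bar>a\<bar> powr (p - 1)" "0 \<le> \<eta> * \<bar>b\<bar> powr (p - 1)" "0 \<le> C * \<bar>a - b\<bar>"
      using \<eta> C by auto
    have far: "S \<le> C * \<bar>a - b\<bar>" if "1 \<le> \<bar>a - b\<bar>"
      using mult_mono[OF C(1) that] S C by simp
    \<comment> \<open>The gap between T and \<open>T + 1\<close> puts a small and a large argument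
      at distance at least 1 in the two mixed cases.\<close>
    consider "\<bar>a\<bar> \<le> T + 1 \<and> \<bar>b\<bar> \<le> T + 1" | "T \<le> \<bar>a\<bar> \<and> T \<le> \<bar>b\<bar>" | "\<bar>a\<bar> < T \<and> T + 1 < \<bar>b\<bar>" | "\<bar>b\<bar> < T \<and> T + 1 < \<bar>a\<bar>"
      by linarith
    then have "\<bar>f x a - f x b\<bar> \<le> \<eta> + \<eta> * \<bar>a\<bar> powr (p - 1) + \<eta> * \<bar>b\<bar> powr (p - 1) + C * \<bar>a - b\<bar>"
    proof cases
      case 1
      show ?thesis
      proof (cases "\<bar>a - b\<bar> < \<delta>")
        case True
        moreover have "a \<in> {-(T + 1)..T + 1}" "b \<in> {-(T + 1)..T + 1}"
          using 1 unfolding atLeastAtMost_iff by linarith+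
        ultimately have "\<bar>f x a - f x b\<bar> < \<eta>" using \<delta>(2)[OF x, of a b] by (simp add: dist_Pair_Pair dist_real_def)
        then show ?thesis using pos by linarith
      next
        case False
        have "2 * S = 2 * S / \<delta> * \<delta>" using \<delta> by simp
        also have "\<dots> \<le> C * \<bar>a - b\<bar>" using C False \<delta> S by (intro mult_mono) auto
        finally show ?thesis using small[OF x, of a] small[OF x, of b] 1 pos \<eta> by linarith
      qed
    next
      case 2
      then show ?thesis using large[OF x, of a] large[OF x, of b] pos \<eta> by linarith
    next
      case 3
      then show ?thesis using large[OF x, of b] small[OF x, of a] far pos \<eta> by linarith
    next
      case 4
      then show ?thesis using large[OF x, of a] small[OF x, of b] far pos \<eta> by linarith
    qed
    then show ?thesis by (simp add: algebra_simps)
  qed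
  then show ?thesis using C(3) by blast
qed

definition fe :: "real ^ 'n \<Rightarrow> real \<Rightarrow> real" where "fe x t = (if x \<in> \<Omega> then f x t else 0)"
definition Fe :: "real ^ 'n \<Rightarrow> real \<Rightarrow> real" where "Fe x t = (if x \<in> \<Omega> then primitive (f x) t else 0)"

text \<open>Continuity on the closed set over the closure of \<Omega> gives a Borel function after
  extension by zero; the factor for \<Omega> then removes the boundary.\<close>

lemma fe_joint: "(\<lambda>z. fe (fst z) (snd z)) \<in> borel_measurable borel"
proof -
  have "(\<lambda>z. indicator (closure \<Omega> \<times> UNIV) z *\<^sub>R (case z of (x, t) \<Rightarrow> f x t)) \<in> borel_measurable borel"
    by (intro borel_measurable_continuous_on_indicator f_cont borel_closed closed_Times) auto
  moreover have "(\<lambda>z :: (real ^ 'n) \<times> real. indicator \<Omega> (fst z) :: real) \<in> borel_measurable borel"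
    by (intro measurable_compose[OF _ borel_measurable_indicator[OF \<Omega>_borel]] borel_measurable_continuous_onI continuous_intros)
  ultimately have "(\<lambda>z. indicator \<Omega> (fst z) * (indicator (closure \<Omega> \<times> UNIV) z *\<^sub>R (case z of (x, t) \<Rightarrow> f x t))) \<in> borel_measurable borel"
    by (rule borel_measurable_times[rotated])
  also have "(\<lambda>z. indicator \<Omega> (fst z) * (indicator (closure \<Omega> \<times> UNIV) z *\<^sub>R (case z of (x, t) \<Rightarrow> f x t))) = (\<lambda>z. fe (fst z) (snd z))"
    using closure_\<Omega> by (auto simp: fe_def fun_eq_iff split: split_indicator)
  finally show ?thesis .
qed

lemma fe_measurable:
  assumes "g \<in> borel_measurable Ms" "k \<in> borel_measurable Ms"
  shows "(\<lambda>z. fe (g z) (k z)) \<in> borel_measurable Ms"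
proof -
  have "(\<lambda>z. (g z, k z)) \<in> borel_measurable Ms" using assms by (rule borel_measurable_Pair)
  from measurable_compose[OF this fe_joint] show ?thesis by simp
qed

lemma Fe_measurable:
  assumes [measurable]: "u \<in> borel_measurable borel"
  shows "(\<lambda>x. Fe x (u x)) \<in> borel_measurable borel"
proof -
  have "(\<lambda>(x, y). fe x (u x * y) * indicator {0..1} y) \<in> borel_measurable (borel \<Otimes>\<^sub>M lborel)"
    unfolding case_prod_beta by (intro borel_measurable_times fe_measurable) measurable
  then have "(\<lambda>x. u x * (\<integral>y. fe x (u x * y) * indicator {0..1} y \<partial>lborel)) \<in> borel_measurable borel"
    by (intro borel_measurable_times lborel.borel_measurable_lebesgue_integral) (auto simp: assms)
  moreover have "u x * (\<integral>y. fe x (u x * y) * indicator {0..1} y \<partial>lborel) = Fe x (u x)" for x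
    using primitive_eq_integral[OF f_continuous[OF closure_\<Omega>], of x "u x"] by (simp add: Fe_def fe_def)
  ultimately show ?thesis by simp
qed

definition Du :: "(real ^ 'n \<Rightarrow> real) \<Rightarrow> (real ^ 'n \<Rightarrow> real) \<Rightarrow> real" where
  "Du u a = (\<integral>x. fe x (u x) * a x \<partial>lborel)"

definition Phi :: "(real ^ 'n \<Rightarrow> real) \<Rightarrow> real" where
  "Phi u = (\<integral>x. Fe x (u x) \<partial>lborel)"

definition one\<Omega> :: "real ^ 'n \<Rightarrow> real" where "one\<Omega> = indicator \<Omega>"

lemma one\<Omega>_sq: "one\<Omega> \<in> sq_integrable lborel"
  unfolding one\<Omega>_def by (intro sq_integrable_indicator) (simp_all add: emeasure_\<Omega>)

lemma one\<Omega>_integrable: "integrable lborel one\<Omega>"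
  unfolding one\<Omega>_def by (rule integrable_real_indicator) (simp_all add: emeasure_\<Omega>)

lemma abs_sq: "u \<in> X \<Longrightarrow> (\<lambda>x. \<bar>u x\<bar>) \<in> sq_integrable lborel"
  using X_sq[of u] by (auto simp: sq_integrable_def)

lemma L_abs_integral:
  assumes "u \<in> X" "g \<in> sq_integrable lborel"
  shows "(\<integral>x. \<bar>u x\<bar> * g x \<partial>lborel) \<le> L u * sqrt (\<integral>x. (g x)\<^sup>2 \<partial>lborel)"
proof -
  have "(\<integral>x. \<bar>u x\<bar> * g x \<partial>lborel)\<^sup>2 \<le> (L u)\<^sup>2 * (\<integral>x. (g x)\<^sup>2 \<partial>lborel)"
    using integral_Cauchy_Schwarz[OF abs_sq[OF assms(1)] assms(2)] by (simp add: L_sq)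
  also have "\<dots> = (L u * sqrt (\<integral>x. (g x)\<^sup>2 \<partial>lborel))\<^sup>2" by (simp add: power_mult_distrib)
  finally show ?thesis by (rule power2_le_imp_le) simp
qed

lemma integrable_abs_indicator: "u \<in> X \<Longrightarrow> integrable lborel (\<lambda>x. \<bar>u x\<bar> * one\<Omega> x)"
  using sq_integrable_mult[OF abs_sq one\<Omega>_sq] .

lemma integral_abs_indicator_le: "u \<in> X \<Longrightarrow> (\<integral>x. \<bar>u x\<bar> * one\<Omega> x \<partial>lborel) \<le> sqrt m\<Omega> * Poincare_const * N u"
proof -
  assume u: "u \<in> X"
  have "(\<integral>x. (one\<Omega> x)\<^sup>2 \<partial>lborel) = m\<Omega>"
  proof -
    have "(\<lambda>x. (one\<Omega> x)\<^sup>2) = indicator \<Omega>" by (auto simp: one\<Omega>_def split: split_indicator)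
    then show ?thesis by (simp add: m\<Omega>_def)
  qed
  then have "(\<integral>x. \<bar>u x\<bar> * one\<Omega> x \<partial>lborel) \<le> L u * sqrt m\<Omega>"
    using L_abs_integral[OF u one\<Omega>_sq] by simp
  also have "\<dots> \<le> (Poincare_const * N u) * sqrt m\<Omega>" using Poincare_const(2)[OF u] m\<Omega>_nonneg by (intro mult_right_mono) auto
  finally show ?thesis by (simp add: mult_ac)
qed

lemma integrable_abs_product: "u \<in> X \<Longrightarrow> v \<in> X \<Longrightarrow> integrable lborel (\<lambda>x. \<bar>u x\<bar> * \<bar>v x\<bar>)"
  using sq_integrable_mult[OF abs_sq abs_sq] .

lemma integral_abs_product_le: "u \<in> X \<Longrightarrow> v \<in> X \<Longrightarrow> (\<integral>x. \<bar>u x\<bar> * \<bar>v x\<bar> \<partial>lborel) \<le> L u * (Poincare_const * N v)"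
proof -
  assume u: "u \<in> X" and v: "v \<in> X"
  have "(\<integral>x. \<bar>u x\<bar> * \<bar>v x\<bar> \<partial>lborel) \<le> L u * L v"
    using L_abs_integral[OF u abs_sq[OF v]] by (simp add: L_def)
  also have "\<dots> \<le> L u * (Poincare_const * N v)" using Poincare_const(2)[OF v] by (intro mult_left_mono) auto
  finally show ?thesis .
qed

definition Sobolev_const :: real where
  "Sobolev_const = (SOME C. C \<ge> 0 \<and> (\<forall>u\<in>X. integrable lborel (\<lambda>x. \<bar>u x\<bar> powr p) \<and> (\<integral>x. \<bar>u x\<bar> powr p \<partial>lborel) \<le> C * N u powr p))"

lemma Sobolev_const: "0 \<le> Sobolev_const" and integrable_powr: "u \<in> X \<Longrightarrow> integrable lborel (\<lambda>x. \<bar>u x\<bar> powr p)"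
  and integral_powr_le: "u \<in> X \<Longrightarrow> (\<integral>x. \<bar>u x\<bar> powr p \<partial>lborel) \<le> Sobolev_const * N u powr p"
proof -
  have "Sobolev_const \<ge> 0 \<and> (\<forall>u\<in>X. integrable lborel (\<lambda>x. \<bar>u x\<bar> powr p) \<and> (\<integral>x. \<bar>u x\<bar> powr p \<partial>lborel) \<le> Sobolev_const * N u powr p)"
    unfolding Sobolev_const_def by (rule someI_ex) (use Sobolev[of p] p in auto)
  then show "0 \<le> Sobolev_const" "u \<in> X \<Longrightarrow> integrable lborel (\<lambda>x. \<bar>u x\<bar> powr p)"
    "u \<in> X \<Longrightarrow> (\<integral>x. \<bar>u x\<bar> powr p \<partial>lborel) \<le> Sobolev_const * N u powr p" by auto
qed

lemma N_zero_AE: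
  assumes "u \<in> X" "N u = 0"
  shows "AE x in lborel. u x = 0"
proof -
  have "L u = 0" using Poincare_const(2)[OF assms(1)] L_nonneg[of u] assms(2) by simp
  then show ?thesis using L_zero_iff_AE[OF assms(1)] by simp
qed

lemma integrable_powr_product:
  assumes u: "u \<in> X" "v \<in> X"
  shows "integrable lborel (\<lambda>x. \<bar>u x\<bar> powr (p - 1) * \<bar>v x\<bar>)"
proof (rule Bochner_Integration.integrable_bound)
  show "integrable lborel (\<lambda>x. \<bar>u x\<bar> powr p + \<bar>v x\<bar> powr p)" using integrable_powr u by auto
  show "(\<lambda>x. \<bar>u x\<bar> powr (p - 1) * \<bar>v x\<bar>) \<in> borel_measurable lborel"
    using X_measurable[OF u(1)] X_measurable[OF u(2)] by measurable
  show "AE x in lborel. norm (\<bar>u x\<bar> powr (p - 1) * \<bar>v x\<bar>) \<le> norm (\<bar>u x\<bar> powr p + \<bar>v x\<bar> powr p)"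
    using powr_Young[of "\<bar>u _\<bar>" "\<bar>v _\<bar>" p] p by (auto simp: abs_mult)
qed

text \<open>Homogeneity in v replaces Hoelder: v is scaled to norm 1, where the crude Young
  inequality suffices. For norm zero v vanishes almost everywhere.\<close>

lemma integral_powr_product_le:
  assumes u: "u \<in> X" "v \<in> X" and K: "N u \<le> K"
  shows "(\<integral>x. \<bar>u x\<bar> powr (p - 1) * \<bar>v x\<bar> \<partial>lborel) \<le> Sobolev_const * (K powr p + 1) * N v"
proof (cases "N v = 0")
  case True
  then have "AE x in lborel. \<bar>u x\<bar> powr (p - 1) * \<bar>v x\<bar> = 0"
    using N_zero_AE[OF u(2)] by auto
  then have "(\<integral>x. \<bar>u x\<bar> powr (p - 1) * \<bar>v x\<bar> \<partial>lborel) = 0" by (rule integral_eq_zero_AE)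
  then show ?thesis using True by simp
next
  case False
  then have Nv: "N v > 0" using N_nonneg[OF u(2)] by linarith
  define w where "w = (1 / N v) *\<^sub>R v"
  have w: "w \<in> X" "N w = 1" using u Nv by (auto simp: w_def N_scale)
  have "(\<integral>x. \<bar>u x\<bar> powr (p - 1) * \<bar>w x\<bar> \<partial>lborel) \<le> (\<integral>x. \<bar>u x\<bar> powr p + \<bar>w x\<bar> powr p \<partial>lborel)"
    using powr_Young p by (intro integral_mono integrable_powr_product u w Bochner_Integration.integrable_add integrable_powr) auto
  also have "\<dots> = (\<integral>x. \<bar>u x\<bar> powr p \<partial>lborel) + (\<integral>x. \<bar>w x\<bar> powr p \<partial>lborel)"
    by (intro Bochner_Integration.integral_add integrable_powr u w)
  also have "\<dots> \<le> Sobolev_const * N u powr p + Sobolev_const * N w powr p" by (intro add_mono integral_powr_le u w)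
  also have "\<dots> \<le> Sobolev_const * (K powr p + 1)"
  proof -
    have "N u powr p \<le> K powr p" using K u p by (intro powr_mono2) auto
    then show ?thesis using Sobolev_const w by (simp add: distrib_left mult_left_mono)
  qed
  finally have le: "(\<integral>x. \<bar>u x\<bar> powr (p - 1) * \<bar>w x\<bar> \<partial>lborel) \<le> Sobolev_const * (K powr p + 1)" .
  have "\<bar>u x\<bar> powr (p - 1) * \<bar>v x\<bar> = N v * (\<bar>u x\<bar> powr (p - 1) * \<bar>w x\<bar>)" for x
    using Nv by (simp add: w_def abs_mult)
  then have "(\<integral>x. \<bar>u x\<bar> powr (p - 1) * \<bar>v x\<bar> \<partial>lborel) = (\<integral>x. N v * (\<bar>u x\<bar> powr (p - 1) * \<bar>w x\<bar>) \<partial>lborel)"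
    by (rule Bochner_Integration.integral_cong[OF refl])
  also have "\<dots> = N v * (\<integral>x. \<bar>u x\<bar> powr (p - 1) * \<bar>w x\<bar> \<partial>lborel)" by simp
  also have "\<dots> \<le> N v * (Sobolev_const * (K powr p + 1))" using le Nv by (intro mult_left_mono) auto
  finally show ?thesis by (simp add: mult_ac)
qed

end

context subcritical
begin

lemma growth_p:
  assumes "x \<in> closure \<Omega>" "\<bar>t\<bar> \<le> r"
  shows "\<bar>f x t\<bar> \<le> 2 * c * (1 + r powr (p - 1))"
proof -
  have "\<bar>t\<bar> powr (q - 1) \<le> 1 + \<bar>t\<bar> powr (p - 1)"
  proof (cases "\<bar>t\<bar> \<le> 1")
    case True
    then have "\<bar>t\<bar> powr (q - 1) \<le> 1 powr (q - 1)" using q by (intro powr_mono2) auto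
    then show ?thesis using powr_ge_zero[of "\<bar>t\<bar>" "p - 1"] unfolding powr_one_eq_one by linarith
  next
    case False
    then have "\<bar>t\<bar> powr (q - 1) \<le> \<bar>t\<bar> powr (p - 1)" using p by (intro powr_mono) auto
    then show ?thesis by linarith
  qed
  also have "\<dots> \<le> 1 + r powr (p - 1)" using assms p by (intro add_left_mono powr_mono2) auto
  finally have "c * (1 + \<bar>t\<bar> powr (q - 1)) \<le> c * (1 + (1 + r powr (p - 1)))"
    using c by (intro mult_left_mono) auto
  also have "\<dots> \<le> c * (2 * (1 + r powr (p - 1)))" using c by (intro mult_left_mono) auto
  finally show ?thesis using growth[OF assms(1), of t] by (simp add: mult_ac)
qed

lemma primitive_f_bound:
  assumes "x \<in> closure \<Omega>" "\<bar>t\<bar> \<le> r"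
  shows "\<bar>primitive (f x) t\<bar> \<le> 2 * c * (1 + r powr (p - 1)) * \<bar>t\<bar>"
proof -
  obtain z where z: "\<bar>z\<bar> \<le> \<bar>t\<bar>" "primitive (f x) t = f x z * t"
    using primitive_MVT_abs[OF f_continuous[OF assms(1)], of 0 t] by auto
  then show ?thesis
    using mult_right_mono[OF growth_p[OF assms(1), of z r], of "\<bar>t\<bar>"] assms(2) by (simp add: abs_mult)
qed

lemma int_fe:
  assumes u: "u \<in> X" and a: "a \<in> X"
  shows "integrable lborel (\<lambda>x. fe x (u x) * a x)"
proof (rule Bochner_Integration.integrable_bound)
  show "integrable lborel (\<lambda>x. 2 * c * (\<bar>a x\<bar> * one\<Omega> x + \<bar>u x\<bar> powr (p - 1) * \<bar>a x\<bar>))"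
    by (intro integrable_mult_right Bochner_Integration.integrable_add integrable_abs_indicator integrable_powr_product u a)
  show "(\<lambda>x. fe x (u x) * a x) \<in> borel_measurable lborel"
    using X_measurable[OF u] X_measurable[OF a] by (intro borel_measurable_times fe_measurable) auto
  have "\<bar>fe x (u x) * a x\<bar> \<le> 2 * c * (\<bar>a x\<bar> * one\<Omega> x + \<bar>u x\<bar> powr (p - 1) * \<bar>a x\<bar>)" for x
  proof (cases "x \<in> \<Omega>")
    case True
    from mult_right_mono[OF growth_p[OF closure_\<Omega>[OF True] order_refl, of "u x"] abs_ge_zero[of "a x"]]
    show ?thesis using True by (simp add: fe_def one\<Omega>_def abs_mult algebra_simps)
  next
    case False
    then show ?thesis by (simp add: fe_def X_outside[OF a])
  qed
  then show "AE x in lborel. norm (fe x (u x) * a x) \<le> norm (2 * c * (\<bar>a x\<bar> * one\<Omega> x + \<bar>u x\<bar> powr (p - 1) * \<bar>a x\<bar>))"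
    by (intro AE_I2) (metis abs_ge_self order_trans real_norm_def)
qed

lemma int_Fe:
  assumes u: "u \<in> X"
  shows "integrable lborel (\<lambda>x. Fe x (u x))"
proof (rule Bochner_Integration.integrable_bound)
  show "integrable lborel (\<lambda>x. 2 * c * (\<bar>u x\<bar> * one\<Omega> x + \<bar>u x\<bar> powr (p - 1) * \<bar>u x\<bar>))"
    by (intro integrable_mult_right Bochner_Integration.integrable_add integrable_abs_indicator integrable_powr_product u)
  show "(\<lambda>x. Fe x (u x)) \<in> borel_measurable lborel"
    using Fe_measurable[OF X_measurable[OF u]] by simp
  have "\<bar>Fe x (u x)\<bar> \<le> 2 * c * (\<bar>u x\<bar> * one\<Omega> x + \<bar>u x\<bar> powr (p - 1) * \<bar>u x\<bar>)" for x
  proof (cases "x \<in> \<Omega>")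
    case True
    from primitive_f_bound[OF closure_\<Omega>[OF True] order_refl, of "u x"]
    show ?thesis using True by (simp add: Fe_def one\<Omega>_def algebra_simps)
  next
    case False
    then show ?thesis by (simp add: Fe_def X_outside[OF u])
  qed
  then show "AE x in lborel. norm (Fe x (u x)) \<le> norm (2 * c * (\<bar>u x\<bar> * one\<Omega> x + \<bar>u x\<bar> powr (p - 1) * \<bar>u x\<bar>))"
    by (intro AE_I2) (metis abs_ge_self order_trans real_norm_def)
qed

text \<open>\<open>f_modulus\<close> is integrated against the absolute value of a. The terms with
  powers carry the small factor and are bounded by \<open>Sobolev\<close>; the linear term is a
  product of two L2 functions and yields \<open>L (u - v)\<close>.\<close>

lemma Du_modulus:
  assumes K: "K > 0" and \<eta>: "\<eta> > 0"
  shows "\<exists>C\<ge>0. \<forall>u\<in>X. \<forall>v\<in>X. \<forall>a\<in>X. N u \<le> K \<longrightarrow> N v \<le> K \<longrightarrow>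
    \<bar>Du u a - Du v a\<bar> \<le> (\<eta> + C * L (u - v)) * N a"
proof -
  \<comment> \<open>\<open>E - 1\<close> is the sum of all constants that multiply \<eta>; the 1
    makes E positive.\<close>
  define E where "E = sqrt m\<Omega> * Poincare_const + 2 * (Sobolev_const * (K powr p + 1)) + 1"
  have E: "E > 0" using m\<Omega>_nonneg Poincare_const(1) Sobolev_const by (simp add: E_def add_nonneg_pos)
  obtain C where C: "C \<ge> 0" "\<And>x a b. x \<in> closure \<Omega> \<Longrightarrow>
      \<bar>f x a - f x b\<bar> \<le> \<eta> / E * (1 + \<bar>a\<bar> powr (p - 1) + \<bar>b\<bar> powr (p - 1)) + C * \<bar>a - b\<bar>"
    using f_modulus[of "\<eta> / E"] \<eta> E by auto
  have "\<bar>Du u a - Du v a\<bar> \<le> (\<eta> + C * Poincare_const * L (u - v)) * N a"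
    if uva: "u \<in> X" "v \<in> X" "a \<in> X" "N u \<le> K" "N v \<le> K" for u v a
  proof -
    define g where "g x = \<eta> / E * (\<bar>a x\<bar> * one\<Omega> x + \<bar>u x\<bar> powr (p - 1) * \<bar>a x\<bar> + \<bar>v x\<bar> powr (p - 1) * \<bar>a x\<bar>)
      + C * (\<bar>(u - v) x\<bar> * \<bar>a x\<bar>)" for x
    have uv: "u - v \<in> X" using uva by simp
    note ints = integrable_abs_indicator[OF uva(3)] integrable_powr_product[OF uva(1,3)] integrable_powr_product[OF uva(2,3)] integrable_abs_product[OF uv uva(3)]
    have gi: "integrable lborel g" unfolding g_def
      by (intro Bochner_Integration.integrable_add integrable_mult_right ints)
    have le: "\<bar>fe x (u x) * a x - fe x (v x) * a x\<bar> \<le> g x" for x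
    proof (cases "x \<in> \<Omega>")
      case True
      from mult_right_mono[OF C(2)[OF closure_\<Omega>[OF True], of "u x" "v x"] abs_ge_zero[of "a x"]]
      have "\<bar>(f x (u x) - f x (v x)) * a x\<bar> \<le> g x"
        unfolding abs_mult using True by (simp add: g_def one\<Omega>_def algebra_simps)
      then show ?thesis using True by (simp add: fe_def left_diff_distrib)
    next
      case False
      then show ?thesis by (simp add: fe_def g_def X_outside[OF uva(3)])
    qed
    have "\<bar>Du u a - Du v a\<bar> = \<bar>\<integral>x. fe x (u x) * a x - fe x (v x) * a x \<partial>lborel\<bar>"
      unfolding Du_def using uva by (simp add: int_fe)
    also have "\<dots> \<le> (\<integral>x. \<bar>fe x (u x) * a x - fe x (v x) * a x\<bar> \<partial>lborel)"
      by (rule integral_abs_bound)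
    also have "\<dots> \<le> (\<integral>x. g x \<partial>lborel)"
      using uva gi le by (intro integral_mono integrable_abs Bochner_Integration.integrable_diff int_fe) auto
    also have "\<dots> = \<eta> / E * ((\<integral>x. \<bar>a x\<bar> * one\<Omega> x \<partial>lborel) + (\<integral>x. \<bar>u x\<bar> powr (p - 1) * \<bar>a x\<bar> \<partial>lborel)
        + (\<integral>x. \<bar>v x\<bar> powr (p - 1) * \<bar>a x\<bar> \<partial>lborel)) + C * (\<integral>x. \<bar>(u - v) x\<bar> * \<bar>a x\<bar> \<partial>lborel)"
      unfolding g_def using ints by (simp del: minus_apply)
    also have "\<dots> \<le> \<eta> / E * (sqrt m\<Omega> * Poincare_const * N a + Sobolev_const * (K powr p + 1) * N a + Sobolev_const * (K powr p + 1) * N a)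
        + C * (L (u - v) * (Poincare_const * N a))"
      using \<eta> E C(1) by (intro add_mono mult_left_mono integral_abs_indicator_le[OF uva(3)] integral_abs_product_le[OF uv uva(3)]
        integral_powr_product_le[OF uva(1,3,4)] integral_powr_product_le[OF uva(2,3,5)]) auto
    also have "\<dots> = \<eta> / E * ((E - 1) * N a) + C * (L (u - v) * (Poincare_const * N a))"
      by (simp add: E_def algebra_simps)
    also have "\<dots> \<le> \<eta> / E * (E * N a) + C * (L (u - v) * (Poincare_const * N a))"
      using \<eta> E uva by (intro add_right_mono mult_left_mono mult_right_mono) auto
    also have "\<dots> = (\<eta> + C * Poincare_const * L (u - v)) * N a" using E by (simp add: algebra_simps)
    finally show ?thesis .
  qed
  then show ?thesis using C(1) Poincare_const(1) by (intro exI[of _ "C * Poincare_const"]) auto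
qed

text \<open>The increment of the primitive is f at an intermediate point z times \<open>a x\<close>,
  so the remainder is again a difference of values of f, now at distance at most the absolute value
  of \<open>a x\<close>.\<close>

lemma Phi_modulus:
  assumes K: "K > 0" and \<eta>: "\<eta> > 0"
  shows "\<exists>C\<ge>0. \<forall>u\<in>X. \<forall>a\<in>X. N u \<le> K \<longrightarrow> N a \<le> K \<longrightarrow>
    \<bar>Phi (u + a) - Phi u - Du u a\<bar> \<le> (\<eta> + C * L a) * N a"
proof -
  \<comment> \<open>The cost of splitting the power of a sum, since z is only bounded by the sum of
    the absolute values of \<open>u x\<close> and \<open>a x\<close>.\<close>
  define T where "T = 2 powr (p - 1)"
  have T: "T > 0" by (simp add: T_def)
  define E where "E = sqrt m\<Omega> * Poincare_const + (T + 1) * (Sobolev_const * (K powr p + 1)) + T * (Sobolev_const * (K powr p + 1)) + 1"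
  have E: "E > 0" using m\<Omega>_nonneg Poincare_const(1) Sobolev_const T by (simp add: E_def add_nonneg_pos)
  obtain C where C: "C \<ge> 0" "\<And>x a b. x \<in> closure \<Omega> \<Longrightarrow>
      \<bar>f x a - f x b\<bar> \<le> \<eta> / E * (1 + \<bar>a\<bar> powr (p - 1) + \<bar>b\<bar> powr (p - 1)) + C * \<bar>a - b\<bar>"
    using f_modulus[of "\<eta> / E"] \<eta> E by auto
  have "\<bar>Phi (u + a) - Phi u - Du u a\<bar> \<le> (\<eta> + C * Poincare_const * L a) * N a"
    if ua: "u \<in> X" "a \<in> X" "N u \<le> K" "N a \<le> K" for u a
  proof -
    define g where "g x = \<eta> / E * (\<bar>a x\<bar> * one\<Omega> x + (T + 1) * (\<bar>u x\<bar> powr (p - 1) * \<bar>a x\<bar>) + T * (\<bar>a x\<bar> powr (p - 1) * \<bar>a x\<bar>))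
      + C * (\<bar>a x\<bar> * \<bar>a x\<bar>)" for x
    note ints = integrable_abs_indicator[OF ua(2)] integrable_powr_product[OF ua(1,2)] integrable_powr_product[OF ua(2,2)] integrable_abs_product[OF ua(2,2)]
    have gi: "integrable lborel g" unfolding g_def
      by (intro Bochner_Integration.integrable_add integrable_mult_right ints)
    have le: "\<bar>Fe x ((u + a) x) - Fe x (u x) - fe x (u x) * a x\<bar> \<le> g x" for x
    proof (cases "x \<in> \<Omega>")
      case True
      note x = closure_\<Omega>[OF True]
      obtain z where z: "\<bar>z - u x\<bar> \<le> \<bar>a x\<bar>" "\<bar>z\<bar> \<le> max \<bar>u x\<bar> \<bar>u x + a x\<bar>"
          "primitive (f x) (u x + a x) - primitive (f x) (u x) = f x z * a x"
        using primitive_MVT_abs[OF f_continuous[OF x], of "u x" "a x"] by blast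
      have "\<bar>z\<bar> \<le> \<bar>u x\<bar> + \<bar>a x\<bar>" using z(2) by linarith
      then have "\<bar>z\<bar> powr (p - 1) \<le> (\<bar>u x\<bar> + \<bar>a x\<bar>) powr (p - 1)" using p by (intro powr_mono2) auto
      also have "\<dots> \<le> T * (\<bar>u x\<bar> powr (p - 1) + \<bar>a x\<bar> powr (p - 1))"
        unfolding T_def using p by (intro powr_add_le) auto
      finally have zp: "\<bar>z\<bar> powr (p - 1) \<le> T * (\<bar>u x\<bar> powr (p - 1) + \<bar>a x\<bar> powr (p - 1))" .
      have "\<bar>f x z - f x (u x)\<bar> \<le> \<eta> / E * (1 + \<bar>z\<bar> powr (p - 1) + \<bar>u x\<bar> powr (p - 1)) + C * \<bar>z - u x\<bar>"
        by (rule C(2)[OF x])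
      also have "\<dots> \<le> \<eta> / E * (1 + T * (\<bar>u x\<bar> powr (p - 1) + \<bar>a x\<bar> powr (p - 1)) + \<bar>u x\<bar> powr (p - 1)) + C * \<bar>a x\<bar>"
        using zp z(1) \<eta> E C(1) by (intro add_mono mult_left_mono) auto
      finally have "\<bar>f x z - f x (u x)\<bar> * \<bar>a x\<bar> \<le>
          (\<eta> / E * (1 + T * (\<bar>u x\<bar> powr (p - 1) + \<bar>a x\<bar> powr (p - 1)) + \<bar>u x\<bar> powr (p - 1)) + C * \<bar>a x\<bar>) * \<bar>a x\<bar>"
        by (rule mult_right_mono) simp
      also have "\<dots> = g x" using True by (simp add: g_def one\<Omega>_def algebra_simps)
      finally have "\<bar>f x z * a x - f x (u x) * a x\<bar> \<le> g x" by (simp only: abs_mult[symmetric] left_diff_distrib)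
      then show ?thesis using True z(3) by (simp add: Fe_def fe_def)
    next
      case False
      then show ?thesis by (simp add: fe_def Fe_def g_def X_outside[OF ua(2)])
    qed
    have sum: "u + a \<in> X" using ua by simp
    have "\<bar>Phi (u + a) - Phi u - Du u a\<bar> = \<bar>\<integral>x. Fe x ((u + a) x) - Fe x (u x) - fe x (u x) * a x \<partial>lborel\<bar>"
      unfolding Du_def Phi_def using int_Fe[OF sum] int_Fe[OF ua(1)] int_fe[OF ua(1,2)]
      by (simp del: plus_fun_apply)
    also have "\<dots> \<le> (\<integral>x. \<bar>Fe x ((u + a) x) - Fe x (u x) - fe x (u x) * a x\<bar> \<partial>lborel)"
      by (rule integral_abs_bound)
    also have "\<dots> \<le> (\<integral>x. g x \<partial>lborel)"
      using int_Fe[OF sum] int_Fe[OF ua(1)] int_fe[OF ua(1,2)] gi le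
      by (intro integral_mono integrable_abs Bochner_Integration.integrable_diff) auto
    also have "\<dots> = \<eta> / E * ((\<integral>x. \<bar>a x\<bar> * one\<Omega> x \<partial>lborel) + (T + 1) * (\<integral>x. \<bar>u x\<bar> powr (p - 1) * \<bar>a x\<bar> \<partial>lborel)
        + T * (\<integral>x. \<bar>a x\<bar> powr (p - 1) * \<bar>a x\<bar> \<partial>lborel)) + C * (\<integral>x. \<bar>a x\<bar> * \<bar>a x\<bar> \<partial>lborel)"
      unfolding g_def using ints by (simp del: abs_mult_self_eq)
    also have "\<dots> \<le> \<eta> / E * (sqrt m\<Omega> * Poincare_const * N a + (T + 1) * (Sobolev_const * (K powr p + 1) * N a) + T * (Sobolev_const * (K powr p + 1) * N a))
        + C * (L a * (Poincare_const * N a))"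
      using \<eta> E C(1) T by (intro add_mono mult_left_mono integral_abs_indicator_le[OF ua(2)] integral_abs_product_le[OF ua(2,2)]
        integral_powr_product_le[OF ua(1,2,3)] integral_powr_product_le[OF ua(2,2,4)]) auto
    also have "\<dots> = \<eta> / E * ((E - 1) * N a) + C * (L a * (Poincare_const * N a))"
      by (simp add: E_def algebra_simps)
    also have "\<dots> \<le> \<eta> / E * (E * N a) + C * (L a * (Poincare_const * N a))"
      using \<eta> E ua by (intro add_right_mono mult_left_mono mult_right_mono) auto
    also have "\<dots> = (\<eta> + C * Poincare_const * L a) * N a" using E by (simp add: algebra_simps)
    finally show ?thesis .
  qed
  then show ?thesis using C(1) Poincare_const(1) by (intro exI[of _ "C * Poincare_const"]) auto
qed

end

section \<open>Mountain pass geometry and the Ambrosetti-Rabinowitz condition\<close>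

lemma power_dominates:
  fixes A a \<theta> :: real
  assumes "0 \<le> A" "0 < a" "2 < \<theta>"
  shows "\<exists>C. \<forall>t\<ge>0. A * t\<^sup>2 - a * t powr \<theta> \<le> C"
proof -
  \<comment> \<open>The point from which on the power \<theta> beats the quadratic term.\<close>
  define T where "T = (A / a) powr (1 / (\<theta> - 2))"
  have "A * t\<^sup>2 - a * t powr \<theta> \<le> A * T\<^sup>2" if t: "t \<ge> 0" for t
  proof (cases "t \<le> T")
    case True
    then have "A * t\<^sup>2 \<le> A * T\<^sup>2" using assms t by (intro mult_left_mono power_mono) auto
    then show ?thesis using assms by (smt (verit) mult_nonneg_nonneg powr_ge_zero)
  next
    case False
    moreover have "0 \<le> T" by (simp add: T_def)
    ultimately have tT: "T < t" "t > 0" by linarith+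
    have "A / a = T powr (\<theta> - 2)" using assms by (simp add: T_def powr_powr)
    also have "\<dots> \<le> t powr (\<theta> - 2)" using tT assms by (intro powr_mono2) (auto simp: T_def)
    finally have "A \<le> a * t powr (\<theta> - 2)" using assms by (simp add: field_simps)
    then have "A * t\<^sup>2 \<le> a * t powr (\<theta> - 2) * t\<^sup>2" by (intro mult_right_mono) auto
    also have "\<dots> = a * t powr \<theta>"
    proof -
      have "t\<^sup>2 = t powr 2" using tT by (simp add: powr_numeral)
      then show ?thesis by (simp add: mult.assoc flip: powr_add)
    qed
    finally show ?thesis using assms by (smt (verit) mult_nonneg_nonneg zero_le_power2)
  qed
  then show ?thesis by blast
qed

locale kirchhoff_problem = subcritical s \<Omega> f c q for s and \<Omega> :: "(real ^ 'n) set" and f c q +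
  fixes M :: "real \<Rightarrow> real" and m0 t0 t_star \<theta> lam lam1 :: real
  assumes nonempty: "\<Omega> \<noteq> {}"
    and M_continuous: "continuous_on {0..} M"
    and m0_pos: "0 < m0" and M_ge: "\<And>t. t \<ge> 0 \<Longrightarrow> m0 \<le> M t"
    and t0: "t0 \<ge> 0" "\<And>t. t \<ge> t0 \<Longrightarrow> t * M t \<le> primitive M t"
    and t_star: "t_star > 0" and \<theta>: "\<theta> > 2"
    and AR: "\<And>x t. x \<in> closure \<Omega> \<Longrightarrow> \<bar>t\<bar> \<ge> t_star \<Longrightarrow>
      0 < \<theta> * primitive (f x) t \<and> \<theta> * primitive (f x) t \<le> f x t * t"
    and lam1: "0 < lam1" "\<And>u. u \<in> X \<Longrightarrow> lam1 * (L u)\<^sup>2 \<le> (N u)\<^sup>2" and lam: "lam < m0 * lam1"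
    and near_0: "\<And>\<epsilon>. \<epsilon> > 0 \<Longrightarrow> \<exists>\<delta>>0. \<forall>x\<in>closure \<Omega>. \<forall>t. 0 < \<bar>t\<bar> \<and> \<bar>t\<bar> \<le> \<delta> \<longrightarrow> f x t / t \<le> lam + \<epsilon>"
begin

text \<open>Constant continuation of M to the left, which makes the primitive differentiable on the
  whole line, 0 included.\<close>

definition Mx :: "real \<Rightarrow> real" where "Mx t = M (max 0 t)"

lemma Mx_continuous: "continuous_on UNIV Mx"
  unfolding Mx_def by (rule continuous_on_compose2[OF M_continuous]) (auto intro!: continuous_intros)

lemma primitive_Mx: "0 \<le> t \<Longrightarrow> primitive Mx t = primitive M t"
  unfolding primitive_def by (rule interval_integral_cong) (auto simp: einterval_def Mx_def zero_ereal_def)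

lemma Mh_MVT:
  assumes "0 \<le> a" "a \<le> b"
  shows "\<exists>x\<in>{a..b}. primitive M b - primitive M a = M x * (b - a)"
  using primitive_MVT[OF Mx_continuous assms(2)] assms by (auto simp: primitive_Mx Mx_def max_def)

text \<open>A one-sided bound on the quotient, multiplied by t, bounds f from above for positive t
  and from below for negative t; continuity at 0 combines the two.\<close>

lemma f_zero:
  assumes "x \<in> closure \<Omega>"
  shows "f x 0 = 0"
proof -
  obtain \<delta> where \<delta>: "\<delta> > 0" "\<And>t. 0 < \<bar>t\<bar> \<Longrightarrow> \<bar>t\<bar> \<le> \<delta> \<Longrightarrow> f x t / t \<le> lam + 1"
    using near_0[of 1] assms by auto
  define t where "t j = \<delta> / real (Suc j)" for j
  have t: "0 < t j" "t j \<le> \<delta>" for j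
    using \<delta> by (auto simp: t_def field_simps)
  have "(\<lambda>j. \<delta> * inverse (real (Suc j))) \<longlonglongrightarrow> \<delta> * 0"
    by (intro tendsto_mult_left LIMSEQ_inverse_real_of_nat)
  then have t0: "t \<longlonglongrightarrow> 0" by (simp add: t_def[abs_def] divide_inverse)
  have cont: "isCont (f x) 0" using f_continuous[OF assms] by (simp add: continuous_on_eq_continuous_at)
  have "f x 0 \<le> (lam + 1) * 0"
  proof (rule LIMSEQ_le)
    show "(\<lambda>j. f x (t j)) \<longlonglongrightarrow> f x 0" by (rule isCont_tendsto_compose[OF cont t0])
    show "(\<lambda>j. (lam + 1) * t j) \<longlonglongrightarrow> (lam + 1) * 0" by (intro tendsto_mult_left t0)
    show "\<exists>n. \<forall>j\<ge>n. f x (t j) \<le> (lam + 1) * t j"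
    proof (intro exI allI impI)
      fix j
      show "f x (t j) \<le> (lam + 1) * t j" using \<delta>(2)[of "t j"] t[of j] by (simp add: divide_le_eq)
    qed
  qed
  moreover have "(lam + 1) * - 0 \<le> f x (- 0)"
  proof (rule LIMSEQ_le)
    show "(\<lambda>j. f x (- t j)) \<longlonglongrightarrow> f x (- 0)"
      using isCont_tendsto_compose[OF _ tendsto_minus[OF t0], of "f x"] cont by simp
    show "(\<lambda>j. (lam + 1) * - t j) \<longlonglongrightarrow> (lam + 1) * - 0" by (intro tendsto_mult_left tendsto_minus t0)
    show "\<exists>n. \<forall>j\<ge>n. (lam + 1) * - t j \<le> f x (- t j)"
    proof (intro exI allI impI)
      fix j
      have "f x (- t j) / (- t j) \<le> lam + 1" using \<delta>(2)[of "- t j"] t[of j] by simp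
      then show "(lam + 1) * - t j \<le> f x (- t j)" using t[of j] by (simp add: field_simps)
    qed
  qed
  ultimately show ?thesis by simp
qed

sublocale kirchhoff X B L M "primitive M" Phi Du m0
proof
  show "\<exists>C. \<forall>u\<in>X. 0 \<le> L u \<and> L u \<le> C * N u" using Poincare_const by (intro exI[of _ Poincare_const]) auto
  show "Du u (a + b) = Du u a + Du u b" if "u \<in> X" "a \<in> X" "b \<in> X" for u a b
    unfolding Du_def using int_fe[OF that(1,2)] int_fe[OF that(1,3)] by (simp add: algebra_simps)
  show "Du u (r *\<^sub>R a) = r * Du u a" if "u \<in> X" "a \<in> X" for u a r
    unfolding Du_def by (simp add: mult.left_commute)
  have "fe x 0 = 0" for x using f_zero[OF closure_\<Omega>, of x] by (simp add: fe_def)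
  then show "Du 0 a = 0" for a by (simp add: Du_def)
  have "Fe x 0 = 0" for x by (simp add: Fe_def)
  then show "Phi 0 = 0" by (simp add: Phi_def)
qed (use M_continuous m0_pos M_ge Mh_MVT Du_modulus Phi_modulus in auto)

text \<open>Near 0 the derivative of F is compared with that of the quadratic. Away from 0 the
  constant in the growth bound is absorbed into a power of t, at the price of a factor depending on
  \<delta>.\<close>

lemma F_upper:
  assumes \<mu>: "lam < \<mu>" "0 < \<mu>"
  shows "\<exists>C\<ge>0. \<forall>x\<in>closure \<Omega>. \<forall>t. primitive (f x) t \<le> \<mu> / 2 * t\<^sup>2 + C * \<bar>t\<bar> powr p"
proof -
  obtain \<delta> where \<delta>: "\<delta> > 0" "\<And>x t. x \<in> closure \<Omega> \<Longrightarrow> 0 < \<bar>t\<bar> \<Longrightarrow> \<bar>t\<bar> \<le> \<delta> \<Longrightarrow> f x t / t \<le> \<mu>"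
    using near_0[of "\<mu> - lam"] \<mu> by auto
  define C where "C = 2 * c * (\<delta> powr (1 - p) + 1)"
  have C: "C \<ge> 0" using c by (simp add: C_def)
  have "primitive (f x) t \<le> \<mu> / 2 * t\<^sup>2 + C * \<bar>t\<bar> powr p" if x: "x \<in> closure \<Omega>" for x t
  proof (cases "\<bar>t\<bar> \<le> \<delta>")
    case True
    define G where "G \<tau> = \<mu> / 2 * \<tau>\<^sup>2 - primitive (f x) \<tau>" for \<tau>
    have G: "(G has_real_derivative \<mu> * \<tau> - f x \<tau>) (at \<tau>)" for \<tau>
      unfolding G_def by (rule derivative_eq_intros primitive_deriv[OF f_continuous[OF x]] refl | simp)+
    have "0 \<le> G t"
    proof (cases t "0 :: real" rule: linorder_cases)
      case less
      obtain z where z: "t < z" "z < 0" "G 0 - G t = (0 - t) * (\<mu> * z - f x z)"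
        using MVT2[OF less, of G "\<lambda>\<tau>. \<mu> * \<tau> - f x \<tau>"] G by blast
      have "f x z / z \<le> \<mu>" using \<delta>(2)[OF x, of z] z True less by auto
      then have "\<mu> * z \<le> f x z" using z by (simp add: divide_le_eq)
      then have "(0 - t) * (\<mu> * z - f x z) \<le> 0" using less by (intro mult_nonneg_nonpos) auto
      then show ?thesis using z(3) by (simp add: G_def)
    next
      case greater
      obtain z where z: "0 < z" "z < t" "G t - G 0 = (t - 0) * (\<mu> * z - f x z)"
        using MVT2[OF greater, of G "\<lambda>\<tau>. \<mu> * \<tau> - f x \<tau>"] G by blast
      have "f x z / z \<le> \<mu>" using \<delta>(2)[OF x, of z] z True greater by auto
      then have "f x z \<le> \<mu> * z" using z by (simp add: divide_le_eq)
      then have "0 \<le> (t - 0) * (\<mu> * z - f x z)" using greater by (intro mult_nonneg_nonneg) auto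
      then show ?thesis using z(3) by (simp add: G_def)
    qed (simp add: G_def)
    then show ?thesis using C by (simp add: G_def add_increasing2)
  next
    case False
    have tp: "\<bar>t\<bar> powr (p - 1) * \<bar>t\<bar> = \<bar>t\<bar> powr p"
      using False \<delta> by (simp add: powr_mult_base mult.commute)
    have "1 \<le> \<delta> powr (1 - p) * \<bar>t\<bar> powr (p - 1)"
    proof -
      have "\<delta> powr (p - 1) \<le> \<bar>t\<bar> powr (p - 1)" using False \<delta> p by (intro powr_mono2) auto
      then have "\<delta> powr (1 - p) * \<delta> powr (p - 1) \<le> \<delta> powr (1 - p) * \<bar>t\<bar> powr (p - 1)" by (intro mult_left_mono) auto
      then show ?thesis using \<delta> by (simp flip: powr_add)
    qed
    then have "1 + \<bar>t\<bar> powr (p - 1) \<le> (\<delta> powr (1 - p) + 1) * \<bar>t\<bar> powr (p - 1)" by (simp add: algebra_simps)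
    then have "2 * c * (1 + \<bar>t\<bar> powr (p - 1)) * \<bar>t\<bar> \<le> 2 * c * ((\<delta> powr (1 - p) + 1) * \<bar>t\<bar> powr (p - 1)) * \<bar>t\<bar>"
      using c by (intro mult_right_mono mult_left_mono) auto
    also have "\<dots> = C * \<bar>t\<bar> powr p" by (simp add: C_def mult.assoc tp)
    finally have "primitive (f x) t \<le> C * \<bar>t\<bar> powr p" using primitive_f_bound[OF x order_refl, of t] by linarith
    then show ?thesis using \<mu> by (simp add: add_increasing)
  qed
  then show ?thesis using C by blast
qed

lemma Mh_lower: "0 \<le> t \<Longrightarrow> m0 * t \<le> primitive M t"
proof -
  assume t: "0 \<le> t"
  obtain x where "x \<in> {0..t}" "primitive M t = M x * t" using Mh_MVT[of 0 t] t by auto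
  then show ?thesis using M_ge[of x] t by (simp add: mult_right_mono)
qed

text \<open>The gap between lam and \<open>m0 * lam1\<close> leaves a positive multiple \<kappa> of
  the squared norm after the quadratic part of F is subtracted; the power p > 2 is negligible for
  small norms.\<close>

lemma ring_bound: "\<exists>\<rho> \<alpha>. 0 < \<rho> \<and> 0 < \<alpha> \<and> (\<forall>u\<in>X. \<rho> / 2 \<le> N u \<longrightarrow> N u \<le> \<rho> \<longrightarrow> \<alpha> \<le> J u)"
proof -
  \<comment> \<open>Strictly between lam and \<open>m0 * lam1\<close>; the maximum with 0 makes it
    positive even when lam is negative.\<close>
  define \<mu> where "\<mu> = (max lam 0 + m0 * lam1) / 2"
  have pos: "0 < m0 * lam1" using m0_pos lam1 by simp
  have mid: "lam < (max lam 0 + P) / 2 \<and> 0 < (max lam 0 + P) / 2 \<and> (max lam 0 + P) / 2 < P"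
    if "lam < P" "0 < P" for P :: real
    using that by (auto simp: max_def)
  have \<mu>: "lam < \<mu>" "0 < \<mu>" "\<mu> < m0 * lam1"
    unfolding \<mu>_def using mid[OF lam pos] by blast+
  obtain C where C: "C \<ge> 0" "\<And>x t. x \<in> closure \<Omega> \<Longrightarrow> primitive (f x) t \<le> \<mu> / 2 * t\<^sup>2 + C * \<bar>t\<bar> powr p"
    using F_upper[OF \<mu>(1,2)] by blast
  define \<kappa> where "\<kappa> = m0 - \<mu> / lam1"
  have \<kappa>: "\<kappa> > 0" using \<mu> lam1 by (simp add: \<kappa>_def field_simps)
  define C' where "C' = C * Sobolev_const + 1"
  have C': "C' > 0" "C * Sobolev_const \<le> C'" using C Sobolev_const by (auto simp: C'_def add_nonneg_pos)
  have J_ge: "\<kappa> / 2 * (N u)\<^sup>2 - C' * N u powr p \<le> J u" if u: "u \<in> X" for u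
  proof -
    have i2: "integrable lborel (\<lambda>x. (u x)\<^sup>2)" using X_sq[OF u] by (simp add: sq_integrable_def)
    have "Phi u \<le> (\<integral>x. \<mu> / 2 * (u x)\<^sup>2 + C * \<bar>u x\<bar> powr p \<partial>lborel)"
      unfolding Phi_def
    proof (rule integral_mono[OF int_Fe[OF u]])
      show "integrable lborel (\<lambda>x. \<mu> / 2 * (u x)\<^sup>2 + C * \<bar>u x\<bar> powr p)"
        using i2 integrable_powr[OF u] by auto
      show "Fe x (u x) \<le> \<mu> / 2 * (u x)\<^sup>2 + C * \<bar>u x\<bar> powr p" for x
        using C(2)[OF closure_\<Omega>, of x "u x"] C(1) \<mu> by (auto simp: Fe_def)
    qed
    also have "\<dots> = \<mu> / 2 * (L u)\<^sup>2 + C * (\<integral>x. \<bar>u x\<bar> powr p \<partial>lborel)"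
      using i2 integrable_powr[OF u] by (simp add: L_sq)
    also have "\<dots> \<le> \<mu> / 2 * ((N u)\<^sup>2 / lam1) + C * (Sobolev_const * N u powr p)"
      using lam1 u \<mu> C integral_powr_le[OF u] by (intro add_mono mult_left_mono) (auto simp: field_simps)
    also have "\<dots> \<le> \<mu> / 2 * ((N u)\<^sup>2 / lam1) + C' * N u powr p"
      using C'(2) by (simp add: mult.assoc[symmetric] mult_right_mono)
    finally have "Phi u \<le> \<mu> / 2 * ((N u)\<^sup>2 / lam1) + C' * N u powr p" .
    moreover have "m0 * (N u)\<^sup>2 \<le> primitive M ((N u)\<^sup>2)" by (rule Mh_lower) simp
    ultimately show ?thesis by (simp add: J_def \<kappa>_def algebra_simps diff_divide_distrib)
  qed
  \<comment> \<open>At this radius the term with the power p is exactly half of the quadratic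
    term.\<close>
  define \<rho> where "\<rho> = (\<kappa> / (4 * C')) powr (1 / (p - 2))"
  have \<rho>: "\<rho> > 0" using \<kappa> C' by (simp add: \<rho>_def)
  have \<rho>p: "\<rho> powr (p - 2) = \<kappa> / (4 * C')" using \<kappa> C' p by (simp add: \<rho>_def powr_powr)
  have "\<kappa> / 4 * (\<rho> / 2)\<^sup>2 \<le> J u" if u: "u \<in> X" "\<rho> / 2 \<le> N u" "N u \<le> \<rho>" for u
  proof -
    have Nu: "N u > 0" using u \<rho> by linarith
    have "N u powr p = N u powr (p - 2) * (N u)\<^sup>2"
    proof -
      have "(N u)\<^sup>2 = N u powr 2" using Nu by (simp add: powr_numeral)
      then show ?thesis by (simp flip: powr_add)
    qed
    moreover have "N u powr (p - 2) \<le> \<kappa> / (4 * C')"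
      unfolding \<rho>p[symmetric] using u Nu p by (intro powr_mono2) auto
    ultimately have "N u powr p \<le> \<kappa> / (4 * C') * (N u)\<^sup>2" by (simp only: mult_right_mono zero_le_power2)
    then have "C' * N u powr p \<le> C' * (\<kappa> / (4 * C') * (N u)\<^sup>2)" using C' by (intro mult_left_mono) auto
    also have "\<dots> = \<kappa> / 4 * (N u)\<^sup>2" using C' by simp
    finally have "\<kappa> / 4 * (N u)\<^sup>2 \<le> J u" using J_ge[OF u(1)] by linarith
    moreover have "\<kappa> / 4 * (\<rho> / 2)\<^sup>2 \<le> \<kappa> / 4 * (N u)\<^sup>2"
      using u \<rho> \<kappa> by (intro mult_left_mono power_mono) auto
    ultimately show ?thesis by linarith
  qed
  moreover have "0 < \<kappa> / 4 * (\<rho> / 2)\<^sup>2" using \<kappa> \<rho> by simp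
  ultimately show ?thesis using \<rho> by blast
qed

text \<open>By compactness F at \<open>t_star\<close> then has a positive minimum over x, which
  makes the lower bound in \<open>F_lower\<close> uniform.\<close>

lemma primitive_continuous_in_x: "continuous_on (closure \<Omega>) (\<lambda>x. primitive (f x) t_star)"
  unfolding continuous_on_iff
proof (intro ballI allI impI)
  fix x and \<epsilon> :: real assume x: "x \<in> closure \<Omega>" and e: "\<epsilon> > 0"
  obtain \<delta> where \<delta>: "\<delta> > 0" "\<And>x y a b. x \<in> closure \<Omega> \<Longrightarrow> y \<in> closure \<Omega> \<Longrightarrow> a \<in> {-t_star..t_star} \<Longrightarrow> b \<in> {-t_star..t_star} \<Longrightarrow>
      dist (x, a) (y, b) < \<delta> \<Longrightarrow> \<bar>f x a - f y b\<bar> < \<epsilon> / t_star"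
    using f_unif[of "\<epsilon> / t_star" t_star] e t_star by auto
  have "dist (primitive (f y) t_star) (primitive (f x) t_star) < \<epsilon>" if y: "y \<in> closure \<Omega>" "dist y x < \<delta>" for y
  proof -
    define G where "G \<tau> = primitive (f y) \<tau> - primitive (f x) \<tau>" for \<tau>
    have "(G has_real_derivative f y \<tau> - f x \<tau>) (at \<tau>)" for \<tau>
      unfolding G_def using x y by (intro DERIV_diff primitive_deriv f_continuous)
    then obtain z where z: "0 < z" "z < t_star" "G t_star - G 0 = (t_star - 0) * (f y z - f x z)"
      using MVT2[OF t_star, of G "\<lambda>\<tau>. f y \<tau> - f x \<tau>"] by blast
    have "\<bar>f y z - f x z\<bar> < \<epsilon> / t_star" using \<delta>(2)[OF y(1) x, of z z] z y by (simp add: dist_Pair_Pair)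
    then have "t_star * \<bar>f y z - f x z\<bar> < \<epsilon>" using t_star by (simp add: field_simps)
    then show ?thesis using z(3) t_star by (simp add: G_def dist_real_def abs_mult)
  qed
  then show "\<exists>d>0. \<forall>x'\<in>closure \<Omega>. dist x' x < d \<longrightarrow> dist (primitive (f x') t_star) (primitive (f x) t_star) < \<epsilon>"
    using \<delta>(1) by blast
qed

text \<open>The Ambrosetti-Rabinowitz condition says that F divided by the power \<theta> is
  nondecreasing beyond \<open>t_star\<close>; its value there is bounded below uniformly in
  x.\<close>

lemma F_lower: "\<exists>a>0. \<exists>b\<ge>0. \<forall>x\<in>closure \<Omega>. \<forall>t\<ge>0. a * t powr \<theta> - b \<le> primitive (f x) t"
proof -
  have "closure \<Omega> \<noteq> {}" using nonempty by simp
  then obtain x0 where x0: "x0 \<in> closure \<Omega>" "\<And>x. x \<in> closure \<Omega> \<Longrightarrow> primitive (f x0) t_star \<le> primitive (f x) t_star"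
    using continuous_attains_inf[OF compact_closure_\<Omega> _ primitive_continuous_in_x] by blast
  define a0 where "a0 = primitive (f x0) t_star"
  have a0: "a0 > 0" using AR[OF x0(1), of t_star] t_star \<theta> by (simp add: a0_def zero_less_mult_iff)
  \<comment> \<open>Normalised so that a times the power \<theta> of \<open>t_star\<close> is the
    minimum a0.\<close>
  define a where "a = a0 * t_star powr - \<theta>"
  have a: "a > 0" using a0 t_star by (simp add: a_def)
  define S where "S = 2 * c * (1 + t_star powr (p - 1)) * t_star"
  have S: "S \<ge> 0" using c t_star by (simp add: S_def)
  have "a * t powr \<theta> - (S + a0) \<le> primitive (f x) t" if x: "x \<in> closure \<Omega>" and t: "t \<ge> 0" for x t
  proof (cases "t_star \<le> t")
    case True
    have "primitive (f x) t_star * t_star powr - \<theta> \<le> primitive (f x) t * t powr - \<theta>"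
    proof (rule DERIV_nonneg_imp_nondecreasing[OF True])
      fix \<tau> assume \<tau>: "t_star \<le> \<tau>" "\<tau> \<le> t"
      then have \<tau>0: "\<tau> > 0" using t_star by linarith
      have "((\<lambda>\<tau>. primitive (f x) \<tau> * \<tau> powr - \<theta>) has_real_derivative
          f x \<tau> * \<tau> powr - \<theta> + (- \<theta> * \<tau> powr (- \<theta> - 1)) * primitive (f x) \<tau>) (at \<tau>)"
        using \<tau>0 by (intro DERIV_mult primitive_deriv f_continuous x has_real_derivative_powr)
      moreover have "f x \<tau> * \<tau> powr - \<theta> + (- \<theta> * \<tau> powr (- \<theta> - 1)) * primitive (f x) \<tau>
          = \<tau> powr (- \<theta> - 1) * (f x \<tau> * \<tau> - \<theta> * primitive (f x) \<tau>)"
      proof -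
        have "\<tau> powr - \<theta> = \<tau> powr (- \<theta> - 1) * \<tau>" using \<tau>0 by (simp add: powr_mult_base mult.commute)
        then show ?thesis by (simp add: algebra_simps)
      qed
      moreover have "0 \<le> f x \<tau> * \<tau> - \<theta> * primitive (f x) \<tau>" using AR[OF x, of \<tau>] \<tau> \<tau>0 by simp
      ultimately show "\<exists>y. ((\<lambda>\<tau>. primitive (f x) \<tau> * \<tau> powr - \<theta>) has_real_derivative y) (at \<tau>) \<and> 0 \<le> y"
        by (metis mult_nonneg_nonneg powr_ge_zero)
    qed
    moreover have "a \<le> primitive (f x) t_star * t_star powr - \<theta>"
      unfolding a_def a0_def using x0(2)[OF x] by (intro mult_right_mono) auto
    ultimately have "a * t powr \<theta> \<le> primitive (f x) t * t powr - \<theta> * t powr \<theta>" by (intro mult_right_mono) auto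
    also have "\<dots> = primitive (f x) t" using True t_star by (simp add: mult.assoc flip: powr_add)
    finally show ?thesis using S a0 by linarith
  next
    case False
    have "\<bar>primitive (f x) t\<bar> \<le> 2 * c * (1 + t_star powr (p - 1)) * \<bar>t\<bar>"
      using False t by (intro primitive_f_bound x) auto
    also have "\<dots> \<le> S" unfolding S_def using False t c by (intro mult_left_mono) auto
    finally have "- S \<le> primitive (f x) t" by linarith
    moreover have "a * t powr \<theta> \<le> a * t_star powr \<theta>" using False t a \<theta> by (intro mult_left_mono powr_mono2) auto
    moreover have "a * t_star powr \<theta> = a0" using t_star by (simp add: a_def mult.assoc flip: powr_add)
    ultimately show ?thesis by linarith
  qed
  then show ?thesis using a S a0 by (intro exI[of _ a] conjI exI[of _ "S + a0"]) auto
qed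

text \<open>Below \<open>t_star\<close> both sides are bounded, so the Ambrosetti-Rabinowitz
  inequality holds everywhere up to a constant.\<close>

lemma AR_lower: "\<exists>b\<ge>0. \<forall>x\<in>closure \<Omega>. \<forall>t. \<theta> * primitive (f x) t - b \<le> f x t * t"
proof -
  define S where "S = 2 * c * (1 + t_star powr (p - 1)) * t_star"
  have S: "S \<ge> 0" using c t_star by (simp add: S_def)
  have "\<theta> * primitive (f x) t - (S + \<theta> * S) \<le> f x t * t" if x: "x \<in> closure \<Omega>" for x t
  proof (cases "t_star \<le> \<bar>t\<bar>")
    case True
    have "0 \<le> S + \<theta> * S" using S \<theta> by simp
    then show ?thesis using AR[OF x True] by linarith
  next
    case False
    have "\<bar>primitive (f x) t\<bar> \<le> 2 * c * (1 + t_star powr (p - 1)) * \<bar>t\<bar>"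
      using False by (intro primitive_f_bound x) auto
    also have "\<dots> \<le> S" unfolding S_def using False c by (intro mult_left_mono) auto
    finally have "\<theta> * primitive (f x) t \<le> \<theta> * S" using \<theta> by (intro mult_left_mono) auto
    moreover have "\<bar>f x t * t\<bar> \<le> S"
      unfolding abs_mult S_def using False c growth_p[OF x, of t t_star] by (intro mult_mono) auto
    ultimately show ?thesis by linarith
  qed
  then show ?thesis using S \<theta> by (intro exI[of _ "S + \<theta> * S"]) auto
qed

text \<open>Hypothesis (ii) says that the primitive of M divided by t has a nonpositive derivative
  beyond \<open>t0\<close>.\<close>

lemma Mh_upper: "\<exists>C\<ge>0. \<forall>t\<ge>0. primitive M t \<le> C * (1 + t)"
proof -
  \<comment> \<open>At least 1, because t0 may be 0 and the quotient is taken at t1.\<close>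
  define t1 where "t1 = max t0 1"
  have t1: "t1 \<ge> 1" "t1 \<ge> t0" by (auto simp: t1_def)
  define C where "C = primitive M t1"
  have C: "C \<ge> 0" using Mh_lower[of t1] m0_pos t1 by (simp add: C_def) (smt (verit) mult_nonneg_nonneg)
  have "primitive M t \<le> C * (1 + t)" if t: "t \<ge> 0" for t
  proof (cases "t \<le> t1")
    case True
    obtain x where "x \<in> {t..t1}" "C - primitive M t = M x * (t1 - t)"
      using Mh_MVT[OF t True] by (auto simp: C_def)
    moreover from this have "0 \<le> M x * (t1 - t)" using M_ge[of x] m0_pos True t by (intro mult_nonneg_nonneg) auto
    ultimately have "primitive M t \<le> C" by linarith
    also have "\<dots> \<le> C * (1 + t)" using mult_left_mono[of 1 "1 + t" C] C t by simp
    finally show ?thesis .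
  next
    case False
    have "- (primitive Mx t1 / t1) \<le> - (primitive Mx t / t)"
    proof (rule DERIV_nonneg_imp_nondecreasing[of t1 t "\<lambda>\<tau>. - (primitive Mx \<tau> / \<tau>)"])
      fix \<tau> assume \<tau>: "t1 \<le> \<tau>" "\<tau> \<le> t"
      then have \<tau>0: "\<tau> > 0" using t1 by linarith
      have "((\<lambda>\<tau>. - (primitive Mx \<tau> / \<tau>)) has_real_derivative - ((Mx \<tau> * \<tau> - primitive Mx \<tau> * 1) / (\<tau> * \<tau>))) (at \<tau>)"
        using \<tau>0 by (intro DERIV_minus DERIV_divide primitive_deriv Mx_continuous DERIV_ident) auto
      moreover have "Mx \<tau> * \<tau> \<le> primitive Mx \<tau>"
        using t0(2)[of \<tau>] \<tau> t1 \<tau>0 by (simp add: Mx_def primitive_Mx mult.commute)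
      ultimately show "\<exists>y. ((\<lambda>\<tau>. - (primitive Mx \<tau> / \<tau>)) has_real_derivative y) (at \<tau>) \<and> 0 \<le> y"
        using \<tau>0 by (intro exI conjI) (auto simp: divide_nonpos_pos)
    qed (use False in simp)
    then have "primitive M t / t \<le> C / t1" using t t1 by (simp add: primitive_Mx C_def)
    also have "\<dots> \<le> C" using C t1 by (simp add: divide_le_eq mult_le_cancel_left1)
    finally have "primitive M t \<le> C * t" using False t1 by (simp add: divide_le_eq)
    also have "\<dots> \<le> C * (1 + t)" using C by (intro mult_left_mono) auto
    finally show ?thesis .
  qed
  then show ?thesis using C by blast
qed

lemma ray_bound: "\<exists>w\<in>X. N w > 0 \<and> (\<exists>C. \<forall>t\<ge>0. J (t *\<^sub>R w) \<le> C)"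
proof -
  obtain w where w: "w \<in> X" "\<And>x. 0 \<le> w x" "\<And>x. w x \<le> 1" "N w > 0" "L w > 0"
    using bump_exists[OF nonempty] by blast
  have [measurable]: "w \<in> borel_measurable borel" using w by (intro X_measurable)
  obtain a b where ab: "a > 0" "b \<ge> 0" "\<And>x t. x \<in> closure \<Omega> \<Longrightarrow> t \<ge> 0 \<Longrightarrow> a * t powr \<theta> - b \<le> primitive (f x) t"
    using F_lower by blast
  obtain C1 where C1: "C1 \<ge> 0" "\<And>t. t \<ge> 0 \<Longrightarrow> primitive M t \<le> C1 * (1 + t)" using Mh_upper by blast
  have i2: "integrable lborel (\<lambda>x. (w x)\<^sup>2)" using X_sq[OF w(1)] by (simp add: sq_integrable_def)
  \<comment> \<open>Values in the unit interval and \<theta> > 2 give integrability of the power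
    \<theta> from that of the square.\<close>
  have w_le: "w x powr \<theta> \<le> (w x)\<^sup>2" for x
  proof (cases "w x = 0")
    case False
    then have "w x > 0" using w(2)[of x] by linarith
    moreover from this have "w x powr \<theta> \<le> w x powr 2" using w(3)[of x] \<theta> by (intro powr_mono') auto
    ultimately show ?thesis by (simp add: powr_numeral)
  qed simp
  have iw: "integrable lborel (\<lambda>x. w x powr \<theta>)"
    by (rule Bochner_Integration.integrable_bound[OF i2]) (use w_le in auto)
  define W where "W = (\<integral>x. w x powr \<theta> \<partial>lborel)"
  have "W \<noteq> 0"
  proof
    assume "W = 0"
    then have "AE x in lborel. w x powr \<theta> = 0"
      using integral_nonneg_eq_0_iff_AE[OF iw] by (simp add: W_def)
    then have "AE x in lborel. w x = 0" by eventually_elim simp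
    then show False using w(5) L_zero_iff_AE[OF w(1)] by simp
  qed
  moreover have "0 \<le> W" unfolding W_def by (rule Bochner_Integration.integral_nonneg) simp
  ultimately have W: "W > 0" by linarith
  obtain C where C: "\<And>t. t \<ge> 0 \<Longrightarrow> (C1 * (N w)\<^sup>2 / 2) * t\<^sup>2 - (a * W) * t powr \<theta> \<le> C"
    using power_dominates[of "C1 * (N w)\<^sup>2 / 2" "a * W" \<theta>] C1 ab W \<theta> by auto
  have "J (t *\<^sub>R w) \<le> C1 / 2 + b * m\<Omega> + C" if t: "t \<ge> 0" for t
  proof -
    have tw: "t *\<^sub>R w \<in> X" using w by simp
    have "a * t powr \<theta> * W - b * m\<Omega> = (\<integral>x. a * t powr \<theta> * w x powr \<theta> - b * one\<Omega> x \<partial>lborel)"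
      using iw one\<Omega>_integrable by (simp add: W_def) (simp add: one\<Omega>_def m\<Omega>_def)
    also have "\<dots> \<le> Phi (t *\<^sub>R w)"
      unfolding Phi_def
    proof (rule integral_mono)
      show "integrable lborel (\<lambda>x. a * t powr \<theta> * w x powr \<theta> - b * one\<Omega> x)"
        using iw one\<Omega>_integrable by auto
      show "integrable lborel (\<lambda>x. Fe x ((t *\<^sub>R w) x))" by (rule int_Fe[OF tw])
      show "a * t powr \<theta> * w x powr \<theta> - b * one\<Omega> x \<le> Fe x ((t *\<^sub>R w) x)" for x
      proof (cases "x \<in> \<Omega>")
        case True
        then show ?thesis using ab(3)[OF closure_\<Omega>[OF True], of "t * w x"] t w(2)[of x]
          by (simp add: Fe_def one\<Omega>_def powr_mult mult.assoc)
      next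
        case False
        then show ?thesis using X_outside[OF w(1) False] by (simp add: Fe_def one\<Omega>_def)
      qed
    qed
    finally have "a * t powr \<theta> * W - b * m\<Omega> \<le> Phi (t *\<^sub>R w)" .
    moreover have "primitive M ((N (t *\<^sub>R w))\<^sup>2) \<le> C1 * (1 + t\<^sup>2 * (N w)\<^sup>2)"
      using C1(2)[of "(N (t *\<^sub>R w))\<^sup>2"] w(1) by (simp add: N_scale power_mult_distrib)
    ultimately have "J (t *\<^sub>R w) \<le> C1 * (1 + t\<^sup>2 * (N w)\<^sup>2) / 2 - (a * t powr \<theta> * W - b * m\<Omega>)"
      unfolding J_def by linarith
    also have "\<dots> = C1 / 2 + b * m\<Omega> + ((C1 * (N w)\<^sup>2 / 2) * t\<^sup>2 - (a * W) * t powr \<theta>)"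
      by (simp add: algebra_simps add_divide_distrib)
    also have "\<dots> \<le> C1 / 2 + b * m\<Omega> + C" using C[OF t] by simp
    finally show ?thesis .
  qed
  then show ?thesis using w(1,4) by blast
qed

text \<open>The level bound controls \<theta>/2 times the primitive of M by the nonlinear part. One
  copy of that primitive dominates \<open>M ((N u)\<^sup>2) * (N u)\<^sup>2\<close> by (ii); the
  remaining factor \<theta>/2 - 1 is positive and for large norms pays for all constants.\<close>

lemma outer_bound:
  "\<exists>R0. \<forall>u\<in>X. R0 \<le> N u \<longrightarrow> J u \<le> C \<longrightarrow> M ((N u)\<^sup>2) * (N u)\<^sup>2 \<le> Du u u"
proof -
  obtain b where b: "b \<ge> 0" "\<And>x t. x \<in> closure \<Omega> \<Longrightarrow> \<theta> * primitive (f x) t - b \<le> f x t * t"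
    using AR_lower by blast
  define d where "d = (\<theta> / 2 - 1) * m0"
  have d: "d > 0" using \<theta> m0_pos by (simp add: d_def)
  \<comment> \<open>Threshold for the squared norm beyond which d times it exceeds the constants
    from the level and from \<open>AR_lower\<close>.\<close>
  define Z where "Z = max 0 ((\<theta> * C + b * m\<Omega>) / d)"
  define R0 where "R0 = sqrt (max t0 Z)"
  have "M ((N u)\<^sup>2) * (N u)\<^sup>2 \<le> Du u u" if u: "u \<in> X" "R0 \<le> N u" "J u \<le> C" for u
  proof -
    have "(sqrt (max t0 Z))\<^sup>2 \<le> (N u)\<^sup>2" using u t0 by (intro power_mono) (auto simp: R0_def)
    then have big: "t0 \<le> (N u)\<^sup>2" "Z \<le> (N u)\<^sup>2" using t0 by auto
    have "(\<theta> * C + b * m\<Omega>) / d \<le> (N u)\<^sup>2" using big(2) by (simp add: Z_def)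
    then have Z: "\<theta> * C + b * m\<Omega> \<le> d * (N u)\<^sup>2" using d by (simp add: field_simps)
    have "\<theta> * Phi u - b * m\<Omega> = (\<integral>x. \<theta> * Fe x (u x) - b * one\<Omega> x \<partial>lborel)"
      using int_Fe[OF u(1)] one\<Omega>_integrable by (simp add: Phi_def) (simp add: one\<Omega>_def m\<Omega>_def)
    also have "\<dots> \<le> Du u u"
      unfolding Du_def
    proof (rule integral_mono)
      show "integrable lborel (\<lambda>x. \<theta> * Fe x (u x) - b * one\<Omega> x)" using int_Fe[OF u(1)] one\<Omega>_integrable by auto
      show "integrable lborel (\<lambda>x. fe x (u x) * u x)" by (rule int_fe[OF u(1,1)])
      show "\<theta> * Fe x (u x) - b * one\<Omega> x \<le> fe x (u x) * u x" for x
        using b(2)[OF closure_\<Omega>, of x "u x"] by (auto simp: Fe_def fe_def one\<Omega>_def)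
    qed
    finally have 1: "\<theta> * Phi u - b * m\<Omega> \<le> Du u u" .
    have "\<theta> * J u \<le> \<theta> * C" using u \<theta> by (intro mult_left_mono) auto
    then have 2: "\<theta> / 2 * primitive M ((N u)\<^sup>2) - \<theta> * C \<le> \<theta> * Phi u"
      by (simp add: J_def algebra_simps)
    have "(\<theta> / 2 - 1) * (m0 * (N u)\<^sup>2) \<le> (\<theta> / 2 - 1) * primitive M ((N u)\<^sup>2)"
      using \<theta> Mh_lower[of "(N u)\<^sup>2"] by (intro mult_left_mono) auto
    then have 3: "d * (N u)\<^sup>2 + primitive M ((N u)\<^sup>2) \<le> \<theta> / 2 * primitive M ((N u)\<^sup>2)"
      by (simp add: d_def algebra_simps)
    have 4: "M ((N u)\<^sup>2) * (N u)\<^sup>2 \<le> primitive M ((N u)\<^sup>2)" using t0(2)[OF big(1)] by (simp add: mult.commute)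
    show ?thesis using 1 2 3 4 Z by linarith
  qed
  then show ?thesis by blast
qed

theorem solution_exists: "\<exists>u\<in>X. N u > 0 \<and> (\<forall>a\<in>X. M ((N u)\<^sup>2) * B u a = Du u a)"
proof -
  obtain \<rho> \<alpha> where ring: "0 < \<rho>" "0 < \<alpha>" "\<And>u. u \<in> X \<Longrightarrow> \<rho> / 2 \<le> N u \<Longrightarrow> N u \<le> \<rho> \<Longrightarrow> \<alpha> \<le> J u"
    using ring_bound by blast
  obtain w C where ray: "w \<in> X" "N w > 0" "\<And>t. 0 \<le> t \<Longrightarrow> J (t *\<^sub>R w) \<le> C" using ray_bound by blast
  obtain R0 where R0: "\<And>u. u \<in> X \<Longrightarrow> R0 \<le> N u \<Longrightarrow> J u \<le> C + 1 \<Longrightarrow> M ((N u)\<^sup>2) * (N u)\<^sup>2 \<le> Du u u"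
    using outer_bound[of "C + 1"] by blast
  show ?thesis
  proof (rule critical_point[of "\<rho> / 2" \<rho> "max \<rho> R0" \<alpha>, OF _ _ _ ring(2,3) ray])
    show "M ((N u)\<^sup>2) * (N u)\<^sup>2 \<le> Du u u" if "u \<in> X" "max \<rho> R0 \<le> N u" "J u \<le> C + 1" for u
      using R0 that by simp
  qed (use ring in auto)
qed

end

section \<open>Weak solutions\<close>

lemma AE_lebesgue_iff: "(AE x in lebesgue. P x) \<longleftrightarrow> (AE x in lborel. P x)"
  by (rule AE_completion_iff)

lemma borel_measurable_lebesgueI: "f \<in> borel_measurable borel \<Longrightarrow> f \<in> borel_measurable lebesgue"
  by (rule measurable_completion) simp

context gagliardo_space
begin

lemma L2_lebesgue_iff:
  assumes "g \<in> borel_measurable lebesgue" "g' \<in> borel_measurable borel" "AE x in lebesgue. g x = g' x"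
  shows "g \<in> L2 \<longleftrightarrow> g' \<in> sq_integrable lborel"
proof -
  have "integrable lebesgue (\<lambda>x. (g x)\<^sup>2) \<longleftrightarrow> integrable lebesgue (\<lambda>x. (g' x)\<^sup>2)"
    using assms borel_measurable_lebesgueI[OF assms(2)] by (intro integrable_cong_AE) auto
  also have "\<dots> \<longleftrightarrow> integrable lborel (\<lambda>x. (g' x)\<^sup>2)"
    using assms(2) by (intro integrable_completion) simp
  finally show ?thesis using assms by (simp add: L2_def sq_integrable_def)
qed

lemma Hs_iff: "u \<in> Hs s \<longleftrightarrow> u \<in> L2 \<and> diff_quot u \<in> L2"
  by (simp add: Hs_def diff_quot_def)

lemma AE_diff_quot_eq:
  assumes "AE x in lborel. u x = u' x"
  shows "AE p in lborel. diff_quot u p = diff_quot u' p"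
  using AE_prod_lborel[OF assms] by eventually_elim (simp add: diff_quot_def case_prod_beta)

lemma X_subset_X0:
  assumes u: "u \<in> X"
  shows "u \<in> X0 s \<Omega>"
proof -
  have "u \<in> L2"
    using L2_lebesgue_iff[of u u] borel_measurable_lebesgueI[OF X_measurable[OF u]] X_measurable[OF u] X_sq[OF u] by simp
  moreover have "diff_quot u \<in> L2"
    using X_measurable[OF u] X_diff_quot[OF u] diff_quot_measurable[OF X_measurable[OF u]]
    by (simp add: L2_def sq_integrable_def borel_measurable_lebesgueI integrable_completion)
  ultimately show ?thesis using X_outside[OF u] by (simp add: X0_def Hs_iff)
qed

text \<open>A Borel version exists almost everywhere; multiplying it by the indicator of \<Omega>
  makes it vanish at every outside point and changes it only on a null set.\<close>

lemma X0_representative: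
  assumes \<phi>: "\<phi> \<in> X0 s \<Omega>"
  shows "\<exists>\<phi>'\<in>X. AE x in lborel. \<phi> x = \<phi>' x"
proof -
  have m: "\<phi> \<in> borel_measurable lebesgue" "diff_quot \<phi> \<in> borel_measurable lebesgue"
    and L2: "\<phi> \<in> L2" "diff_quot \<phi> \<in> L2" and out: "AE x in lborel. x \<notin> \<Omega> \<longrightarrow> \<phi> x = 0"
    using \<phi> by (auto simp: X0_def Hs_iff L2_def AE_lebesgue_iff)
  obtain g where g: "g \<in> borel_measurable lborel" "AE x in lborel. \<phi> x = g x"
    using completion_ex_borel_measurable_real[OF m(1)] by blast
  define \<phi>' where "\<phi>' x = indicator \<Omega> x * g x" for x
  have gm: "g \<in> borel_measurable borel" using g(1) by simp
  have \<phi>'m: "\<phi>' \<in> borel_measurable borel"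
    unfolding \<phi>'_def by (intro borel_measurable_times gm borel_measurable_indicator \<Omega>_borel)
  have eq: "AE x in lborel. \<phi> x = \<phi>' x"
    using g(2) out by eventually_elim (auto simp: \<phi>'_def split: split_indicator)
  have "\<phi>' \<in> sq_integrable lborel"
    using L2_lebesgue_iff[OF m(1) \<phi>'m] eq L2(1) by (simp add: AE_lebesgue_iff)
  moreover have "diff_quot \<phi>' \<in> sq_integrable lborel"
  proof -
    have "integrable lebesgue (\<lambda>p. (diff_quot \<phi> p)\<^sup>2) \<longleftrightarrow> integrable lebesgue (\<lambda>p. (diff_quot \<phi>' p)\<^sup>2)"
    proof (rule integrable_cong_AE)
      show "(\<lambda>p. (diff_quot \<phi> p)\<^sup>2) \<in> borel_measurable lebesgue" using m(2) by simp
      show "(\<lambda>p. (diff_quot \<phi>' p)\<^sup>2) \<in> borel_measurable lebesgue"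
        using borel_measurable_lebesgueI[OF diff_quot_measurable[OF \<phi>'m]] by simp
      show "AE p in lebesgue. (diff_quot \<phi> p)\<^sup>2 = (diff_quot \<phi>' p)\<^sup>2"
        unfolding AE_lebesgue_iff using AE_diff_quot_eq[OF eq] by eventually_elim simp
    qed
    then show ?thesis
      using L2(2) diff_quot_measurable[OF \<phi>'m] by (simp add: L2_def sq_integrable_def integrable_completion)
  qed
  moreover have "\<phi>' x = 0" if "x \<notin> \<Omega>" for x using that by (simp add: \<phi>'_def)
  ultimately have "\<phi>' \<in> X" using \<phi>'m by (simp add: X_def)
  then show ?thesis using eq by blast
qed

lemma Q_region_borel: "Q_region \<Omega> \<in> sets borel"
proof -
  have "(UNIV - \<Omega>) \<times> (UNIV - \<Omega>) \<in> sets borel"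
    using open_\<Omega> by (intro borel_closed closed_Times) (auto simp: Compl_eq_Diff_UNIV[symmetric])
  then show ?thesis unfolding Q_region_def by (intro sets.Diff) auto
qed

lemma AE_outside_Q:
  assumes "u \<in> X0 s \<Omega>"
  shows "AE p in lborel. p \<notin> Q_region \<Omega> \<longrightarrow> diff_quot u p = 0"
proof -
  have "AE x in lborel. x \<notin> \<Omega> \<longrightarrow> u x = 0" using assms by (simp add: X0_def AE_lebesgue_iff)
  from AE_prod_lborel[OF this] show ?thesis
    by eventually_elim (auto simp: Q_region_def diff_quot_def)
qed

text \<open>Off the region Q both points lie outside \<Omega>, so the quotient of u vanishes there
  almost everywhere and the integral may be extended to all pairs.\<close>

lemma gagliardo_eq:
  assumes u: "u \<in> X0 s \<Omega>" and \<phi>: "\<phi> \<in> X0 s \<Omega>"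
    and u': "u' \<in> X" "AE x in lborel. u x = u' x" and \<phi>': "\<phi>' \<in> X" "AE x in lborel. \<phi> x = \<phi>' x"
  shows "gagliardo s \<Omega> u \<phi> = B u' \<phi>'"
proof -
  have m: "diff_quot u \<in> borel_measurable lebesgue" "diff_quot \<phi> \<in> borel_measurable lebesgue"
    using u \<phi> by (auto simp: X0_def Hs_iff L2_def)
  have m': "diff_quot u' \<in> borel_measurable borel" "diff_quot \<phi>' \<in> borel_measurable borel"
    using u'(1) \<phi>'(1) by (auto intro: diff_quot_measurable X_measurable)
  have prod: "(u x - u y) * (\<phi> x - \<phi> y) / norm (x - y) powr (real CARD('n) + 2 * s) = diff_quot u (x, y) * diff_quot \<phi> (x, y)" for x y
    by (simp add: diff_quot_def flip: powr_add)
  have "gagliardo s \<Omega> u \<phi> = (\<integral>p. indicator (Q_region \<Omega>) p * (diff_quot u p * diff_quot \<phi> p) \<partial>lebesgue)"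
    unfolding gagliardo_def set_lebesgue_integral_def prod by (simp add: case_prod_beta)
  also have "\<dots> = (\<integral>p. diff_quot u' p * diff_quot \<phi>' p \<partial>lebesgue)"
  proof (rule integral_cong_AE)
    show "(\<lambda>p. indicator (Q_region \<Omega>) p * (diff_quot u p * diff_quot \<phi> p)) \<in> borel_measurable lebesgue"
      using m borel_measurable_lebesgueI[OF borel_measurable_indicator[OF Q_region_borel]]
      by (intro borel_measurable_times) auto
    show "(\<lambda>p. diff_quot u' p * diff_quot \<phi>' p) \<in> borel_measurable lebesgue"
      using m' by (intro borel_measurable_lebesgueI borel_measurable_times)
    show "AE p in lebesgue. indicator (Q_region \<Omega>) p * (diff_quot u p * diff_quot \<phi> p) = diff_quot u' p * diff_quot \<phi>' p"
      unfolding AE_lebesgue_iff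
      using AE_diff_quot_eq[OF u'(2)] AE_diff_quot_eq[OF \<phi>'(2)] AE_outside_Q[OF u]
      by eventually_elim (auto split: split_indicator)
  qed
  also have "\<dots> = B u' \<phi>'"
    unfolding B_def using m' by (intro integral_completion borel_measurable_times) auto
  finally show ?thesis .
qed

lemma gagliardo_energy_eq:
  assumes "u \<in> X0 s \<Omega>" "u' \<in> X" "AE x in lborel. u x = u' x"
  shows "gagliardo_energy s \<Omega> u = (N u')\<^sup>2"
proof -
  have "gagliardo_energy s \<Omega> u = gagliardo s \<Omega> u u"
    by (simp add: gagliardo_energy_def gagliardo_def power2_eq_square)
  then show ?thesis using gagliardo_eq[OF assms(1,1,2,3,2,3)] assms(2) by (simp add: N_sq)
qed

lemma L_sq_eq:
  assumes "u \<in> X0 s \<Omega>" "u' \<in> X" "AE x in lborel. u x = u' x"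
  shows "(LINT x:\<Omega>|lebesgue. \<bar>u x\<bar>\<^sup>2) = (L u')\<^sup>2"
proof -
  have m: "u \<in> borel_measurable lebesgue" using assms(1) by (auto simp: X0_def Hs_def L2_def)
  have "(LINT x:\<Omega>|lebesgue. \<bar>u x\<bar>\<^sup>2) = (\<integral>x. (u' x)\<^sup>2 \<partial>lebesgue)"
    unfolding set_lebesgue_integral_def
  proof (rule integral_cong_AE)
    show "(\<lambda>x. indicator \<Omega> x *\<^sub>R \<bar>u x\<bar>\<^sup>2) \<in> borel_measurable lebesgue"
      using m borel_measurable_lebesgueI[OF borel_measurable_indicator[OF \<Omega>_borel]]
      by (intro borel_measurable_scaleR) auto
    show "(\<lambda>x. (u' x)\<^sup>2) \<in> borel_measurable lebesgue"
      using X_measurable[OF assms(2)] by (intro borel_measurable_lebesgueI) simp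
    show "AE x in lebesgue. indicator \<Omega> x *\<^sub>R \<bar>u x\<bar>\<^sup>2 = (u' x)\<^sup>2"
      unfolding AE_lebesgue_iff using assms(3)
      by eventually_elim (use X_outside[OF assms(2)] in \<open>auto split: split_indicator\<close>)
  qed
  also have "\<dots> = (L u')\<^sup>2"
    unfolding L_sq using X_measurable[OF assms(2)] by (intro integral_completion) simp
  finally show ?thesis .
qed

text \<open>The minimiser attains the least quotient, so \<open>LEAST\<close> denotes a genuine
  minimum; other quotients are compared through Borel representatives.\<close>

lemma lambda1:
  assumes "\<Omega> \<noteq> {}"
  shows lambda1_pos: "0 < lambda1 s \<Omega>"
    and lambda1_le: "u \<in> X \<Longrightarrow> lambda1 s \<Omega> * (L u)\<^sup>2 \<le> (N u)\<^sup>2"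
proof -
  obtain v where v: "v \<in> X" "L v = 1" "\<And>u. u \<in> X \<Longrightarrow> (N v)\<^sup>2 * (L u)\<^sup>2 \<le> (N u)\<^sup>2"
    using first_eigenvalue[OF assms] by blast
  have eq: "lambda1 s \<Omega> = (N v)\<^sup>2"
    unfolding lambda1_def
  proof (rule Least_equality)
    have "gagliardo_energy s \<Omega> v / (LINT x:\<Omega>|lebesgue. \<bar>v x\<bar>\<^sup>2) = (N v)\<^sup>2"
      using gagliardo_energy_eq[of v v] L_sq_eq[of v v] v X_subset_X0[OF v(1)] by simp
    moreover have "\<not> (AE x in lebesgue. v x = 0)"
      using L_zero_iff_AE[OF v(1)] v(2) by (simp add: AE_lebesgue_iff)
    ultimately show "(N v)\<^sup>2 \<in> {gagliardo_energy s \<Omega> u / (LINT x:\<Omega>|lebesgue. \<bar>u x\<bar>\<^sup>2) | u.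
        u \<in> X0 s \<Omega> \<and> \<not> (AE x in lebesgue. u x = 0)}"
      using X_subset_X0[OF v(1)] by force
  next
    fix r assume "r \<in> {gagliardo_energy s \<Omega> u / (LINT x:\<Omega>|lebesgue. \<bar>u x\<bar>\<^sup>2) | u.
        u \<in> X0 s \<Omega> \<and> \<not> (AE x in lebesgue. u x = 0)}"
    then obtain u where u: "u \<in> X0 s \<Omega>" "\<not> (AE x in lborel. u x = 0)"
      and r: "r = gagliardo_energy s \<Omega> u / (LINT x:\<Omega>|lebesgue. \<bar>u x\<bar>\<^sup>2)"
      by (auto simp: AE_lebesgue_iff)
    obtain u' where u': "u' \<in> X" "AE x in lborel. u x = u' x" using X0_representative[OF u(1)] by blast
    have "L u' \<noteq> 0"
    proof
      assume "L u' = 0"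
      then have "AE x in lborel. u' x = 0" using L_zero_iff_AE[OF u'(1)] by simp
      with u'(2) have "AE x in lborel. u x = 0" by eventually_elim simp
      then show False using u(2) by simp
    qed
    then have "0 < (L u')\<^sup>2" by simp
    moreover have "r = (N u')\<^sup>2 / (L u')\<^sup>2"
      using r gagliardo_energy_eq[OF u(1) u'] L_sq_eq[OF u(1) u'] by simp
    ultimately show "(N v)\<^sup>2 \<le> r" using v(3)[OF u'(1)] by (simp add: le_divide_eq)
  qed
  have "N v \<noteq> 0" using Poincare_const(2)[OF v(1)] v(2) by auto
  then show "0 < lambda1 s \<Omega>" by (simp add: eq)
  show "u \<in> X \<Longrightarrow> lambda1 s \<Omega> * (L u)\<^sup>2 \<le> (N u)\<^sup>2" using v(3) by (simp add: eq)
qed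

end

context subcritical
begin

lemma weak_form_rhs:
  assumes u: "u \<in> X" and \<phi>: "\<phi> \<in> X0 s \<Omega>" and \<phi>': "\<phi>' \<in> X" "AE x in lborel. \<phi> x = \<phi>' x"
  shows "set_integrable lebesgue \<Omega> (\<lambda>x. f x (u x) * \<phi> x)"
    and "(LINT x:\<Omega>|lebesgue. f x (u x) * \<phi> x) = Du u \<phi>'"
proof -
  have fm: "(\<lambda>x. fe x (u x)) \<in> borel_measurable borel"
    using X_measurable[OF u] by (intro fe_measurable) auto
  have m: "\<phi> \<in> borel_measurable lebesgue" using \<phi> by (auto simp: X0_def Hs_def L2_def)
  have eq: "(\<lambda>x. indicator \<Omega> x *\<^sub>R (f x (u x) * \<phi> x)) = (\<lambda>x. fe x (u x) * \<phi> x)"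
    by (auto simp: fun_eq_iff fe_def split: split_indicator)
  have m1: "(\<lambda>x. fe x (u x) * \<phi> x) \<in> borel_measurable lebesgue"
    using m borel_measurable_lebesgueI[OF fm] by (intro borel_measurable_times)
  have b: "(\<lambda>x. fe x (u x) * \<phi>' x) \<in> borel_measurable borel"
    using fm X_measurable[OF \<phi>'(1)] by (intro borel_measurable_times)
  note m2 = borel_measurable_lebesgueI[OF b]
  have ae: "AE x in lebesgue. fe x (u x) * \<phi> x = fe x (u x) * \<phi>' x"
    unfolding AE_lebesgue_iff using \<phi>'(2) by eventually_elim simp
  have "integrable lebesgue (\<lambda>x. fe x (u x) * \<phi>' x)"
    using int_fe[OF u \<phi>'(1)] b by (simp add: integrable_completion)
  then show "set_integrable lebesgue \<Omega> (\<lambda>x. f x (u x) * \<phi> x)"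
    unfolding set_integrable_def eq using integrable_cong_AE[OF m1 m2 ae] by simp
  have "(LINT x:\<Omega>|lebesgue. f x (u x) * \<phi> x) = (\<integral>x. fe x (u x) * \<phi>' x \<partial>lebesgue)"
    unfolding set_lebesgue_integral_def eq by (rule integral_cong_AE[OF m1 m2 ae])
  also have "\<dots> = Du u \<phi>'" unfolding Du_def using b by (intro integral_completion) simp
  finally show "(LINT x:\<Omega>|lebesgue. f x (u x) * \<phi> x) = Du u \<phi>'" .
qed

end

theorem theorem2:
  fixes s m\<^sub>0 t\<^sub>0 c q t_star \<theta> lam :: real
    and \<Omega> :: "(real ^ 'n) set"
    and M :: "real \<Rightarrow> real"
    and f :: "(real ^ 'n) \<Rightarrow> real \<Rightarrow> real"
  assumes "0 < s" "s < 1" "s < real CARD('n) / 2"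
    and "bounded_smooth_domain \<Omega>"
    and "M ` {0..} \<subseteq> {0..}" "continuous_on {0..} M"
    and "0 < m\<^sub>0" "\<And>t. t \<ge> 0 \<Longrightarrow> m\<^sub>0 \<le> M t"
    and "t\<^sub>0 \<ge> 0" "\<And>t. t \<ge> t\<^sub>0 \<Longrightarrow> primitive M t \<ge> t * M t"
    and "continuous_on (closure \<Omega> \<times> UNIV) (\<lambda>(x, t). f x t)"
    and "c > 0" "2 < q" "q < 2 * real CARD('n) / (real CARD('n) - 2 * s)"
    and "\<And>x t. x \<in> closure \<Omega> \<Longrightarrow> \<bar>f x t\<bar> \<le> c * (1 + \<bar>t\<bar> powr (q - 1))"
    and "t_star > 0" "\<theta> > 2"
    and "\<And>x \<xi>. x \<in> closure \<Omega> \<Longrightarrow> \<bar>\<xi>\<bar> \<ge> t_star \<Longrightarrow>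
           0 < \<theta> * primitive (f x) \<xi> \<and> \<theta> * primitive (f x) \<xi> \<le> f x \<xi> * \<xi>"
    and "lam < m\<^sub>0 * lambda1 s \<Omega>"
    and "\<And>\<epsilon>. \<epsilon> > 0 \<Longrightarrow> \<exists>\<delta>>0. \<forall>x\<in>closure \<Omega>. \<forall>t. 0 < \<bar>t\<bar> \<and> \<bar>t\<bar> \<le> \<delta> \<longrightarrow> f x t / t \<le> lam + \<epsilon>"
  shows "\<exists>u. weak_solution s \<Omega> M f u \<and> \<not> (AE x in lebesgue. u x = 0)"
proof -
  have \<Omega>: "open \<Omega>" "bounded \<Omega>" "\<Omega> \<noteq> {}"
    using assms(4) by (auto simp: bounded_smooth_domain_def)
  interpret gagliardo_space s \<Omega>
    by unfold_locales (use assms(1-3) \<Omega> in auto)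
  interpret kirchhoff_problem s \<Omega> f c q M "m\<^sub>0" "t\<^sub>0" t_star \<theta> lam "lambda1 s \<Omega>"
    by unfold_locales (use assms \<Omega> lambda1_pos[OF \<Omega>(3)] lambda1_le[OF \<Omega>(3)] in auto)
  obtain u where u: "u \<in> X" "N u > 0" "\<And>a. a \<in> X \<Longrightarrow> M ((N u)\<^sup>2) * B u a = Du u a"
    using solution_exists by blast
  have u0: "u \<in> X0 s \<Omega>" by (rule X_subset_X0[OF u(1)])
  have "weak_solution s \<Omega> M f u"
    unfolding weak_solution_def
  proof (intro conjI ballI u0)
    fix \<phi> assume \<phi>: "\<phi> \<in> X0 s \<Omega>"
    then obtain \<phi>' where \<phi>': "\<phi>' \<in> X" "AE x in lborel. \<phi> x = \<phi>' x" using X0_representative by blast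
    show "set_integrable lebesgue \<Omega> (\<lambda>x. f x (u x) * \<phi> x)" by (rule weak_form_rhs[OF u(1) \<phi> \<phi>'])
    show "M (gagliardo_energy s \<Omega> u) * gagliardo s \<Omega> u \<phi> = (LINT x:\<Omega>|lebesgue. f x (u x) * \<phi> x)"
      using gagliardo_energy_eq[OF u0 u(1)] gagliardo_eq[OF u0 \<phi> u(1) _ \<phi>'] weak_form_rhs(2)[OF u(1) \<phi> \<phi>'] u(3)[OF \<phi>'(1)]
      by simp
  qed
  moreover have "\<not> (AE x in lebesgue. u x = 0)"
  proof
    assume "AE x in lebesgue. u x = 0"
    then have "AE x in lborel. u x = 0" by (simp add: AE_lebesgue_iff)
    from AE_diff_quot_eq[OF this] have "AE p in lborel. diff_quot u p * diff_quot u p = 0"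
      by eventually_elim (simp add: diff_quot_def case_prod_beta)
    then have "B u u = 0" unfolding B_def by (rule integral_eq_zero_AE)
    then show False using u(2) N_sq[OF u(1)] by simp
  qed
  ultimately show ?thesis by blast
qed

end
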